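(* Fix an integer $a \geq 1$. Suppose that the following necklace character sum estimate holds at degree $a$: for every integer $k \geq 1$, \[ \lim_{p \to \infty} p^{-(\frac{k}{2}+1)} \max_{\substack{Z_1, \dots, Z_k \subseteq \mathbb{F}_p,\ Z_i \neq \emptyset \\ |Z_1 \cup \cdots \cup Z_k| \leq a}} |\Sigma(Z_1, \dots, Z_k)| = 0, \] where the limit is over primes $p \equiv 1 \pmod 4$. Then the following weak convergence statement holds at degree $a$: for every choice, for each sufficiently large prime $p \equiv 1 \pmod 4$, of an independent set $I = I_p \in \mathcal{I}_a(G_p)$, the empirical spectral distribution of $\frac{2^{a+1}}{\sqrt{p}} A_{G_{p,I}}$ converges weakly to $\mathsf{KM}(2^a)$ as $p \to \infty$.
   Context: Throughout, $p$ denotes a prime with $p \equiv 1 \pmod 4$, and limits $p\to\infty$ are over such primes. $\mathbb{F}_p = \mathbb{Z}/p\mathbb{Z}$. The Paley graph $G_p$ has vertex set $\mathbb{F}_p$, with $x \sim y$ iff $x - y$ is a nonzero quadratic residue mod $p$. The Legendre symbol $\chi:\mathbb{F}_p \to \{-1,0,1\}$ is $\chi(0)=0$, $\chi(x)=1$ if $x$ is a nonzero square, $\chi(x)=-1$ otherwise. For $Z_1,\dots,Z_k \subseteq \mathbb{F}_p$, the necklace character sum is \[ \Sigma(Z_1,\dots,Z_k) = \sum_{x_1,\dots,x_k \in \mathbb{F}_p} \chi(x_2-x_1)\cdots\chi(x_k-x_{k-1})\chi(x_1-x_k)\prod_{i=1}^k\prod_{z\in Z_i}\chi(x_i - z). \]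 For a graph $G$, $\mathcal{I}_a(G)$ is the set of independent sets of size $a$ in $G$, and $A_G$ is its $\{0,1\}$-valued adjacency matrix. For $X \subseteq \mathbb{F}_p$, $G_{p,X}$ is the subgraph of $G_p$ induced on the set of vertices not in $X$ and not adjacent to any vertex of $X$. The empirical spectral distribution of a real symmetric $n\times n$ matrix $M$ is $\frac{1}{n}\sum_{i=1}^n \delta_{\lambda_i(M)}$. For $v \geq 1$, the Kesten–McKay law $\mathsf{KM}(v)$ is the probability measure on $\mathbb{R}$ with density \[ \mathbb{1}\{|x|\le 2\sqrt{v-1}\}\frac{v\sqrt{4(v-1)-x^2}}{2\pi(v^2-x^2)}\,dx + \frac{\max\{2-v,0\}}{2}\delta_{-v} + \frac{\max\{2-v,0\}}{2}\delta_{v}. \] *)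

theory Defs
  imports
    "HOL-Probability.Probability"
    "HOL-Number_Theory.Number_Theory"
    "Jordan_Normal_Form.Char_Poly"
    "Graph_Theory.Digraph_Component"
begin

section \<open>Necklace character sums\<close>

text \<open>The field with \<open>p\<close> elements is represented by the residues \<open>{0..<int p}\<close>; \<^const>\<open>Legendre\<close> only
  depends on its first argument modulo \<open>p\<close>, so differences need not be reduced.\<close>

definition residue_field :: "nat \<Rightarrow> int set" where
  "residue_field p = {0..<int p}"

definition necklace_sum :: "nat \<Rightarrow> nat \<Rightarrow> (nat \<Rightarrow> int set) \<Rightarrow> int" where
  "necklace_sum p k Z =
     (\<Sum>x \<in> {1..k} \<rightarrow>\<^sub>E residue_field p.
        (\<Prod>i\<in>{1..<k}. Legendre (x (i + 1) - x i) (int p)) * Legendre (x 1 - x k) (int p) *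
        (\<Prod>i\<in>{1..k}. \<Prod>z\<in>Z i. Legendre (x i - z) (int p)))"

definition necklace_tuples :: "nat \<Rightarrow> nat \<Rightarrow> nat \<Rightarrow> (nat \<Rightarrow> int set) set" where
  "necklace_tuples p k a =
     {Z \<in> {1..k} \<rightarrow>\<^sub>E Pow (residue_field p).
        (\<forall>i\<in>{1..k}. Z i \<noteq> {}) \<and> card (\<Union>i\<in>{1..k}. Z i) \<le> a}"

definition primes_1_mod_4 :: "nat filter" where
  "primes_1_mod_4 = inf at_top (principal {p. prime p \<and> [p = 1] (mod 4)})"


section \<open>Paley graphs\<close>

text \<open>Undirected graphs are symmetric digraphs, as in the locale \<^locale>\<open>graph\<close>.\<close>

definition paley_graph :: "nat \<Rightarrow> (int, int \<times> int) pre_digraph" where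
  "paley_graph p =
     \<lparr> verts = residue_field p,
       arcs = {(x, y). x \<in> residue_field p \<and> y \<in> residue_field p \<and>
                 [x - y \<noteq> 0] (mod int p) \<and> QuadRes (int p) (x - y)},
       tail = fst, head = snd \<rparr>"

definition independent_sets :: "nat \<Rightarrow> ('a, 'b) pre_digraph \<Rightarrow> 'a set set" where
  "independent_sets a G =
     {S. S \<subseteq> verts G \<and> finite S \<and> card S = a \<and> (\<forall>x\<in>S. \<forall>y\<in>S. (x, y) \<notin> arcs_ends G)}"

definition paley_localization :: "nat \<Rightarrow> int set \<Rightarrow> (int, int \<times> int) pre_digraph" where
  "paley_localization p X =
     paley_graph p \<restriction>
       {v \<in> verts (paley_graph p). v \<notin> X \<and> (\<forall>x\<in>X. (v, x) \<notin> arcs_ends (paley_graph p))}"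

text \<open>The rows and columns are indexed by the vertices in increasing order.\<close>

definition adjacency_matrix :: "('a::linorder, 'b) pre_digraph \<Rightarrow> real mat" where
  "adjacency_matrix G =
     (let n = card (verts G); vs = sorted_list_of_set (verts G)
      in mat n n (\<lambda>(i, j). if (vs ! i, vs ! j) \<in> arcs_ends G then 1 else 0))"


section \<open>Spectral distributions and weak convergence\<close>

text \<open>The characteristic polynomial of a real symmetric \<open>n \<times> n\<close> matrix splits over the reals, so that
  \<^term>\<open>proots (char_poly M)\<close> is the multiset of its \<open>n\<close> eigenvalues. The value is unspecified for \<open>n = 0\<close>.\<close>

definition empirical_spectral_distribution :: "real mat \<Rightarrow> real measure" where
  "empirical_spectral_distribution M =
     distr (measure_pmf (pmf_of_multiset (proots (char_poly M)))) borel (\<lambda>x. x)"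

definition kesten_mckay_density :: "real \<Rightarrow> real \<Rightarrow> real" where
  "kesten_mckay_density v x =
     (if \<bar>x\<bar> \<le> 2 * sqrt (v - 1)
      then v * sqrt (4 * (v - 1) - x\<^sup>2) / (2 * pi * (v\<^sup>2 - x\<^sup>2)) else 0)"

definition kesten_mckay :: "real \<Rightarrow> real measure" where
  "kesten_mckay v =
     measure_of UNIV (sets borel)
       (\<lambda>A. emeasure (density lborel (\<lambda>x. ennreal (kesten_mckay_density v x))) A
          + ennreal (max (2 - v) 0 / 2) * indicator A (- v)
          + ennreal (max (2 - v) 0 / 2) * indicator A v)"

definition weak_conv_filter :: "('i \<Rightarrow> real measure) \<Rightarrow> real measure \<Rightarrow> 'i filter \<Rightarrow> bool" where
  "weak_conv_filter \<mu> \<nu> F \<longleftrightarrow>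
     (\<forall>f :: real \<Rightarrow> real. continuous_on UNIV f \<longrightarrow> bounded (range f) \<longrightarrow>
        ((\<lambda>i. integral\<^sup>L (\<mu> i) f) \<longlongrightarrow> integral\<^sup>L \<nu> f) F)"

lemma graph_paley_graph:
  assumes "prime p" "[p = 1] (mod 4)"
  shows "graph (paley_graph p)"
proof -
  have odd: "p > 2"
    using assms by (cases "p = 2") (auto simp: cong_def prime_gt_1_nat le_less_Suc_eq
        intro: le_neq_implies_less dest: prime_ge_2_nat)
  have "QuadRes (int p) (- 1)"
  proof -
    have "p mod 4 = 1" using assms(2) by (simp add: cong_def)
    then obtain m where m: "p = 4 * m + 1"
      by (metis mod_div_mult_eq add.commute mult.commute)
    have "[Legendre (- 1) (int p) = (- 1) ^ ((p - 1) div 2)] (mod int p)"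
      using euler_criterion[OF assms(1) odd, of "- 1"] by simp
    moreover have "(- 1 :: int) ^ ((p - 1) div 2) = 1"
      using m by (simp add: mult.assoc power_mult)
    moreover have "\<not> int p dvd 2" using odd zdvd_imp_le by fastforce
    ultimately show ?thesis
      using odd by (auto simp: Legendre_def cong_iff_dvd_diff split: if_splits)
  qed
  then obtain s where s: "[s\<^sup>2 = - 1] (mod int p)" by (auto simp: QuadRes_def)
  have swap: "QuadRes (int p) (y - x)" if "QuadRes (int p) (x - y)" for x y
  proof -
    from that obtain t where "[t\<^sup>2 = x - y] (mod int p)" by (auto simp: QuadRes_def)
    from cong_mult[OF s this] have "[(s * t)\<^sup>2 = y - x] (mod int p)"
      by (simp add: power_mult_distrib)
    then show ?thesis unfolding QuadRes_def by blast
  qed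
  have fin: "finite (arcs (paley_graph p))"
    by (rule finite_subset[of _ "residue_field p \<times> residue_field p"])
      (auto simp: paley_graph_def residue_field_def)
  show ?thesis
  proof (unfold_locales, goal_cases)
    case (4) show ?case by (rule fin)
  next
    case 7
    show ?case
      unfolding symmetric_def sym_def arcs_ends_conv
      using swap by (force simp: paley_graph_def cong_iff_dvd_diff dvd_diff_commute)
  qed (auto simp: paley_graph_def residue_field_def arc_to_ends_def)
qed

lemma sets_kesten_mckay [simp]: "sets (kesten_mckay v) = sets borel"
  by (simp add: kesten_mckay_def sets.sigma_sets_eq[of borel, simplified])

lemma space_kesten_mckay [simp]: "space (kesten_mckay v) = UNIV"
  by (simp add: kesten_mckay_def)

lemma emeasure_kesten_mckay:
  assumes "A \<in> sets borel"
  shows "emeasure (kesten_mckay v) A =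
    (\<integral>\<^sup>+x\<in>A. ennreal (kesten_mckay_density v x) \<partial>lborel)
    + ennreal (max (2 - v) 0 / 2) * indicator A (- v)
    + ennreal (max (2 - v) 0 / 2) * indicator A v"
proof -
  let ?D = "density lborel (\<lambda>x. ennreal (kesten_mckay_density v x))"
  let ?c = "ennreal (max (2 - v) 0 / 2)"
  let ?\<mu> = "\<lambda>A. emeasure ?D A + ?c * indicator A (- v) + ?c * indicator A v"
  have meas: "(\<lambda>x. ennreal (kesten_mckay_density v x)) \<in> borel_measurable lborel"
    unfolding kesten_mckay_density_def by measurable
  have "countably_additive (sets borel) ?\<mu>"
  proof (rule countably_additiveI)
    fix B :: "nat \<Rightarrow> real set"
    assume B: "range B \<subseteq> sets borel" "disjoint_family B" "(\<Union>i. B i) \<in> sets borel"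
    have "(\<Sum>i. ?\<mu> (B i)) =
        (\<Sum>i. emeasure ?D (B i)) + ?c * (\<Sum>i. indicator (B i) (- v)) + ?c * (\<Sum>i. indicator (B i) v)"
      by (simp add: suminf_add[symmetric])
    also have "\<dots> = ?\<mu> (\<Union>i. B i)"
      using B by (subst suminf_emeasure) (auto simp: suminf_indicator)
    finally show "(\<Sum>i. ?\<mu> (B i)) = ?\<mu> (\<Union>i. B i)" .
  qed
  then have "emeasure (kesten_mckay v) A = ?\<mu> A"
    using assms sets.sigma_algebra_axioms[of borel]
    unfolding kesten_mckay_def
    by (intro emeasure_measure_of_sigma) (auto simp: positive_def)
  then show ?thesis
    using assms meas by (simp add: emeasure_density)
qed

text \<open>For sequences of probability measures, \<^const>\<open>weak_conv_filter\<close> is \<^const>\<open>weak_conv_m\<close>.\<close>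

lemma weak_conv_filter_sequentially:
  assumes "\<And>n. real_distribution (\<mu> n)" "real_distribution \<nu>"
  shows "weak_conv_filter \<mu> \<nu> sequentially \<longleftrightarrow> weak_conv_m \<mu> \<nu>"
proof
  assume *: "weak_conv_filter \<mu> \<nu> sequentially"
  show "weak_conv_m \<mu> \<nu>"
  proof (rule integral_bdd_continuous_conv_imp_weak_conv[OF assms])
    fix f :: "real \<Rightarrow> real"
    assume f: "\<And>x. isCont f x" "\<And>x. \<bar>f x\<bar> \<le> 1"
    then have "continuous_on UNIV f" "bounded (range f)"
      by (auto simp: continuous_on_eq_continuous_at bounded_iff)
    then show "(\<lambda>n. integral\<^sup>L (\<mu> n) f) \<longlonglongrightarrow> integral\<^sup>L \<nu> f"
      using * by (simp add: weak_conv_filter_def)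
  qed
next
  assume *: "weak_conv_m \<mu> \<nu>"
  show "weak_conv_filter \<mu> \<nu> sequentially"
    unfolding weak_conv_filter_def
  proof (intro allI impI)
    fix f :: "real \<Rightarrow> real"
    assume f: "continuous_on UNIV f" "bounded (range f)"
    then obtain B where "\<And>x. norm (f x) \<le> B" by (auto simp: bounded_iff)
    with f(1) show "(\<lambda>n. integral\<^sup>L (\<mu> n) f) \<longlonglongrightarrow> integral\<^sup>L \<nu> f"
      by (intro weak_conv_imp_integral_bdd_continuous_conv[OF assms *])
        (auto simp: continuous_on_eq_continuous_at)
  qed
qed

end

theory Submission
  imports Defs
begin

text \<open>
  Let \<open>v = 2 ^ a\<close>, let \<open>E\<close> be the coordinate projection onto the vertices of the localization and put
  \<open>R = v E - 1\<close>. The matrix \<open>s = (chi (x - y) / sqrt p + 1 / p)\<close> is an exact symmetric involution, and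
  up to a rank one term and a small multiple of the identity the normalized adjacency matrix is the
  compression of \<open>v s\<close> to the range of \<open>E\<close>. From \<open>s\<^sup>2 = 1\<close> and \<open>R = v E - 1\<close> one sees that the
  non-backtracking polynomials of the \<open>v\<close>-regular tree (the orthogonal polynomials of the Kesten-McKay
  law) send this compression to \<open>v E s R s R \<dots> s E\<close>. The trace of such a word reduces, by cyclicity and
  \<open>R\<^sup>2 = (v - 2) R + (v - 1)\<close>, to traces of \<open>(s R) ^ k\<close> and of \<open>R\<close>. Away from the independent set \<open>R\<close> is a
  signed sum of products of characters over non-empty subsets of it, so that these traces are
  necklace sums up to bounded errors coming from finite rank perturbations. Hence the means of all
  orthogonal polynomials tend to zero, which determines the limit law on a compact interval. The rank
  one term moves the eigenvalue counting function by at most one.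
\<close>

section \<open>Spectral theorem for symmetric kernels on finite sets\<close>

text \<open>The hypothesis is used only through traces known up to \<open>o (p)\<close>, so errors
  bounded in \<open>p\<close> are harmless. The constant 1 subtracted in \<open>R\<close> is the
  contribution of the empty subset when the product of the factors \<open>1 - chi (x - z)\<close>
  over the independent set is expanded; with it removed, every remaining term carries non-empty
  sets, exactly as the hypothesis demands. The raw matrix \<open>chi (x - y) / sqrt p\<close>
  squares only to the identity minus the projection onto constants. The summand \<open>1 / p\<close>
  repairs this, so that the algebra of words is exact and errors enter only when traces are
  translated back into necklace sums. The rank one term left in the adjacency matrix has norm of
  order \<open>sqrt p\<close>, so high moments of that matrix diverge; this is why the term is
  removed through counting functions and not through moments. The case \<open>k = 2\<close> with
  equal sets moreover yields that \<open>card V / p\<close> tends to \<open>1 / v\<close>, the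
  normalization of the distributions.\<close>

definition eigenbasis :: "'a set \<Rightarrow> ('a \<Rightarrow> 'a \<Rightarrow> real) \<Rightarrow> ('a \<Rightarrow> real) \<Rightarrow> ('a \<Rightarrow> 'a \<Rightarrow> real) \<Rightarrow> bool" where
  "eigenbasis V K l u \<longleftrightarrow>
     (\<forall>i\<in>V. \<forall>x\<in>V. (\<Sum>y\<in>V. K x y * u i y) = l i * u i x) \<and>
     (\<forall>i\<in>V. \<forall>j\<in>V. (\<Sum>x\<in>V. u i x * u j x) = of_bool (i = j)) \<and>
     (\<forall>x\<in>V. \<forall>y\<in>V. (\<Sum>i\<in>V. u i x * u i y) = of_bool (x = y))"

lemma sum_mult_delta:
  fixes f :: "'a \<Rightarrow> real"
  assumes "finite V" "x \<in> V"
  shows "(\<Sum>z\<in>V. f z * of_bool (z = x)) = f x" "(\<Sum>z\<in>V. f z * of_bool (x = z)) = f x"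
    "(\<Sum>z\<in>V. of_bool (z = x) * f z) = f x" "(\<Sum>z\<in>V. of_bool (x = z) * f z) = f x"
proof -
  have "f z * of_bool (z = x) = (if z = x then f z else 0)" "f z * of_bool (x = z) = (if z = x then f z else 0)"
    "of_bool (z = x) * f z = (if z = x then f z else 0)" "of_bool (x = z) * f z = (if z = x then f z else 0)" for z
    by auto
  then show "(\<Sum>z\<in>V. f z * of_bool (z = x)) = f x" "(\<Sum>z\<in>V. f z * of_bool (x = z)) = f x"
    "(\<Sum>z\<in>V. of_bool (z = x) * f z) = f x" "(\<Sum>z\<in>V. of_bool (x = z) * f z) = f x"
    using assms by simp_all
qed

text \<open>Over the complex numbers some eigenvalue \<open>z\<close> exists. The Hermitian form
  \<open>Q\<close> at its eigenvector is \<open>z\<close> times the squared norm and, by symmetry of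
  \<open>A\<close>, equals its own conjugate. Hence \<open>z\<close> is real and a root of the real
  characteristic polynomial.\<close>

lemma symmetric_mat_eigenvalue_exists:
  fixes A :: "real mat"
  assumes A: "A \<in> carrier_mat n n" and n: "n > 0"
    and sym: "\<And>i j. i < n \<Longrightarrow> j < n \<Longrightarrow> A $$ (i, j) = A $$ (j, i)"
  shows "\<exists>k. eigenvalue A k"
proof -
  define C where "C = map_mat complex_of_real A"
  have C: "C \<in> carrier_mat n n" using A by (simp add: C_def)
  have cp: "char_poly C = map_poly complex_of_real (char_poly A)"
    unfolding C_def by (rule of_real_hom.char_poly_hom[OF A])
  have "degree (char_poly C) = n" using degree_monic_char_poly[OF C] by simp
  then have "\<not> constant (poly (char_poly C))" using n by (simp add: constant_degree)
  then obtain z where z: "poly (char_poly C) z = 0" using fundamental_theorem_of_algebra by blast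
  then have "eigenvalue C z" using eigenvalue_root_char_poly[OF C] by simp
  then obtain w where w: "w \<in> carrier_vec n" "w \<noteq> 0\<^sub>v n" "C *\<^sub>v w = z \<cdot>\<^sub>v w"
    using C by (auto simp: eigenvalue_def eigenvector_def)
  have eq: "(\<Sum>j<n. complex_of_real (A $$ (i, j)) * w $ j) = z * w $ i" if "i < n" for i
  proof -
    have "(C *\<^sub>v w) $ i = (\<Sum>j<n. C $$ (i, j) * w $ j)"
      using C w(1) that by (simp add: scalar_prod_def atLeast0LessThan)
    also have "\<dots> = (\<Sum>j<n. complex_of_real (A $$ (i, j)) * w $ j)"
      using A that by (intro sum.cong) (auto simp: C_def)
    finally show ?thesis using w(1,3) that by simp
  qed
  define Q where "Q = (\<Sum>i<n. \<Sum>j<n. cnj (w $ i) * complex_of_real (A $$ (i, j)) * w $ j)"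
  define N where "N = (\<Sum>i<n. (cmod (w $ i))\<^sup>2)"
  have "Q = (\<Sum>i<n. cnj (w $ i) * (z * w $ i))"
    unfolding Q_def by (intro sum.cong) (simp_all add: eq[symmetric] sum_distrib_left mult.assoc)
  also have "\<dots> = z * complex_of_real N"
    unfolding N_def of_real_sum sum_distrib_left complex_norm_square by (simp add: mult_ac)
  finally have Q: "Q = z * complex_of_real N" .
  have "cnj Q = (\<Sum>i<n. \<Sum>j<n. cnj (w $ j) * complex_of_real (A $$ (i, j)) * w $ i)"
    unfolding Q_def cnj_sum by (intro sum.cong) (simp_all add: mult_ac)
  also have "\<dots> = (\<Sum>j<n. \<Sum>i<n. cnj (w $ j) * complex_of_real (A $$ (i, j)) * w $ i)"
    by (rule sum.swap)
  also have "\<dots> = Q" unfolding Q_def by (intro sum.cong) (simp_all add: sym)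
  finally have "cnj Q = Q" .
  obtain i0 where i0: "i0 < n" "w $ i0 \<noteq> 0" using w(1,2) by (metis eq_vecI index_zero_vec carrier_vecD)
  have "(cmod (w $ i0))\<^sup>2 \<le> N" unfolding N_def using i0 by (intro member_le_sum) auto
  then have "N > 0" using i0 by (smt (verit) zero_less_norm_iff zero_less_power)
  from \<open>cnj Q = Q\<close> have "cnj z = z" using Q \<open>N > 0\<close> by simp
  then have "z = complex_of_real (Re z)" by (simp add: complex_eq_iff)
  then have "complex_of_real (poly (char_poly A) (Re z)) = 0"
    using z cp by (metis of_real_hom.poly_map_poly)
  then have "poly (char_poly A) (Re z) = 0" by simp
  then show ?thesis using eigenvalue_root_char_poly[OF A] by blast
qed

lemma symmetric_kernel_eigenvector_exists:
  fixes K :: "'a \<Rightarrow> 'a \<Rightarrow> real"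
  assumes fin: "finite V" and ne: "V \<noteq> {}"
    and sym: "\<And>x y. x \<in> V \<Longrightarrow> y \<in> V \<Longrightarrow> K x y = K y x"
  shows "\<exists>k f. (\<Sum>x\<in>V. (f x)\<^sup>2) = 1 \<and> (\<forall>x\<in>V. (\<Sum>y\<in>V. K x y * f y) = k * f x)"
proof -
  obtain vs where vs: "set vs = V" "distinct vs" using finite_distinct_list[OF fin] by blast
  define n where "n = length vs"
  have bij: "bij_betw (\<lambda>i. vs ! i) {..<n} V"
    using bij_betw_nth[OF vs(2)] vs(1) by (auto simp: n_def)
  have n: "n > 0" using ne vs by (auto simp: n_def)
  define A where "A = mat n n (\<lambda>(i, j). K (vs ! i) (vs ! j))"
  have A: "A \<in> carrier_mat n n" by (simp add: A_def)
  have inV: "vs ! i \<in> V" if "i < n" for i using that vs by (auto simp: n_def)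
  obtain k where "eigenvalue A k"
    using symmetric_mat_eigenvalue_exists[OF A n] sym inV by (auto simp: A_def)
  then obtain w where w: "w \<in> carrier_vec n" "w \<noteq> 0\<^sub>v n" "A *\<^sub>v w = k \<cdot>\<^sub>v w"
    using A by (auto simp: eigenvalue_def eigenvector_def)
  define g where "g x = w $ (the_inv_into {..<n} (\<lambda>i. vs ! i) x)" for x
  have g: "g (vs ! i) = w $ i" if "i < n" for i
    unfolding g_def using that bij by (subst the_inv_into_f_f) (auto simp: bij_betw_def)
  have eq: "(\<Sum>y\<in>V. K x y * g y) = k * g x" if xV: "x \<in> V" for x
  proof -
    obtain i where i: "i < n" "x = vs ! i" using xV bij unfolding bij_betw_def by blast
    have "(\<Sum>y\<in>V. K x y * g y) = (\<Sum>j<n. K x (vs ! j) * g (vs ! j))"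
      by (rule sum.reindex_bij_betw[OF bij, symmetric])
    also have "\<dots> = (A *\<^sub>v w) $ i"
      using i w(1) by (simp add: A_def scalar_prod_def atLeast0LessThan g)
    finally show ?thesis using w i g by simp
  qed
  obtain i0 where i0: "i0 < n" "w $ i0 \<noteq> 0" using w(1,2) by (metis eq_vecI index_zero_vec carrier_vecD)
  define N where "N = (\<Sum>x\<in>V. (g x)\<^sup>2)"
  have "(g (vs ! i0))\<^sup>2 \<le> N" unfolding N_def using i0 inV fin by (intro member_le_sum) auto
  moreover have "(g (vs ! i0))\<^sup>2 > 0" using i0 g by simp
  ultimately have N: "N > 0" by linarith
  define f where "f x = g x / sqrt N" for x
  have "(\<Sum>x\<in>V. (f x)\<^sup>2) = N / N"
    using N by (simp add: f_def power_divide sum_divide_distrib[symmetric] N_def)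
  moreover have "(\<Sum>y\<in>V. K x y * f y) = k * f x" if "x \<in> V" for x
    using eq[OF that] by (simp add: f_def sum_divide_distrib[symmetric])
  ultimately show ?thesis using N by auto
qed

text \<open>Deflation: conjugating \<open>K\<close> with a reflection that exchanges a unit
  eigenvector with the basis vector at \<open>x0\<close> decouples \<open>x0\<close>, and the
  induction hypothesis applies to \<open>V - {x0}\<close>. Labelling eigenvectors by the elements of
  \<open>V\<close> lets \<open>x0\<close> itself be the label of the removed one.\<close>

lemma symmetric_kernel_eigenbasis_exists:
  fixes K :: "'a \<Rightarrow> 'a \<Rightarrow> real"
  assumes "finite V" and "\<And>x y. x \<in> V \<Longrightarrow> y \<in> V \<Longrightarrow> K x y = K y x"
  shows "\<exists>l u. eigenbasis V K l u"
  using assms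
proof (induction "card V" arbitrary: V K)
  case 0
  then show ?case by (auto simp: eigenbasis_def)
next
  case (Suc m)
  have fin: "finite V" by fact
  have ne: "V \<noteq> {}" using Suc.hyps(2) by auto
  then obtain x0 where x0: "x0 \<in> V" by blast
  have sym: "\<And>x y. x \<in> V \<Longrightarrow> y \<in> V \<Longrightarrow> K x y = K y x" by fact
  obtain k f where f1: "(\<Sum>x\<in>V. (f x)\<^sup>2) = 1"
    and fk: "\<And>x. x \<in> V \<Longrightarrow> (\<Sum>y\<in>V. K x y * f y) = k * f x"
    using symmetric_kernel_eigenvector_exists[of V K, OF fin ne sym] by blast
  \<comment> \<open>A symmetric orthogonal matrix \<open>H\<close> (a Householder reflection) that maps the basis vector of \<open>x0\<close> to \<open>f\<close>.\<close>
  obtain H :: "'a \<Rightarrow> 'a \<Rightarrow> real" where Hsym: "\<And>x y. H x y = H y x"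
    and Hinv: "\<And>x y. x \<in> V \<Longrightarrow> y \<in> V \<Longrightarrow> (\<Sum>z\<in>V. H x z * H z y) = of_bool (x = y)"
    and Hf: "\<And>x. x \<in> V \<Longrightarrow> H x x0 = f x"
  proof (cases "\<forall>x\<in>V. f x = of_bool (x = x0)")
    case True
    show thesis
      by (rule that[of "\<lambda>x y. of_bool (x = y)"])
        (use True fin in \<open>auto simp: sum_mult_delta simp del: sum_mult_of_bool_eq sum_of_bool_mult_eq\<close>)
  next
    case False
    define w where "w x = of_bool (x = x0) - f x" for x
    define N where "N = (\<Sum>x\<in>V. w x * w x)"
    have f1': "(\<Sum>x\<in>V. f x * f x) = 1" using f1 by (simp add: power2_eq_square)
    have "N = (\<Sum>x\<in>V. of_bool (x = x0) - 2 * (of_bool (x = x0) * f x) + f x * f x)"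
      unfolding N_def by (intro sum.cong) (auto simp: w_def algebra_simps)
    also have "\<dots> = 1 - 2 * f x0 + 1"
      unfolding sum.distrib sum_subtractf sum_distrib_left[symmetric] sum_mult_delta[OF fin x0] f1'
      using sum_mult_delta(1)[OF fin x0, of "\<lambda>_. 1"] by simp
    \<comment> \<open>Both the basis vector and \<open>f\<close> have norm one, which makes
      \<open>N\<close> twice the entry of \<open>w\<close> at \<open>x0\<close>. Exactly this makes
      the reflection along \<open>w\<close> exchange the two vectors.\<close>
    finally have N: "N = 2 * w x0" by (simp add: w_def)
    from False obtain x where x: "x \<in> V" "w x \<noteq> 0" by (auto simp: w_def)
    have "w x * w x \<le> N" unfolding N_def using x fin by (intro member_le_sum) auto
    moreover have "w x * w x > 0" using x by (metis not_real_square_gt_zero)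
    ultimately have N0: "N > 0" by linarith
    show thesis
    proof (rule that[of "\<lambda>x y. of_bool (x = y) - 2 * w x * w y / N"])
      fix x y assume xy: "x \<in> V" "y \<in> V"
      have "(\<Sum>z\<in>V. (of_bool (x = z) - 2 * w x * w z / N) * (of_bool (z = y) - 2 * w z * w y / N))
         = (\<Sum>z\<in>V. of_bool (x = z) * of_bool (z = y) - of_bool (x = z) * (2 * w z * w y / N)
               - of_bool (z = y) * (2 * w x * w z / N) + (4 * w x * w y / (N * N)) * (w z * w z))"
        by (intro sum.cong) (auto simp: algebra_simps)
      also have "\<dots> = of_bool (x = y) - 2 * w x * w y / N - 2 * w x * w y / N + (4 * w x * w y / (N * N)) * N"
        unfolding N_def sum.distrib sum_subtractf sum_distrib_left[symmetric]
          sum_mult_delta[OF fin xy(1)] sum_mult_delta[OF fin xy(2)] ..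
      also have "\<dots> = of_bool (x = y)" using N0 by (simp add: field_simps)
      finally show "(\<Sum>z\<in>V. (of_bool (x = z) - 2 * w x * w z / N) * (of_bool (z = y) - 2 * w z * w y / N))
         = of_bool (x = y)" .
    next
      fix x assume "x \<in> V"
      show "of_bool (x = x0) - 2 * w x * w x0 / N = f x"
      proof -
        have "2 * w x * w x0 / N = w x" using N N0 by simp
        then show ?thesis by (simp add: w_def)
      qed
    qed (auto simp: mult_ac)
  qed
  \<comment> \<open>\<open>K'\<close> is the product \<open>H K H\<close>; its row and column at
    \<open>x0\<close> will turn out to be zero off the diagonal.\<close>
  define K' where "K' x y = (\<Sum>z\<in>V. \<Sum>t\<in>V. H x z * K z t * H t y)" for x y
  define V' where "V' = V - {x0}"
  have V: "V = insert x0 V'" "x0 \<notin> V'" "finite V'" using x0 fin by (auto simp: V'_def)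
  have K'sym: "K' x y = K' y x" for x y
  proof -
    have "K' x y = (\<Sum>t\<in>V. \<Sum>z\<in>V. H x z * K z t * H t y)" unfolding K'_def by (rule sum.swap)
    also have "\<dots> = K' y x" unfolding K'_def
      by (intro sum.cong refl) (simp add: Hsym[of x] Hsym[of _ y] sym mult_ac)
    finally show ?thesis .
  qed
  have HK': "(\<Sum>x\<in>V. H r x * K' x y) = (\<Sum>t\<in>V. K r t * H t y)" if "r \<in> V" for r y
  proof -
    have "(\<Sum>x\<in>V. H r x * K' x y) = (\<Sum>x\<in>V. \<Sum>z\<in>V. H r x * H x z * (\<Sum>t\<in>V. K z t * H t y))"
      unfolding K'_def by (simp add: sum_distrib_left mult_ac)
    also have "\<dots> = (\<Sum>z\<in>V. (\<Sum>x\<in>V. H r x * H x z) * (\<Sum>t\<in>V. K z t * H t y))"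
      by (subst sum.swap) (simp add: sum_distrib_right)
    also have "\<dots> = (\<Sum>z\<in>V. of_bool (r = z) * (\<Sum>t\<in>V. K z t * H t y))"
      using Hinv that by (intro sum.cong) auto
    also have "\<dots> = (\<Sum>t\<in>V. K r t * H t y)"
      by (rule sum_mult_delta[OF fin that])
    finally show ?thesis .
  qed
  have K'0: "K' x x0 = k * of_bool (x = x0)" if "x \<in> V" for x
  proof -
    have "K' x x0 = (\<Sum>z\<in>V. H x z * (\<Sum>t\<in>V. K z t * f t))"
      unfolding K'_def sum_distrib_left by (intro sum.cong refl) (simp add: Hf mult_ac)
    also have "\<dots> = (\<Sum>z\<in>V. H x z * (k * H z x0))"
      by (intro sum.cong refl) (simp add: fk Hf)
    also have "\<dots> = k * (\<Sum>z\<in>V. H x z * H z x0)"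
      by (simp add: sum_distrib_left mult_ac)
    finally show ?thesis using Hinv that x0 by simp
  qed
  have "card V' = m" using Suc.hyps(2) V by simp
  then obtain l u where "eigenbasis V' K' l u"
    using Suc.hyps(1)[of V' K'] V(3) K'sym by metis
  then have eb: "\<And>i x. i \<in> V' \<Longrightarrow> x \<in> V' \<Longrightarrow> (\<Sum>y\<in>V'. K' x y * u i y) = l i * u i x"
     "\<And>i j. i \<in> V' \<Longrightarrow> j \<in> V' \<Longrightarrow> (\<Sum>x\<in>V'. u i x * u j x) = of_bool (i = j)"
     "\<And>x y. x \<in> V' \<Longrightarrow> y \<in> V' \<Longrightarrow> (\<Sum>i\<in>V'. u i x * u i y) = of_bool (x = y)"
    by (auto simp: eigenbasis_def)
  \<comment> \<open>The eigenbasis of the smaller block is completed by the basis vector at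
    \<open>x0\<close>; \<open>u3\<close> below carries it back through \<open>H\<close>.\<close>
  define l2 where "l2 = l(x0 := k)"
  define u2 where "u2 i x = (if i = x0 \<or> x = x0 then of_bool (i = x) else u i x)" for i x
  have neq: "i \<noteq> x0" if "i \<in> V'" for i using that V by auto
  have e2: "(\<Sum>y\<in>V. K' x y * u2 i y) = l2 i * u2 i x" if i: "i \<in> V" and x: "x \<in> V" for i x
  proof (cases "i = x0")
    case True
    have "(\<Sum>y\<in>V. K' x y * u2 i y) = (\<Sum>y\<in>V. K' x y * of_bool (y = x0))"
      using True by (intro sum.cong) (auto simp: u2_def)
    also have "\<dots> = K' x x0" by (rule sum_mult_delta[OF fin x0])
    finally show ?thesis using K'0[OF x] True by (auto simp: u2_def l2_def)
  next
    case False
    then have i': "i \<in> V'" using i by (auto simp: V'_def)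
    have *: "(\<Sum>y\<in>V. K' x y * u2 i y) = (\<Sum>y\<in>V'. K' x y * u i y)"
      unfolding V(1) using V(2,3) False neq
      by (subst sum.insert) (auto simp: u2_def intro!: sum.cong)
    show ?thesis
    proof (cases "x = x0")
      case True
      have "K' x y = 0" if "y \<in> V'" for y
        using K'0[of y] K'sym[of x y] True that neq by (auto simp: V'_def)
      then show ?thesis unfolding * using True False by (simp add: u2_def)
    next
      case F2: False
      then show ?thesis unfolding * using eb(1)[OF i', of x] x False by (auto simp: V'_def u2_def l2_def)
    qed
  qed
  have o2: "(\<Sum>x\<in>V. u2 i x * u2 j x) = of_bool (i = j)" if "i \<in> V" "j \<in> V" for i j
  proof (cases "i = x0 \<or> j = x0")
    case True
    have "(\<Sum>x\<in>V. u2 i x * u2 j x) = (\<Sum>x\<in>V. of_bool (x = x0) * of_bool (i = j))"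
      using True that by (intro sum.cong) (auto simp: u2_def)
    then show ?thesis unfolding sum_mult_delta[OF fin x0] .
  next
    case False
    then show ?thesis using that eb(2)[of i j] V(2,3) neq
      unfolding V(1) by (subst sum.insert) (auto simp: u2_def intro!: sum.cong)
  qed
  have c2: "(\<Sum>i\<in>V. u2 i x * u2 i y) = of_bool (x = y)" if "x \<in> V" "y \<in> V" for x y
  proof (cases "x = x0 \<or> y = x0")
    case True
    have "(\<Sum>i\<in>V. u2 i x * u2 i y) = (\<Sum>i\<in>V. of_bool (i = x0) * of_bool (x = y))"
      using True that by (intro sum.cong) (auto simp: u2_def)
    then show ?thesis unfolding sum_mult_delta[OF fin x0] .
  next
    case False
    then show ?thesis using that eb(3)[of x y] V(2,3) neq
      unfolding V(1) by (subst sum.insert) (auto simp: u2_def intro!: sum.cong)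
  qed
  define u3 where "u3 i x = (\<Sum>z\<in>V. H x z * u2 i z)" for i x
  have e3: "(\<Sum>y\<in>V. K x y * u3 i y) = l2 i * u3 i x" if i: "i \<in> V" and x: "x \<in> V" for i x
  proof -
    have "(\<Sum>y\<in>V. K x y * u3 i y) = (\<Sum>y\<in>V. \<Sum>z\<in>V. K x y * H y z * u2 i z)"
      unfolding u3_def by (simp add: sum_distrib_left mult_ac)
    also have "\<dots> = (\<Sum>z\<in>V. (\<Sum>y\<in>V. K x y * H y z) * u2 i z)"
      by (subst sum.swap) (simp add: sum_distrib_right)
    also have "\<dots> = (\<Sum>z\<in>V. \<Sum>y\<in>V. H x y * K' y z * u2 i z)"
      unfolding sum_distrib_right[symmetric] HK'[OF x] ..
    also have "\<dots> = (\<Sum>y\<in>V. H x y * (\<Sum>z\<in>V. K' y z * u2 i z))"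
      by (subst sum.swap) (simp add: sum_distrib_left mult_ac)
    also have "\<dots> = (\<Sum>y\<in>V. H x y * (l2 i * u2 i y))"
      by (intro sum.cong refl) (simp add: e2 i)
    also have "\<dots> = l2 i * u3 i x"
      unfolding u3_def by (simp add: sum_distrib_left mult_ac)
    finally show ?thesis .
  qed
  have o3: "(\<Sum>x\<in>V. u3 i x * u3 j x) = of_bool (i = j)" if "i \<in> V" "j \<in> V" for i j
  proof -
    have "(\<Sum>x\<in>V. u3 i x * u3 j x) = (\<Sum>x\<in>V. \<Sum>z\<in>V. \<Sum>t\<in>V. u2 i z * u2 j t * (H z x * H x t))"
      unfolding u3_def sum_product by (intro sum.cong refl) (simp add: Hsym mult_ac)
    also have "\<dots> = (\<Sum>z\<in>V. \<Sum>x\<in>V. \<Sum>t\<in>V. u2 i z * u2 j t * (H z x * H x t))" by (rule sum.swap)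
    also have "\<dots> = (\<Sum>z\<in>V. \<Sum>t\<in>V. u2 i z * u2 j t * (\<Sum>x\<in>V. H z x * H x t))"
      by (rule sum.cong[OF refl], subst sum.swap) (simp add: sum_distrib_left)
    also have "\<dots> = (\<Sum>z\<in>V. \<Sum>t\<in>V. u2 i z * u2 j t * of_bool (z = t))"
      by (intro sum.cong refl) (simp add: Hinv)
    also have "\<dots> = (\<Sum>z\<in>V. u2 i z * u2 j z)"
      by (intro sum.cong refl sum_mult_delta[OF fin])
    finally show ?thesis using o2[OF that] by simp
  qed
  have c3: "(\<Sum>i\<in>V. u3 i x * u3 i y) = of_bool (x = y)" if "x \<in> V" "y \<in> V" for x y
  proof -
    have "(\<Sum>i\<in>V. u3 i x * u3 i y) = (\<Sum>i\<in>V. \<Sum>z\<in>V. \<Sum>t\<in>V. H x z * H t y * (u2 i z * u2 i t))"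
      unfolding u3_def sum_product by (intro sum.cong refl) (simp add: Hsym[of _ y] mult_ac)
    also have "\<dots> = (\<Sum>z\<in>V. \<Sum>i\<in>V. \<Sum>t\<in>V. H x z * H t y * (u2 i z * u2 i t))" by (rule sum.swap)
    also have "\<dots> = (\<Sum>z\<in>V. \<Sum>t\<in>V. H x z * H t y * (\<Sum>i\<in>V. u2 i z * u2 i t))"
      by (rule sum.cong[OF refl], subst sum.swap) (simp add: sum_distrib_left)
    also have "\<dots> = (\<Sum>z\<in>V. \<Sum>t\<in>V. H x z * H t y * of_bool (z = t))"
      by (intro sum.cong refl) (simp add: c2)
    also have "\<dots> = (\<Sum>z\<in>V. H x z * H z y)"
      by (intro sum.cong refl sum_mult_delta[OF fin])
    finally show ?thesis using Hinv[OF that] by simp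
  qed
  show ?case unfolding eigenbasis_def using e3 o3 c3 by blast
qed

lemma eigenbasisD:
  assumes "eigenbasis V K l u"
  shows "i \<in> V \<Longrightarrow> x \<in> V \<Longrightarrow> (\<Sum>y\<in>V. K x y * u i y) = l i * u i x"
    and "i \<in> V \<Longrightarrow> j \<in> V \<Longrightarrow> (\<Sum>x\<in>V. u i x * u j x) = of_bool (i = j)"
    and "x \<in> V \<Longrightarrow> y \<in> V \<Longrightarrow> (\<Sum>i\<in>V. u i x * u i y) = of_bool (x = y)"
  using assms by (auto simp: eigenbasis_def)

lemma eigenbasis_shift:
  assumes "finite V" "eigenbasis V K l u"
  shows "eigenbasis V (\<lambda>x y. K x y - d * of_bool (x = y)) (\<lambda>i. l i - d) u"
proof -
  have "(\<Sum>y\<in>V. (K x y - d * of_bool (x = y)) * u i y) = (l i - d) * u i x" if "i \<in> V" "x \<in> V" for i x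
  proof -
    have "(\<Sum>y\<in>V. (K x y - d * of_bool (x = y)) * u i y) = (\<Sum>y\<in>V. K x y * u i y - d * (of_bool (x = y) * u i y))"
      by (simp add: left_diff_distrib mult.assoc)
    also have "\<dots> = l i * u i x - d * u i x"
      unfolding sum_subtractf sum_distrib_left[symmetric] sum_mult_delta[OF assms(1) that(2)]
      using eigenbasisD(1)[OF assms(2) that] by simp
    finally show ?thesis by (simp add: left_diff_distrib)
  qed
  then show ?thesis using assms(2) unfolding eigenbasis_def by blast
qed

text \<open>The two orthogonality relations in \<open>eigenbasis\<close> make the eigenvector
  matrices \<open>P\<close> and \<open>Q\<close> inverse to each other on both sides, so the matrix
  is similar to a diagonal one. The sorted enumeration of \<open>V\<close> is that of
  \<open>adjacency_matrix\<close>.\<close>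

lemma proots_char_poly_eigenbasis:
  fixes K :: "'a::linorder \<Rightarrow> 'a \<Rightarrow> real"
  assumes fin: "finite V" and eb: "eigenbasis V K l u"
  shows "proots (char_poly (mat (card V) (card V)
           (\<lambda>(i, j). K (sorted_list_of_set V ! i) (sorted_list_of_set V ! j)))) = image_mset l (mset_set V)"
proof -
  define vs where "vs = sorted_list_of_set V"
  define n where "n = card V"
  define A where "A = mat n n (\<lambda>(i, j). K (vs ! i) (vs ! j))"
  define P where "P = mat n n (\<lambda>(i, j). u (vs ! j) (vs ! i))"
  define Q where "Q = mat n n (\<lambda>(i, j). u (vs ! i) (vs ! j))"
  define D where "D = mat_diag n (\<lambda>i. l (vs ! i))"
  have len: "length vs = n" using fin by (simp add: vs_def n_def)
  have vs: "distinct vs" "set vs = V" using fin by (simp_all add: vs_def)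
  have bij: "bij_betw (\<lambda>i. vs ! i) {..<n} V"
    by (rule bij_betw_nth) (use vs len in simp_all)
  have inV: "vs ! i \<in> V" if "i < n" for i using that bij by (auto simp: bij_betw_def)
  have inj: "vs ! i = vs ! j \<longleftrightarrow> i = j" if "i < n" "j < n" for i j
    using that bij by (auto simp: bij_betw_def inj_on_def)
  have sumV: "(\<Sum>j<n. g (vs ! j)) = (\<Sum>y\<in>V. g y)" for g :: "'a \<Rightarrow> real"
    by (rule sum.reindex_bij_betw[OF bij])
  have carr: "A \<in> carrier_mat n n" "P \<in> carrier_mat n n" "Q \<in> carrier_mat n n" "D \<in> carrier_mat n n"
    by (simp_all add: A_def P_def Q_def D_def)
  have PQ: "P * Q = 1\<^sub>m n"
  proof (rule eq_matI)
    fix i j assume "i < dim_row (1\<^sub>m n :: real mat)" "j < dim_col (1\<^sub>m n :: real mat)"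
    then have ij: "i < n" "j < n" by auto
    then have "(P * Q) $$ (i, j) = (\<Sum>k<n. u (vs ! k) (vs ! i) * u (vs ! k) (vs ! j))"
      by (simp add: P_def Q_def scalar_prod_def atLeast0LessThan)
    also have "\<dots> = of_bool (vs ! i = vs ! j)"
      using eigenbasisD(3)[OF eb inV inV] ij
      by (simp add: sumV[of "\<lambda>k. u k (vs ! i) * u k (vs ! j)"])
    finally show "(P * Q) $$ (i, j) = 1\<^sub>m n $$ (i, j)" using ij inj by simp
  qed (simp_all add: P_def Q_def)
  have QP: "Q * P = 1\<^sub>m n"
  proof (rule eq_matI)
    fix i j assume "i < dim_row (1\<^sub>m n :: real mat)" "j < dim_col (1\<^sub>m n :: real mat)"
    then have ij: "i < n" "j < n" by auto
    then have "(Q * P) $$ (i, j) = (\<Sum>k<n. u (vs ! i) (vs ! k) * u (vs ! j) (vs ! k))"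
      by (simp add: P_def Q_def scalar_prod_def atLeast0LessThan)
    also have "\<dots> = of_bool (vs ! i = vs ! j)"
      using eigenbasisD(2)[OF eb inV inV] ij
      by (simp add: sumV[of "\<lambda>k. u (vs ! i) k * u (vs ! j) k"])
    finally show "(Q * P) $$ (i, j) = 1\<^sub>m n $$ (i, j)" using ij inj by simp
  qed (simp_all add: P_def Q_def)
  have AP: "A * P = P * D"
  proof (rule eq_matI)
    fix i j assume "i < dim_row (P * D)" "j < dim_col (P * D)"
    then have ij: "i < n" "j < n" using carr by auto
    then have "(A * P) $$ (i, j) = (\<Sum>k<n. K (vs ! i) (vs ! k) * u (vs ! j) (vs ! k))"
      by (simp add: A_def P_def scalar_prod_def atLeast0LessThan)
    also have "\<dots> = l (vs ! j) * u (vs ! j) (vs ! i)"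
      using eigenbasisD(1)[OF eb inV inV] ij
      by (simp add: sumV[of "\<lambda>k. K (vs ! i) k * u (vs ! j) k"])
    also have "\<dots> = (P * D) $$ (i, j)"
      unfolding D_def mat_diag_mult_right[OF carr(2)] using ij by (simp add: P_def)
    finally show "(A * P) $$ (i, j) = (P * D) $$ (i, j)" .
  qed (use carr in auto)
  have "A = A * (P * Q)" using PQ carr by simp
  also have "\<dots> = A * P * Q" using carr by (simp add: assoc_mult_mat[of _ n n _ n _ n])
  finally have "A = P * D * Q" using AP by simp
  then have "similar_mat A D"
    unfolding similar_mat_def using similar_mat_witI[OF PQ QP _ carr(1,4,2,3)] by blast
  then have "char_poly A = char_poly D" by (rule char_poly_similar)
  also have "\<dots> = (\<Prod>a\<leftarrow>diag_mat D. [:- a, 1:])"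
    by (rule char_poly_upper_triangular[OF carr(4)]) (auto simp: D_def mat_diag_def)
  also have "diag_mat D = map (\<lambda>i. l (vs ! i)) [0..<n]"
    unfolding diag_mat_def by (auto simp: D_def mat_diag_def)
  also have "\<dots> = map l vs" by (rule nth_equalityI) (simp_all add: len)
  finally have cp: "char_poly A = (\<Prod>a\<leftarrow>map l vs. [:- a, 1:])" .
  have "proots (\<Prod>a\<leftarrow>xs. [:- a, 1:]) = mset xs" for xs :: "real list"
  proof (induction xs)
    case (Cons x xs)
    have nz: "(\<Prod>a\<leftarrow>xs. [:- a, 1:]) \<noteq> 0" by (auto simp: prod_list_zero_iff)
    have "proots [:- x, 1:] = {#x#}" using proots_linear_factor[of x] by simp
    moreover have "proots ([:- x, 1:] * (\<Prod>a\<leftarrow>xs. [:- a, 1:])) = proots [:- x, 1:] + proots (\<Prod>a\<leftarrow>xs. [:- a, 1:])"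
      by (rule proots_mult) (use nz in auto)
    ultimately show ?case using Cons by simp
  qed simp
  from this[of "map l vs"] have "proots (char_poly A) = image_mset l (mset vs)" unfolding cp by simp
  also have "mset vs = mset_set V" using mset_set_set[OF vs(1)] vs(2) by simp
  finally show ?thesis by (simp add: A_def n_def vs_def)
qed

section \<open>Eigenvalue counts under rank one perturbations\<close>

text \<open>Gaussian elimination: an equation with non-zero coefficient at \<open>x0\<close> is
  solved for that unknown, which removes one equation and one unknown together.\<close>

lemma underdetermined_homogeneous_system:
  fixes g :: "'b \<Rightarrow> 'a \<Rightarrow> real"
  assumes "finite J" "finite V" "card J < card V"
  shows "\<exists>y. (\<exists>x\<in>V. y x \<noteq> 0) \<and> (\<forall>j\<in>J. (\<Sum>x\<in>V. g j x * y x) = 0)"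
  using assms
proof (induction J arbitrary: V g rule: finite_induct)
  case empty
  then show ?case by (intro exI[of _ "\<lambda>_. 1"]) (auto simp: card_gt_0_iff)
next
  case (insert j0 J)
  show ?case
  proof (cases "\<forall>x\<in>V. g j0 x = 0")
    case True
    obtain y where "\<exists>x\<in>V. y x \<noteq> 0" "\<forall>j\<in>J. (\<Sum>x\<in>V. g j x * y x) = 0"
      using insert.IH[of V g] insert.prems insert.hyps by auto
    then show ?thesis using True by (intro exI[of _ y]) auto
  next
    case False
    then obtain x0 where x0: "x0 \<in> V" "g j0 x0 \<noteq> 0" by blast
    define V' where "V' = V - {x0}"
    have V: "V = insert x0 V'" "x0 \<notin> V'" "finite V'" using x0 insert.prems by (auto simp: V'_def)
    \<comment> \<open>A multiple of equation \<open>j0\<close> cancels the coefficient at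
      \<open>x0\<close> in all others; the value \<open>c\<close> below then solves equation
      \<open>j0\<close> itself.\<close>
    define g' where "g' j x = g j x - g j x0 * g j0 x / g j0 x0" for j x
    obtain y where y: "\<exists>x\<in>V'. y x \<noteq> 0" "\<And>j. j \<in> J \<Longrightarrow> (\<Sum>x\<in>V'. g' j x * y x) = 0"
      using insert.IH[of V' g'] insert.prems insert.hyps V by auto
    define c where "c = - (\<Sum>x\<in>V'. g j0 x * y x) / g j0 x0"
    define y' where "y' = y(x0 := c)"
    have yV': "y' x = y x" if "x \<in> V'" for x using that V by (auto simp: y'_def)
    have split: "(\<Sum>x\<in>V. g j x * y' x) = g j x0 * c + (\<Sum>x\<in>V'. g j x * y x)" for j
    proof -
      have "(\<Sum>x\<in>V'. g j x * y' x) = (\<Sum>x\<in>V'. g j x * y x)"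
        by (intro sum.cong) (auto simp: yV')
      then show ?thesis unfolding V(1) using V by (simp add: y'_def)
    qed
    have "(\<Sum>x\<in>V. g j x * y' x) = 0" if j: "j \<in> insert j0 J" for j
    proof (cases "j = j0")
      case True
      then show ?thesis unfolding split c_def using x0 by simp
    next
      case False
      have "0 = (\<Sum>x\<in>V'. g' j x * y x)" using y(2) j False by auto
      also have "\<dots> = (\<Sum>x\<in>V'. g j x * y x - g j x0 / g j0 x0 * (g j0 x * y x))"
        unfolding g'_def by (intro sum.cong) (simp_all add: field_simps)
      also have "\<dots> = (\<Sum>x\<in>V'. g j x * y x) - g j x0 / g j0 x0 * (\<Sum>x\<in>V'. g j0 x * y x)"
        by (simp add: sum_subtractf sum_distrib_left)
      also have "\<dots> = (\<Sum>x\<in>V. g j x * y' x)"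
        unfolding split c_def by simp
      finally show ?thesis by simp
    qed
    moreover have "\<exists>x\<in>V. y' x \<noteq> 0" using y(1) yV' V by fastforce
    ultimately show ?thesis by blast
  qed
qed

lemma eigenbasis_parseval:
  assumes fin: "finite V" and eb: "eigenbasis V K l u"
  shows "(\<Sum>x\<in>V. \<Sum>z\<in>V. y x * K x z * y z) = (\<Sum>i\<in>V. l i * (\<Sum>x\<in>V. u i x * y x)\<^sup>2)"
    and "(\<Sum>x\<in>V. (y x)\<^sup>2) = (\<Sum>i\<in>V. (\<Sum>x\<in>V. u i x * y x)\<^sup>2)"
proof -
  define c where "c i = (\<Sum>x\<in>V. u i x * y x)" for i
  have y: "y x = (\<Sum>i\<in>V. c i * u i x)" if "x \<in> V" for x
  proof -
    have "(\<Sum>i\<in>V. c i * u i x) = (\<Sum>i\<in>V. \<Sum>z\<in>V. y z * (u i z * u i x))"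
      unfolding c_def by (simp add: sum_distrib_left sum_distrib_right mult_ac)
    also have "\<dots> = (\<Sum>z\<in>V. y z * (\<Sum>i\<in>V. u i z * u i x))"
      by (subst sum.swap) (simp add: sum_distrib_left)
    also have "\<dots> = (\<Sum>z\<in>V. y z * of_bool (z = x))"
      using eigenbasisD(3)[OF eb] that by (intro sum.cong) auto
    also have "\<dots> = y x" by (rule sum_mult_delta[OF fin that])
    finally show ?thesis by simp
  qed
  have Ky: "(\<Sum>z\<in>V. K x z * y z) = (\<Sum>i\<in>V. l i * c i * u i x)" if "x \<in> V" for x
  proof -
    have "(\<Sum>z\<in>V. K x z * y z) = (\<Sum>z\<in>V. \<Sum>i\<in>V. c i * (K x z * u i z))"
      by (intro sum.cong refl) (simp add: y sum_distrib_left mult_ac)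
    also have "\<dots> = (\<Sum>i\<in>V. c i * (\<Sum>z\<in>V. K x z * u i z))"
      by (subst sum.swap) (simp add: sum_distrib_left)
    also have "\<dots> = (\<Sum>i\<in>V. l i * c i * u i x)"
      using eigenbasisD(1)[OF eb] that by (intro sum.cong) auto
    finally show ?thesis .
  qed
  have pair: "(\<Sum>x\<in>V. y x * (\<Sum>i\<in>V. b i * u i x)) = (\<Sum>i\<in>V. b i * c i)" for b
  proof -
    have "(\<Sum>x\<in>V. y x * (\<Sum>i\<in>V. b i * u i x)) = (\<Sum>x\<in>V. \<Sum>i\<in>V. b i * (u i x * y x))"
      by (simp add: sum_distrib_left mult_ac)
    also have "\<dots> = (\<Sum>i\<in>V. b i * c i)"
      unfolding c_def by (subst sum.swap) (simp add: sum_distrib_left)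
    finally show ?thesis .
  qed
  have "(\<Sum>x\<in>V. \<Sum>z\<in>V. y x * K x z * y z) = (\<Sum>x\<in>V. y x * (\<Sum>z\<in>V. K x z * y z))"
    by (simp add: sum_distrib_left mult_ac)
  also have "\<dots> = (\<Sum>x\<in>V. y x * (\<Sum>i\<in>V. l i * c i * u i x))"
    by (intro sum.cong refl) (simp add: Ky)
  also have "\<dots> = (\<Sum>i\<in>V. l i * (c i)\<^sup>2)"
    unfolding pair by (simp add: power2_eq_square mult_ac)
  finally show "(\<Sum>x\<in>V. \<Sum>z\<in>V. y x * K x z * y z) = (\<Sum>i\<in>V. l i * (\<Sum>x\<in>V. u i x * y x)\<^sup>2)"
    unfolding c_def .
  have "(\<Sum>x\<in>V. (y x)\<^sup>2) = (\<Sum>x\<in>V. y x * (\<Sum>i\<in>V. c i * u i x))"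
    using y by (intro sum.cong) (auto simp: power2_eq_square)
  also have "\<dots> = (\<Sum>i\<in>V. (c i)\<^sup>2)" unfolding pair by (simp add: power2_eq_square)
  finally show "(\<Sum>x\<in>V. (y x)\<^sup>2) = (\<Sum>i\<in>V. (\<Sum>x\<in>V. u i x * y x)\<^sup>2)" unfolding c_def .
qed

text \<open>Interlacing by a dimension count. On a vector orthogonal to \<open>g\<close> the two
  quadratic forms agree. If the counts differed by two or more, such a vector could be chosen so
  that the form of \<open>K\<close> is at most \<open>t\<close> times the squared norm while that of
  \<open>L\<close> exceeds it. The sign of \<open>c\<close> is free, so \<open>K\<close> and
  \<open>L\<close> may be exchanged.\<close>

lemma rank_one_perturbation_eigenvalue_count:
  assumes fin: "finite V" and K: "eigenbasis V K l u" and L: "eigenbasis V L m w"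
    and KL: "\<And>x y. x \<in> V \<Longrightarrow> y \<in> V \<Longrightarrow> K x y = L x y + c * g x * g y"
  shows "card {i\<in>V. l i \<le> t} \<le> card {i\<in>V. m i \<le> t} + 1"
proof (rule ccontr)
  assume "\<not> ?thesis"
  then have less: "card {i\<in>V. m i \<le> t} + 1 < card {i\<in>V. l i \<le> t}" by simp
  \<comment> \<open>A vector orthogonal to \<open>g\<close>, to the eigenvectors of \<open>K\<close> above \<open>t\<close> and to those of \<open>L\<close> up to \<open>t\<close>.\<close>
  define J where "J = insert None (Some ` (Inl ` {i\<in>V. \<not> l i \<le> t} \<union> Inr ` {i\<in>V. m i \<le> t}))"
  define h where "h j = (case j of None \<Rightarrow> g | Some (Inl i) \<Rightarrow> u i | Some (Inr i) \<Rightarrow> w i)" for j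
  have finJ: "finite J" using fin by (simp add: J_def)
  have "card J \<le> Suc (card (Some ` (Inl ` {i\<in>V. \<not> l i \<le> t} \<union> Inr ` {i\<in>V. m i \<le> t})))"
    unfolding J_def by (rule card_insert_le_m1) auto
  also have "\<dots> \<le> Suc (card {i\<in>V. \<not> l i \<le> t} + card {i\<in>V. m i \<le> t})"
    using fin by (subst card_image) (auto intro!: order_trans[OF card_Un_le] add_mono card_image_le)
  also have "card {i\<in>V. \<not> l i \<le> t} = card V - card {i\<in>V. l i \<le> t}"
  proof -
    have "{i\<in>V. \<not> l i \<le> t} = V - {i\<in>V. l i \<le> t}" by auto
    then show ?thesis using fin by (simp add: card_Diff_subset)
  qed
  also have "Suc (card V - card {i\<in>V. l i \<le> t} + card {i\<in>V. m i \<le> t}) < card V"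
    using less card_mono[OF fin, of "{i\<in>V. l i \<le> t}"] by auto
  finally have "card J < card V" .
  then obtain y where y: "\<exists>x\<in>V. y x \<noteq> 0" "\<And>j. j \<in> J \<Longrightarrow> (\<Sum>x\<in>V. h j x * y x) = 0"
    using underdetermined_homogeneous_system[OF finJ fin, of h] by blast
  have yg: "(\<Sum>x\<in>V. g x * y x) = 0" using y(2)[of None] by (simp add: J_def h_def)
  have yu: "(\<Sum>x\<in>V. u i x * y x) = 0" if "i \<in> V" "l i > t" for i
    using y(2)[of "Some (Inl i)"] that by (auto simp: J_def h_def)
  have yw: "(\<Sum>x\<in>V. w i x * y x) = 0" if "i \<in> V" "m i \<le> t" for i
    using y(2)[of "Some (Inr i)"] that by (auto simp: J_def h_def)
  define N where "N = (\<Sum>x\<in>V. (y x)\<^sup>2)"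
  obtain x1 where x1: "x1 \<in> V" "y x1 \<noteq> 0" using y(1) by blast
  have "(y x1)\<^sup>2 \<le> N" unfolding N_def using x1 fin by (intro member_le_sum) auto
  then have N0: "N > 0" using x1 by (smt (verit) zero_less_power2)
  have "(\<Sum>x\<in>V. \<Sum>z\<in>V. y x * K x z * y z)
      = (\<Sum>x\<in>V. \<Sum>z\<in>V. y x * L x z * y z + c * ((g x * y x) * (g z * y z)))"
    by (intro sum.cong refl) (simp add: KL algebra_simps)
  also have "\<dots> = (\<Sum>x\<in>V. \<Sum>z\<in>V. y x * L x z * y z) + c * ((\<Sum>x\<in>V. g x * y x) * (\<Sum>x\<in>V. g x * y x))"
    by (simp only: sum.distrib sum_product) (simp only: sum_distrib_left)
  finally have KLq: "(\<Sum>x\<in>V. \<Sum>z\<in>V. y x * K x z * y z) = (\<Sum>x\<in>V. \<Sum>z\<in>V. y x * L x z * y z)"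
    using yg by simp
  have NK: "N = (\<Sum>i\<in>V. (\<Sum>x\<in>V. u i x * y x)\<^sup>2)"
    unfolding N_def by (rule eigenbasis_parseval(2)[OF fin K])
  have NL: "N = (\<Sum>i\<in>V. (\<Sum>x\<in>V. w i x * y x)\<^sup>2)"
    unfolding N_def by (rule eigenbasis_parseval(2)[OF fin L])
  have "(\<Sum>i\<in>V. l i * (\<Sum>x\<in>V. u i x * y x)\<^sup>2) \<le> (\<Sum>i\<in>V. t * (\<Sum>x\<in>V. u i x * y x)\<^sup>2)"
  proof (rule sum_mono)
    fix i assume i: "i \<in> V"
    show "l i * (\<Sum>x\<in>V. u i x * y x)\<^sup>2 \<le> t * (\<Sum>x\<in>V. u i x * y x)\<^sup>2"
      using yu[OF i] by (cases "l i > t") (auto intro: mult_right_mono)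
  qed
  then have le: "(\<Sum>x\<in>V. \<Sum>z\<in>V. y x * K x z * y z) \<le> t * N"
    unfolding eigenbasis_parseval(1)[OF fin K] NK sum_distrib_left .
  have "\<exists>i\<in>V. (\<Sum>x\<in>V. w i x * y x) \<noteq> 0"
    using N0 unfolding NL by (rule contrapos_pp) simp
  then obtain i1 where i1: "i1 \<in> V" "(\<Sum>x\<in>V. w i1 x * y x) \<noteq> 0" by blast
  \<comment> \<open>Strictness comes from \<open>i1\<close>: coefficients with
    \<open>m i \<le> t\<close> vanish, so its non-zero coefficient belongs to an eigenvalue above
    \<open>t\<close>.\<close>
  have "(\<Sum>i\<in>V. t * (\<Sum>x\<in>V. w i x * y x)\<^sup>2) < (\<Sum>i\<in>V. m i * (\<Sum>x\<in>V. w i x * y x)\<^sup>2)"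
  proof (rule sum_strict_mono_ex1[OF fin])
    show "\<forall>i\<in>V. t * (\<Sum>x\<in>V. w i x * y x)\<^sup>2 \<le> m i * (\<Sum>x\<in>V. w i x * y x)\<^sup>2"
    proof
      fix i assume i: "i \<in> V"
      show "t * (\<Sum>x\<in>V. w i x * y x)\<^sup>2 \<le> m i * (\<Sum>x\<in>V. w i x * y x)\<^sup>2"
        using yw[OF i] by (cases "m i \<le> t") (auto intro: mult_right_mono)
    qed
    show "\<exists>i\<in>V. t * (\<Sum>x\<in>V. w i x * y x)\<^sup>2 < m i * (\<Sum>x\<in>V. w i x * y x)\<^sup>2"
      using i1 yw[OF i1(1)] by (intro bexI[of _ i1] mult_strict_right_mono) (auto simp: not_le[symmetric])
  qed
  then have "t * N < (\<Sum>x\<in>V. \<Sum>z\<in>V. y x * L x z * y z)"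
    unfolding eigenbasis_parseval(1)[OF fin L] NL sum_distrib_left .
  then show False using le KLq by simp
qed

section \<open>The Kesten-McKay law\<close>

text \<open>The non-backtracking polynomials of the \<open>v\<close>-regular tree.\<close>

fun kesten_mckay_poly :: "real \<Rightarrow> nat \<Rightarrow> real \<Rightarrow> real" where
  "kesten_mckay_poly v 0 x = 1"
| "kesten_mckay_poly v (Suc 0) x = x"
| "kesten_mckay_poly v (Suc (Suc k)) x =
     x * kesten_mckay_poly v (Suc k) x - (if k = 0 then v else v - 1) * kesten_mckay_poly v k x"

section \<open>The law in the angular variable\<close>

text \<open>With \<open>q = sqrt (v - 1)\<close> and \<open>x = - 2 * q * cos \<theta>\<close> this
  is the Kesten-McKay density at \<open>x\<close> times the derivative of \<open>x\<close>. The
  minus sign makes the substitution increasing on the interval from 0 to \<open>pi\<close>.\<close>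

definition angular_density :: "real \<Rightarrow> real \<Rightarrow> real" where
  "angular_density q \<theta> =
     (q\<^sup>2 + 1) * 2 * q\<^sup>2 * (sin \<theta>)\<^sup>2 / (pi * (q ^ 4 + 1 - 2 * q\<^sup>2 * cos (2 * \<theta>)))"

text \<open>Written as a sum of squares, the denominator is visibly non-negative, is bounded below
  uniformly for \<open>q > 1\<close>, and for \<open>q = 1\<close> vanishes exactly where
  \<open>sin \<theta>\<close> does.\<close>

lemma angular_denominator:
  fixes q \<theta> :: real
  shows "q ^ 4 + 1 - 2 * q\<^sup>2 * cos (2 * \<theta>) = (q\<^sup>2 - 1)\<^sup>2 + 4 * q\<^sup>2 * (sin \<theta>)\<^sup>2"
proof -
  have "cos (2 * \<theta>) = 1 - 2 * (sin \<theta>)\<^sup>2" by (simp add: cos_double_sin)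
  show ?thesis unfolding \<open>cos (2 * \<theta>) = _\<close> by (simp add: power2_eq_square power4_eq_xxxx algebra_simps)
qed

lemma angular_density_nonneg: "angular_density q \<theta> \<ge> 0"
  unfolding angular_density_def angular_denominator by simp

lemma borel_measurable_angular_density [measurable]: "angular_density q \<in> borel_measurable borel"
  unfolding angular_density_def by measurable

lemma borel_measurable_kesten_mckay_density [measurable]: "kesten_mckay_density v \<in> borel_measurable borel"
  unfolding kesten_mckay_density_def by measurable

lemma kesten_mckay_density_cos:
  assumes "q \<ge> 1" "\<theta> \<in> {0..pi}"
  shows "kesten_mckay_density (q\<^sup>2 + 1) (- 2 * q * cos \<theta>) * (2 * q * sin \<theta>) = angular_density q \<theta>"
proof -
  have s0: "sin \<theta> \<ge> 0" using assms by (simp add: sin_ge_zero)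
  have "\<bar>cos \<theta>\<bar> \<le> 1" by simp
  then have "\<bar>- 2 * q * cos \<theta>\<bar> \<le> 2 * q" using assms by (simp add: abs_mult mult_left_le)
  moreover have "sqrt (q\<^sup>2 + 1 - 1) = q" using assms by simp
  ultimately have le: "\<bar>- 2 * q * cos \<theta>\<bar> \<le> 2 * sqrt (q\<^sup>2 + 1 - 1)" by simp
  have "4 * (q\<^sup>2 + 1 - 1) - (- 2 * q * cos \<theta>)\<^sup>2 = (2 * q * sin \<theta>)\<^sup>2"
    by (simp add: power_mult_distrib sin_squared_eq algebra_simps)
  then have sq: "sqrt (4 * (q\<^sup>2 + 1 - 1) - (- 2 * q * cos \<theta>)\<^sup>2) = 2 * q * sin \<theta>"
    using s0 assms by (simp only: real_sqrt_abs) simp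
  have den: "(q\<^sup>2 + 1)\<^sup>2 - (- 2 * q * cos \<theta>)\<^sup>2 = q ^ 4 + 1 - 2 * q\<^sup>2 * cos (2 * \<theta>)"
  proof -
    have e: "(- 2 * q * cos \<theta>)\<^sup>2 = 4 * q\<^sup>2 * (1 - (sin \<theta>)\<^sup>2)"
      by (simp add: power_mult_distrib cos_squared_eq)
    show ?thesis unfolding angular_denominator e by (simp add: power2_eq_square algebra_simps)
  qed
  have dens: "kesten_mckay_density (q\<^sup>2 + 1) (- 2 * q * cos \<theta>) =
      (q\<^sup>2 + 1) * (2 * q * sin \<theta>) / (2 * pi * (q ^ 4 + 1 - 2 * q\<^sup>2 * cos (2 * \<theta>)))"
    unfolding kesten_mckay_density_def if_P[OF le] sq den ..
  show ?thesis
    unfolding angular_density_def dens by (simp add: power2_eq_square)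
qed

definition angular_measure :: "real \<Rightarrow> real measure" where
  "angular_measure q = density lborel (\<lambda>\<theta>. ennreal (angular_density q \<theta> * indicator {0..pi} \<theta>))"

lemma sets_angular_measure [simp, measurable_cong]: "sets (angular_measure q) = sets borel"
  by (simp add: angular_measure_def)

lemma kesten_mckay_eq_distr:
  assumes q: "q \<ge> 1"
  shows "kesten_mckay (q\<^sup>2 + 1) = distr (angular_measure q) borel (\<lambda>\<theta>. - 2 * q * cos \<theta>)"
proof (rule measure_eqI)
  fix A assume "A \<in> sets (kesten_mckay (q\<^sup>2 + 1))"
  then have A [measurable]: "A \<in> sets borel" by simp
  define f where "f x = kesten_mckay_density (q\<^sup>2 + 1) x * indicator A x" for x
  \<comment> \<open>Since \<open>q \<ge> 1\<close>, the parameter is at least 2 and both atoms have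
    weight zero.\<close>
  have v: "max (2 - (q\<^sup>2 + 1)) 0 = 0" using q by (simp add: one_le_power)
  have sup: "x \<in> {- 2 * q * cos 0 .. - 2 * q * cos pi}" if "kesten_mckay_density (q\<^sup>2 + 1) x \<noteq> 0" for x
    using that q by (auto simp: kesten_mckay_density_def split: if_splits)
  then have *: "ennreal (kesten_mckay_density (q\<^sup>2 + 1) x) * indicator A x =
      ennreal (f x * indicator {- 2 * q * cos 0 .. - 2 * q * cos pi} x)" for x
    by (cases "kesten_mckay_density (q\<^sup>2 + 1) x = 0") (auto simp: f_def indicator_def)
  have "emeasure (kesten_mckay (q\<^sup>2 + 1)) A = (\<integral>\<^sup>+x. ennreal (f x * indicator {- 2 * q * cos 0 .. - 2 * q * cos pi} x) \<partial>lborel)"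
    unfolding emeasure_kesten_mckay[OF A] v * by simp
  also have "\<dots> = (\<integral>\<^sup>+\<theta>. ennreal (f (- 2 * q * cos \<theta>) * (2 * q * sin \<theta>) * indicator {0..pi} \<theta>) \<partial>lborel)"
  proof -
    have "set_borel_measurable borel {- 2 * q * cos 0 .. - 2 * q * cos pi} f"
      unfolding set_borel_measurable_def f_def by measurable
    then show ?thesis
      by (intro nn_integral_substitution[where g = "\<lambda>\<theta>. - 2 * q * cos \<theta>" and g' = "\<lambda>\<theta>. 2 * q * sin \<theta>"])
        (use q in \<open>auto intro!: derivative_eq_intros continuous_intros sin_ge_zero mult_nonneg_nonneg\<close>)
  qed
  also have "\<dots> = (\<integral>\<^sup>+\<theta>. ennreal (angular_density q \<theta> * indicator {0..pi} \<theta>)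
      * indicator ((\<lambda>\<theta>. - 2 * q * cos \<theta>) -` A) \<theta> \<partial>lborel)"
  proof (intro nn_integral_cong)
    fix \<theta> :: real
    show "ennreal (f (- 2 * q * cos \<theta>) * (2 * q * sin \<theta>) * indicator {0..pi} \<theta>) =
        ennreal (angular_density q \<theta> * indicator {0..pi} \<theta>) * indicator ((\<lambda>\<theta>. - 2 * q * cos \<theta>) -` A) \<theta>"
      using kesten_mckay_density_cos[OF q, of \<theta>]
      by (cases "\<theta> \<in> {0..pi}"; cases "- 2 * q * cos \<theta> \<in> A") (simp_all add: f_def)
  qed
  also have "\<dots> = emeasure (angular_measure q) ((\<lambda>\<theta>. - 2 * q * cos \<theta>) -` A)"
    unfolding angular_measure_def by (subst emeasure_density) (auto simp: measurable_sets_borel[OF _ A])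
  also have "\<dots> = emeasure (distr (angular_measure q) borel (\<lambda>\<theta>. - 2 * q * cos \<theta>)) A"
    by (subst emeasure_distr) (auto simp: angular_measure_def)
  finally show "emeasure (kesten_mckay (q\<^sup>2 + 1)) A = emeasure (distr (angular_measure q) borel (\<lambda>\<theta>. - 2 * q * cos \<theta>)) A" .
qed simp

section \<open>Total mass and vanishing means of the polynomials\<close>

lemma integral_cos_mult:
  assumes "m \<ge> 1"
  shows "((\<lambda>\<theta>. cos (real m * \<theta>)) has_integral 0) {0..pi}"
proof -
  have "((\<lambda>\<theta>. cos (real m * \<theta>)) has_integral (sin (real m * pi) / m - sin (real m * 0) / m)) {0..pi}"
    using assms by (intro fundamental_theorem_of_calculus)
      (auto intro!: derivative_eq_intros simp flip: has_real_derivative_iff_has_vector_derivative)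
  then show ?thesis by simp
qed

text \<open>In terms of Chebyshev polynomials of the second kind, the polynomial of degree
  \<open>k + 1\<close> is \<open>(- q) ^ (k + 1)\<close> times
  \<open>U (k + 1) - U (k - 1) / q ^ 2\<close> at \<open>cos \<theta>\<close>. Multiplication by
  \<open>q ^ 2 * sin \<theta>\<close> clears both denominators. Degree two is treated apart because
  its recurrence has the coefficient \<open>v\<close> in place of \<open>v - 1\<close>.\<close>

lemma sin_mult_kesten_mckay_poly:
  "q\<^sup>2 * sin \<theta> * kesten_mckay_poly (q\<^sup>2 + 1) (Suc k) (- 2 * q * cos \<theta>) =
     (- q) ^ Suc k * (q\<^sup>2 * sin (real (k + 2) * \<theta>) - sin (real k * \<theta>))"
proof (induction k rule: less_induct)
  case (less k)
  have rec: "2 * cos \<theta> * sin (real (Suc n) * \<theta>) = sin (real (n + 2) * \<theta>) + sin (real n * \<theta>)" for n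
  proof -
    have "sin (real (n + 2) * \<theta>) = sin (real (Suc n) * \<theta> + \<theta>)"
      "sin (real n * \<theta>) = sin (real (Suc n) * \<theta> - \<theta>)" by (simp_all add: algebra_simps)
    then show ?thesis by (simp add: sin_add sin_diff)
  qed
  consider "k = 0" | "k = 1" | m where "k = Suc (Suc m)" by (metis One_nat_def not0_implies_Suc)
  then show ?case
  proof cases
    case 1
    then show ?thesis using rec[of 0] by (simp add: power2_eq_square algebra_simps)
  next
    case 2
    have r0: "sin (2 * \<theta>) = 2 * cos \<theta> * sin \<theta>" using rec[of 0] by simp
    have r1: "sin (3 * \<theta>) = (4 * (cos \<theta>)\<^sup>2 - 1) * sin \<theta>"
      using rec[of 1] r0 by (simp add: power2_eq_square algebra_simps)
    have "q\<^sup>2 * sin \<theta> * ((- 2 * q * cos \<theta>) * (- 2 * q * cos \<theta>) - (q\<^sup>2 + 1)) =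
        (- q) ^ 2 * (q\<^sup>2 * ((4 * (cos \<theta>)\<^sup>2 - 1) * sin \<theta>) - sin \<theta>)"
      by (simp add: power2_eq_square algebra_simps)
    then show ?thesis using 2 by (simp add: r1 numeral_2_eq_2)
  next
    case (3 m)
    have i1: "q\<^sup>2 * sin \<theta> * kesten_mckay_poly (q\<^sup>2 + 1) (Suc (Suc m)) (- 2 * q * cos \<theta>) =
       (- q) ^ Suc (Suc m) * (q\<^sup>2 * sin (real (m + 3) * \<theta>) - sin (real (m + 1) * \<theta>))"
      using less[of "Suc m"] 3 by (simp add: numeral_3_eq_3)
    have i0: "q\<^sup>2 * sin \<theta> * kesten_mckay_poly (q\<^sup>2 + 1) (Suc m) (- 2 * q * cos \<theta>) =
       (- q) ^ Suc m * (q\<^sup>2 * sin (real (m + 2) * \<theta>) - sin (real m * \<theta>))"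
      using less[of m] 3 by simp
    have "q\<^sup>2 * sin \<theta> * kesten_mckay_poly (q\<^sup>2 + 1) (Suc k) (- 2 * q * cos \<theta>) =
      (- 2 * q * cos \<theta>) * (q\<^sup>2 * sin \<theta> * kesten_mckay_poly (q\<^sup>2 + 1) (Suc (Suc m)) (- 2 * q * cos \<theta>))
       - q\<^sup>2 * (q\<^sup>2 * sin \<theta> * kesten_mckay_poly (q\<^sup>2 + 1) (Suc m) (- 2 * q * cos \<theta>))"
      using 3 by (simp add: algebra_simps)
    also have "\<dots> = (- q) ^ Suc k * (q\<^sup>2 * (2 * cos \<theta> * sin (real (m + 3) * \<theta>)) - 2 * cos \<theta> * sin (real (m + 1) * \<theta>)
         - (q\<^sup>2 * sin (real (m + 2) * \<theta>) - sin (real m * \<theta>)))"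
      unfolding i0 i1 3 by (simp add: power2_eq_square algebra_simps)
    also have "\<dots> = (- q) ^ Suc k * (q\<^sup>2 * sin (real (k + 2) * \<theta>) - sin (real k * \<theta>))"
      using rec[of "m + 2"] rec[of m] 3 by (simp add: algebra_simps)
    finally show ?thesis .
  qed
qed

text \<open>By the closed form above, the mean of the polynomial of degree \<open>k + 1\<close> is a
  multiple of \<open>q ^ 2 * sine_moment q (k + 2) - sine_moment q k\<close>.\<close>

definition sine_moment :: "real \<Rightarrow> nat \<Rightarrow> real" where
  "sine_moment q j = integral {0..pi} (\<lambda>\<theta>. sin \<theta> * sin (real j * \<theta>) / (q ^ 4 + 1 - 2 * q\<^sup>2 * cos (2 * \<theta>)))"

lemma angular_denominator_pos:
  fixes q :: real
  assumes "q > 1"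
  shows "(q\<^sup>2 - 1)\<^sup>2 > 0" "(q\<^sup>2 - 1)\<^sup>2 \<le> q ^ 4 + 1 - 2 * q\<^sup>2 * cos (2 * \<theta>)"
    "q ^ 4 + 1 - 2 * q\<^sup>2 * cos (2 * \<theta>) > 0"
proof -
  have "q\<^sup>2 > 1" using assms by (simp add: one_less_power)
  then show *: "(q\<^sup>2 - 1)\<^sup>2 > 0" by simp
  show **: "(q\<^sup>2 - 1)\<^sup>2 \<le> q ^ 4 + 1 - 2 * q\<^sup>2 * cos (2 * \<theta>)"
    unfolding angular_denominator by simp
  show "q ^ 4 + 1 - 2 * q\<^sup>2 * cos (2 * \<theta>) > 0" using * ** by linarith
qed

lemma sine_moment_has_integral:
  assumes "q > 1"
  shows "((\<lambda>\<theta>. sin \<theta> * sin (real j * \<theta>) / (q ^ 4 + 1 - 2 * q\<^sup>2 * cos (2 * \<theta>)))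
    has_integral sine_moment q j) {0..pi}"
  unfolding sine_moment_def
  by (intro integrable_integral integrable_continuous_interval continuous_intros)
    (use angular_denominator_pos(3)[OF assms] in \<open>auto simp: less_imp_neq[symmetric]\<close>)

lemma sine_moment_bound:
  assumes "q > 1"
  shows "\<bar>sine_moment q j\<bar> \<le> pi / (q\<^sup>2 - 1)\<^sup>2"
proof -
  have "norm (sine_moment q j) \<le> 1 / (q\<^sup>2 - 1)\<^sup>2 * measure lborel (cbox 0 pi)"
  proof (rule has_integral_bound)
    show "((\<lambda>\<theta>. sin \<theta> * sin (real j * \<theta>) / (q ^ 4 + 1 - 2 * q\<^sup>2 * cos (2 * \<theta>)))
      has_integral sine_moment q j) (cbox 0 pi)" using sine_moment_has_integral[OF assms] by simp
    fix \<theta> :: real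
    have "\<bar>sin \<theta> * sin (real j * \<theta>)\<bar> \<le> 1 * 1" unfolding abs_mult by (intro mult_mono) auto
    then show "norm (sin \<theta> * sin (real j * \<theta>) / (q ^ 4 + 1 - 2 * q\<^sup>2 * cos (2 * \<theta>))) \<le> 1 / (q\<^sup>2 - 1)\<^sup>2"
      using angular_denominator_pos(1)[OF assms] angular_denominator_pos(2,3)[OF assms, of \<theta>]
      by (auto simp: abs_mult intro!: frac_le)
  qed auto
  then show ?thesis by simp
qed

text \<open>Multiplying the integrand by its denominator cancels the fraction and leaves the
  integral of \<open>sin \<theta> * sin (m * \<theta>)\<close>, which is \<open>pi / 2\<close> for
  \<open>m = 1\<close> and 0 for \<open>m \<ge> 2\<close>. The term with
  \<open>cos (2 * \<theta>)\<close> produces the neighbours \<open>m + 2\<close> and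
  \<open>m - 2\<close>; for \<open>m = 1\<close> the lower one is \<open>sin (- \<theta>)\<close>,
  whence the additional \<open>q ^ 2\<close> in the first identity.\<close>

lemma sine_moment_recurrence:
  assumes q: "q > 1"
  shows "(q ^ 4 + 1 + q\<^sup>2) * sine_moment q 1 - q\<^sup>2 * sine_moment q 3 = pi / 2"
    and "(q ^ 4 + 1) * sine_moment q (j + 2) - q\<^sup>2 * (sine_moment q (j + 4) + sine_moment q j) = 0"
proof -
  define D where "D \<theta> = q ^ 4 + 1 - 2 * q\<^sup>2 * cos (2 * \<theta>)" for \<theta>
  have D: "D \<theta> > 0" for \<theta> unfolding D_def by (rule angular_denominator_pos[OF q])
  note hi = sine_moment_has_integral[OF q, folded D_def]
  have pr: "sin \<theta> * sin (real m * \<theta>) = (cos (real (m - 1) * \<theta>) - cos (real (m + 1) * \<theta>)) / 2" if "m \<ge> 1" for m \<theta>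
  proof -
    have "real (m - 1) * \<theta> = real m * \<theta> - \<theta>" "real (m + 1) * \<theta> = real m * \<theta> + \<theta>"
      using that by (simp_all add: of_nat_diff algebra_simps)
    then show ?thesis by (simp add: cos_add cos_diff)
  qed
  have h1: "((\<lambda>\<theta>. (q ^ 4 + 1 + q\<^sup>2) * (sin \<theta> * sin (real 1 * \<theta>) / D \<theta>) - q\<^sup>2 * (sin \<theta> * sin (real 3 * \<theta>) / D \<theta>))
     has_integral (q ^ 4 + 1 + q\<^sup>2) * sine_moment q 1 - q\<^sup>2 * sine_moment q 3) {0..pi}"
    by (intro has_integral_diff has_integral_mult_right hi)
  have e1: "(q ^ 4 + 1 + q\<^sup>2) * (sin \<theta> * sin (real 1 * \<theta>) / D \<theta>) - q\<^sup>2 * (sin \<theta> * sin (real 3 * \<theta>) / D \<theta>)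
     = 1 / 2 - cos (real 2 * \<theta>) / 2" for \<theta>
  proof -
    have "sin (3 * \<theta>) = sin (2 * \<theta> + \<theta>)" by simp
    also have "\<dots> = 2 * cos (2 * \<theta>) * sin \<theta> + sin \<theta>"
      unfolding sin_add using sin_diff[of "2 * \<theta>" \<theta>] by (simp add: mult.commute)
    finally have s3: "sin (3 * \<theta>) = 2 * cos (2 * \<theta>) * sin \<theta> + sin \<theta>" .
    have "(q ^ 4 + 1 + q\<^sup>2) * (sin \<theta> * sin (real 1 * \<theta>) / D \<theta>) - q\<^sup>2 * (sin \<theta> * sin (real 3 * \<theta>) / D \<theta>)
       = sin \<theta> * ((q ^ 4 + 1 + q\<^sup>2) * sin \<theta> - q\<^sup>2 * sin (3 * \<theta>)) / D \<theta>"
      by (simp add: diff_divide_distrib add_divide_distrib algebra_simps)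
    also have "(q ^ 4 + 1 + q\<^sup>2) * sin \<theta> - q\<^sup>2 * sin (3 * \<theta>) = sin \<theta> * D \<theta>"
      unfolding s3 D_def by (simp add: algebra_simps)
    also have "sin \<theta> * (sin \<theta> * D \<theta>) / D \<theta> = sin \<theta> * sin (real 1 * \<theta>)" using D[of \<theta>] by simp
    finally show ?thesis using pr[of 1 \<theta>] by simp
  qed
  have h2: "((\<lambda>\<theta>. 1 / 2 - cos (real 2 * \<theta>) / 2) has_integral (1 / 2 * (pi - 0) - 0 / 2)) {0..pi}"
    using has_integral_const_real[of "1 / 2 :: real" 0 pi] integral_cos_mult[of 2]
    by (intro has_integral_diff has_integral_divide) simp_all
  show "(q ^ 4 + 1 + q\<^sup>2) * sine_moment q 1 - q\<^sup>2 * sine_moment q 3 = pi / 2"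
    using has_integral_unique[OF h1[unfolded e1] h2] by simp
  have h3: "((\<lambda>\<theta>. (q ^ 4 + 1) * (sin \<theta> * sin (real (j + 2) * \<theta>) / D \<theta>)
       - q\<^sup>2 * (sin \<theta> * sin (real (j + 4) * \<theta>) / D \<theta> + sin \<theta> * sin (real j * \<theta>) / D \<theta>))
     has_integral (q ^ 4 + 1) * sine_moment q (j + 2) - q\<^sup>2 * (sine_moment q (j + 4) + sine_moment q j)) {0..pi}"
    by (intro has_integral_diff has_integral_mult_right has_integral_add hi)
  have e3: "(q ^ 4 + 1) * (sin \<theta> * sin (real (j + 2) * \<theta>) / D \<theta>)
       - q\<^sup>2 * (sin \<theta> * sin (real (j + 4) * \<theta>) / D \<theta> + sin \<theta> * sin (real j * \<theta>) / D \<theta>)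
     = cos (real (j + 1) * \<theta>) / 2 - cos (real (j + 3) * \<theta>) / 2" for \<theta>
  proof -
    define \<phi> where "\<phi> = real (j + 2) * \<theta>"
    have "real (j + 4) * \<theta> = \<phi> + 2 * \<theta>" "real j * \<theta> = \<phi> - 2 * \<theta>" by (simp_all add: \<phi>_def algebra_simps)
    then have s: "sin (real (j + 4) * \<theta>) + sin (real j * \<theta>) = 2 * cos (2 * \<theta>) * sin \<phi>"
      by (simp only: sin_add sin_diff) simp
    have "(q ^ 4 + 1) * (sin \<theta> * sin \<phi> / D \<theta>)
       - q\<^sup>2 * (sin \<theta> * sin (real (j + 4) * \<theta>) / D \<theta> + sin \<theta> * sin (real j * \<theta>) / D \<theta>)
      = sin \<theta> * ((q ^ 4 + 1) * sin \<phi> - q\<^sup>2 * (sin (real (j + 4) * \<theta>) + sin (real j * \<theta>))) / D \<theta>"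
      by (simp add: diff_divide_distrib add_divide_distrib algebra_simps)
    also have "(q ^ 4 + 1) * sin \<phi> - q\<^sup>2 * (sin (real (j + 4) * \<theta>) + sin (real j * \<theta>)) = sin \<phi> * D \<theta>"
      unfolding s D_def by (simp add: algebra_simps)
    also have "sin \<theta> * (sin \<phi> * D \<theta>) / D \<theta> = sin \<theta> * sin \<phi>" using D[of \<theta>] by simp
    also have "\<dots> = cos (real (j + 1) * \<theta>) / 2 - cos (real (j + 3) * \<theta>) / 2"
      using pr[of "j + 2" \<theta>] by (simp add: \<phi>_def diff_divide_distrib add.commute)
    finally show ?thesis unfolding \<phi>_def .
  qed
  have h4: "((\<lambda>\<theta>. cos (real (j + 1) * \<theta>) / 2 - cos (real (j + 3) * \<theta>) / 2) has_integral (0 / 2 - 0 / 2)) {0..pi}"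
    by (intro has_integral_diff has_integral_divide integral_cos_mult) simp_all
  show "(q ^ 4 + 1) * sine_moment q (j + 2) - q\<^sup>2 * (sine_moment q (j + 4) + sine_moment q j) = 0"
    using has_integral_unique[OF h3[unfolded e3] h4] by simp
qed

text \<open>The recurrence of the moments has a decaying and a growing solution; the latter is excluded by boundedness.\<close>

lemma sine_moment_geometric:
  assumes q: "q > 1"
  shows "q\<^sup>2 * sine_moment q (k + 2) = sine_moment q k"
proof (rule ccontr)
  define e where "e n = q\<^sup>2 * sine_moment q (n + 2) - sine_moment q n" for n
  assume "\<not> ?thesis"
  then have e0: "\<bar>e k\<bar> > 0" by (simp add: e_def)
  have step: "e (n + 2) = q\<^sup>2 * e n" for n
  proof -
    have "n + 2 + 2 = n + 4" by simp
    then show ?thesis using sine_moment_recurrence(2)[OF q, of n] unfolding e_def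
      by (simp add: power2_eq_square power4_eq_xxxx algebra_simps del: add_2_eq_Suc add_2_eq_Suc')
  qed
  have pow: "e (k + 2 * m) = (q\<^sup>2) ^ m * e k" for m
  proof (induction m)
    case (Suc m)
    have "e (k + 2 * Suc m) = e (k + 2 * m + 2)" by (simp add: algebra_simps)
    then show ?case using step[of "k + 2 * m"] Suc by simp
  qed simp
  define M where "M = (q\<^sup>2 + 1) * (pi / (q\<^sup>2 - 1)\<^sup>2)"
  have bound: "\<bar>e n\<bar> \<le> M" for n
  proof -
    have "\<bar>e n\<bar> \<le> q\<^sup>2 * \<bar>sine_moment q (n + 2)\<bar> + \<bar>sine_moment q n\<bar>"
      unfolding e_def by (metis abs_mult abs_power2 abs_triangle_ineq4)
    also have "\<dots> \<le> q\<^sup>2 * (pi / (q\<^sup>2 - 1)\<^sup>2) + pi / (q\<^sup>2 - 1)\<^sup>2"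
      by (intro add_mono mult_left_mono sine_moment_bound q) simp
    finally show ?thesis unfolding M_def distrib_right by simp
  qed
  have "q\<^sup>2 > 1" using q by (simp add: one_less_power)
  then obtain m where "M / \<bar>e k\<bar> < (q\<^sup>2) ^ m" using real_arch_pow by blast
  then have "M < \<bar>e (k + 2 * m)\<bar>"
    unfolding pow abs_mult using e0 q by (simp add: field_simps)
  then show False using bound[of "k + 2 * m"] by simp
qed

text \<open>The geometric relation between the moments is precisely the vanishing of the mean in
  each positive degree. Inserted into the inhomogeneous recurrence, it determines
  \<open>sine_moment q 1\<close> and thereby the total mass.\<close>

lemma angular_integral_gt1:
  assumes q: "q > 1"
  shows "(angular_density q has_integral 1) {0..pi}"
    and "((\<lambda>\<theta>. kesten_mckay_poly (q\<^sup>2 + 1) (Suc k) (- 2 * q * cos \<theta>) * angular_density q \<theta>) has_integral 0) {0..pi}"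
proof -
  define D where "D \<theta> = q ^ 4 + 1 - 2 * q\<^sup>2 * cos (2 * \<theta>)" for \<theta>
  have D: "D \<theta> > 0" for \<theta> unfolding D_def by (rule angular_denominator_pos[OF q])
  note hi = sine_moment_has_integral[OF q, folded D_def]
  have "((\<lambda>\<theta>. 2 * (q\<^sup>2 + 1) * q\<^sup>2 / pi * (sin \<theta> * sin (real 1 * \<theta>) / D \<theta>)) has_integral
      2 * (q\<^sup>2 + 1) * q\<^sup>2 / pi * sine_moment q 1) {0..pi}"
    by (intro has_integral_mult_right hi)
  also have "(\<lambda>\<theta>. 2 * (q\<^sup>2 + 1) * q\<^sup>2 / pi * (sin \<theta> * sin (real 1 * \<theta>) / D \<theta>)) = angular_density q"
    by (auto simp: fun_eq_iff angular_density_def D_def power2_eq_square[of "sin _"])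
  also have "2 * (q\<^sup>2 + 1) * q\<^sup>2 / pi * sine_moment q 1 = 1"
  proof -
    have "q\<^sup>2 * sine_moment q 3 = sine_moment q 1" using sine_moment_geometric[OF q, of 1] by (simp add: numeral_3_eq_3)
    then have "(q ^ 4 + q\<^sup>2) * sine_moment q 1 = pi / 2"
      using sine_moment_recurrence(1)[OF q] by (simp add: algebra_simps)
    then have "2 * (q\<^sup>2 + 1) * q\<^sup>2 * sine_moment q 1 = pi"
      by (simp add: power2_eq_square power4_eq_xxxx algebra_simps)
    then show ?thesis by simp
  qed
  finally show "(angular_density q has_integral 1) {0..pi}" .
  have "((\<lambda>\<theta>. 2 * (q\<^sup>2 + 1) / pi * (- q) ^ Suc k * (q\<^sup>2 * (sin \<theta> * sin (real (k + 2) * \<theta>) / D \<theta>) - sin \<theta> * sin (real k * \<theta>) / D \<theta>))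
     has_integral 2 * (q\<^sup>2 + 1) / pi * (- q) ^ Suc k * (q\<^sup>2 * sine_moment q (k + 2) - sine_moment q k)) {0..pi}"
    by (intro has_integral_mult_right has_integral_diff hi)
  also have "(\<lambda>\<theta>. 2 * (q\<^sup>2 + 1) / pi * (- q) ^ Suc k * (q\<^sup>2 * (sin \<theta> * sin (real (k + 2) * \<theta>) / D \<theta>) - sin \<theta> * sin (real k * \<theta>) / D \<theta>))
     = (\<lambda>\<theta>. kesten_mckay_poly (q\<^sup>2 + 1) (Suc k) (- 2 * q * cos \<theta>) * angular_density q \<theta>)"
  proof
    fix \<theta>
    have "kesten_mckay_poly (q\<^sup>2 + 1) (Suc k) (- 2 * q * cos \<theta>) * angular_density q \<theta>
      = 2 * (q\<^sup>2 + 1) / pi * (sin \<theta> / D \<theta>) * (q\<^sup>2 * sin \<theta> * kesten_mckay_poly (q\<^sup>2 + 1) (Suc k) (- 2 * q * cos \<theta>))"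
      unfolding angular_density_def D_def[symmetric] by (simp add: power2_eq_square[of "sin _"])
    also have "\<dots> = 2 * (q\<^sup>2 + 1) / pi * (- q) ^ Suc k * (q\<^sup>2 * (sin \<theta> * sin (real (k + 2) * \<theta>) / D \<theta>) - sin \<theta> * sin (real k * \<theta>) / D \<theta>)"
    proof -
      have "c * (s / d) * (A * (b * x - y)) = c * A * (b * (s * x / d) - s * y / d)" for A b c d s x y :: real
        by (simp add: algebra_simps diff_divide_distrib)
      then show ?thesis unfolding sin_mult_kesten_mckay_poly .
    qed
    finally show "2 * (q\<^sup>2 + 1) / pi * (- q) ^ Suc k * (q\<^sup>2 * (sin \<theta> * sin (real (k + 2) * \<theta>) / D \<theta>) - sin \<theta> * sin (real k * \<theta>) / D \<theta>)
      = kesten_mckay_poly (q\<^sup>2 + 1) (Suc k) (- 2 * q * cos \<theta>) * angular_density q \<theta>" by simp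
  qed
  finally show "((\<lambda>\<theta>. kesten_mckay_poly (q\<^sup>2 + 1) (Suc k) (- 2 * q * cos \<theta>) * angular_density q \<theta>) has_integral 0) {0..pi}"
    using sine_moment_geometric[OF q, of k] by simp
qed

text \<open>The degenerate case \<open>v = 2\<close>: the density is constant and the polynomials
  become \<open>2 * (- 1) ^ k * cos (k * \<theta>)\<close>. At the end points the density formula is
  a division by zero with value 0, so these two points are discarded.\<close>

lemma angular_integral_eq1:
  shows "(angular_density 1 has_integral 1) {0..pi}"
    and "((\<lambda>\<theta>. kesten_mckay_poly 2 (Suc k) (- 2 * cos \<theta>) * angular_density 1 \<theta>) has_integral 0) {0..pi}"
proof -
  have ad: "angular_density 1 \<theta> = 1 / pi" if "\<theta> \<in> {0..pi} - {0, pi}" for \<theta>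
  proof -
    have "sin \<theta> \<noteq> 0" using that sin_gt_zero[of \<theta>] by auto
    then show ?thesis unfolding angular_density_def angular_denominator by simp
  qed
  have "((\<lambda>\<theta>. 1 / pi) has_integral 1) {0..pi}"
    using has_integral_const_real[of "1 / pi :: real" 0 pi] by simp
  from has_integral_spike_finite[OF _ _ this, of "{0, pi}" "angular_density 1"]
  show "(angular_density 1 has_integral 1) {0..pi}" by (simp add: ad)
  have P: "kesten_mckay_poly 2 (Suc k) (- 2 * cos \<theta>) * angular_density 1 \<theta> = (2 * (- 1) ^ Suc k / pi) * cos (real (Suc k) * \<theta>)"
    if th: "\<theta> \<in> {0..pi} - {0, pi}" for \<theta>
  proof -
    have s: "sin \<theta> \<noteq> 0" using that sin_gt_zero[of \<theta>] by auto
    have "real (k + 2) * \<theta> = real (Suc k) * \<theta> + \<theta>" "real k * \<theta> = real (Suc k) * \<theta> - \<theta>" by (simp_all add: algebra_simps)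
    then have "sin (real (k + 2) * \<theta>) - sin (real k * \<theta>) = 2 * cos (real (Suc k) * \<theta>) * sin \<theta>"
      by (simp only: sin_add sin_diff)
    then have "sin \<theta> * kesten_mckay_poly 2 (Suc k) (- 2 * cos \<theta>) = sin \<theta> * (2 * (- 1) ^ Suc k * cos (real (Suc k) * \<theta>))"
      using sin_mult_kesten_mckay_poly[of 1 \<theta> k] by simp
    then have "kesten_mckay_poly 2 (Suc k) (- 2 * cos \<theta>) = 2 * (- 1) ^ Suc k * cos (real (Suc k) * \<theta>)"
      using s by (simp only: mult_cancel_left) simp
    then show ?thesis using ad[OF th] by simp
  qed
  have "((\<lambda>\<theta>. (2 * (- 1) ^ Suc k / pi) * cos (real (Suc k) * \<theta>)) has_integral (2 * (- 1) ^ Suc k / pi) * 0) {0..pi}"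
    by (intro has_integral_mult_right integral_cos_mult) simp
  from has_integral_spike_finite[OF _ P this, of "{0, pi}"]
  show "((\<lambda>\<theta>. kesten_mckay_poly 2 (Suc k) (- 2 * cos \<theta>) * angular_density 1 \<theta>) has_integral 0) {0..pi}"
    by (simp del: kesten_mckay_poly.simps)
qed

lemma angular_integral:
  assumes "q \<ge> 1"
  shows "(angular_density q has_integral 1) {0..pi}"
    and "((\<lambda>\<theta>. kesten_mckay_poly (q\<^sup>2 + 1) (Suc k) (- 2 * q * cos \<theta>) * angular_density q \<theta>) has_integral 0) {0..pi}"
proof -
  have "q = 1 \<or> q > 1" using assms by auto
  then show "(angular_density q has_integral 1) {0..pi}"
    "((\<lambda>\<theta>. kesten_mckay_poly (q\<^sup>2 + 1) (Suc k) (- 2 * q * cos \<theta>) * angular_density q \<theta>) has_integral 0) {0..pi}"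
    using angular_integral_eq1 angular_integral_gt1 by (auto simp del: kesten_mckay_poly.simps)
qed

text \<open>The square \<open>(q ^ 2 - 1) ^ 2\<close> is dropped from the denominator. This bound
  survives at \<open>q = 1\<close> and makes continuous functions integrable against the
  density.\<close>

lemma angular_density_le: "angular_density q \<theta> \<le> (q\<^sup>2 + 1) / (2 * pi)"
proof (cases "q\<^sup>2 * (sin \<theta>)\<^sup>2 = 0")
  case True
  then show ?thesis by (auto simp: angular_density_def)
next
  case False
  then have pos: "q\<^sup>2 * (sin \<theta>)\<^sup>2 > 0" by (simp add: less_le)
  have "angular_density q \<theta> = (q\<^sup>2 + 1) * (2 * (q\<^sup>2 * (sin \<theta>)\<^sup>2)) / (pi * ((q\<^sup>2 - 1)\<^sup>2 + 4 * (q\<^sup>2 * (sin \<theta>)\<^sup>2)))"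
    unfolding angular_density_def angular_denominator by (simp add: mult_ac)
  also have "\<dots> \<le> (q\<^sup>2 + 1) * (2 * (q\<^sup>2 * (sin \<theta>)\<^sup>2)) / (pi * (4 * (q\<^sup>2 * (sin \<theta>)\<^sup>2)))"
    using pos by (intro divide_left_mono mult_left_mono mult_pos_pos add_nonneg_pos) auto
  also have "\<dots> = (q\<^sup>2 + 1) / (2 * pi)"
  proof -
    have "c * (2 * t) / (pi * (4 * t)) = c / (2 * pi)" if "t > 0" for c t :: real
      using that by (simp add: field_simps)
    then show ?thesis using pos by blast
  qed
  finally show ?thesis .
qed

lemma set_integrable_angular:
  assumes "continuous_on UNIV f"
  shows "set_integrable lborel {0..pi} (\<lambda>\<theta>. f (- 2 * q * cos \<theta>) * angular_density q \<theta>)"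
proof -
  have cont: "continuous_on {0..pi} (\<lambda>\<theta>. f (- 2 * q * cos \<theta>))"
    by (rule continuous_on_compose2[OF assms]) (auto intro!: continuous_intros)
  have [measurable]: "f \<in> borel_measurable borel" using assms by (rule borel_measurable_continuous_onI)
  have "bounded ((\<lambda>\<theta>. f (- 2 * q * cos \<theta>)) ` {0..pi})"
    by (intro compact_imp_bounded compact_continuous_image cont) simp
  then obtain B where B: "\<And>\<theta>. \<theta> \<in> {0..pi} \<Longrightarrow> \<bar>f (- 2 * q * cos \<theta>)\<bar> \<le> B"
    unfolding bounded_iff real_norm_def by blast
  have "norm (f (- 2 * q * cos \<theta>) * angular_density q \<theta>) \<le> B * ((q\<^sup>2 + 1) / (2 * pi))"
    if "\<theta> \<in> {0..pi}" for \<theta>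
    using B[OF that] angular_density_le[of q \<theta>] angular_density_nonneg[of q \<theta>]
    unfolding real_norm_def abs_mult by (intro mult_mono) auto
  then show ?thesis unfolding set_integrable_def
    by (intro integrableI_bounded_set_indicator[where B = "B * ((q\<^sup>2 + 1) / (2 * pi))"]) auto
qed

section \<open>Integration against the Kesten-McKay law\<close>

lemma kesten_mckay_integral_eq:
  assumes q: "q \<ge> 1" and f: "continuous_on UNIV f"
    and I: "((\<lambda>\<theta>. f (- 2 * q * cos \<theta>) * angular_density q \<theta>) has_integral I) {0..pi}"
  shows "integrable (kesten_mckay (q\<^sup>2 + 1)) f" "integral\<^sup>L (kesten_mckay (q\<^sup>2 + 1)) f = I"
proof -
  have [measurable]: "f \<in> borel_measurable borel" using f by (rule borel_measurable_continuous_onI)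
  note si = set_integrable_angular[OF f, of q]
  have nn: "0 \<le> angular_density q \<theta> * indicator {0..pi} \<theta>" for \<theta>
    by (simp add: angular_density_nonneg indicator_def)
  have "integrable (angular_measure q) (\<lambda>\<theta>. f (- 2 * q * cos \<theta>))"
    unfolding angular_measure_def
    by (subst integrable_density) (use si in \<open>simp_all add: nn set_integrable_def mult_ac\<close>)
  then show "integrable (kesten_mckay (q\<^sup>2 + 1)) f"
    unfolding kesten_mckay_eq_distr[OF q] by (subst integrable_distr_eq) auto
  have "integral\<^sup>L (kesten_mckay (q\<^sup>2 + 1)) f = integral\<^sup>L (angular_measure q) (\<lambda>\<theta>. f (- 2 * q * cos \<theta>))"
    unfolding kesten_mckay_eq_distr[OF q] by (subst integral_distr) auto
  also have "\<dots> = (LINT \<theta>:{0..pi}|lborel. f (- 2 * q * cos \<theta>) * angular_density q \<theta>)"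
    unfolding angular_measure_def set_lebesgue_integral_def
    by (subst integral_density) (simp_all add: nn mult_ac)
  also have "\<dots> = integral {0..pi} (\<lambda>\<theta>. f (- 2 * q * cos \<theta>) * angular_density q \<theta>)"
    by (rule set_borel_integral_eq_integral(2)[OF si])
  also have "\<dots> = I" using I by (rule integral_unique)
  finally show "integral\<^sup>L (kesten_mckay (q\<^sup>2 + 1)) f = I" .
qed

lemma continuous_kesten_mckay_poly [continuous_intros]: "continuous_on A (kesten_mckay_poly v k)"
proof (induction v k "0 :: real" rule: kesten_mckay_poly.induct)
  case (3 v k)
  have "kesten_mckay_poly v (Suc (Suc k)) = (\<lambda>x. x * kesten_mckay_poly v (Suc k) x
      - (if k = 0 then v else v - 1) * kesten_mckay_poly v k x)" by auto
  then show ?case using 3 by (auto intro!: continuous_intros)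
qed (auto simp: fun_eq_iff[THEN iffD2, of "kesten_mckay_poly _ 0" "\<lambda>_. 1"] fun_eq_iff[THEN iffD2, of "kesten_mckay_poly _ (Suc 0)" "\<lambda>x. x"])

lemma kesten_mckay_integral_poly:
  assumes v: "v \<ge> 2" and k: "k \<ge> 1"
  shows "integrable (kesten_mckay v) (kesten_mckay_poly v k)"
    "integral\<^sup>L (kesten_mckay v) (kesten_mckay_poly v k) = 0"
proof -
  define q where "q = sqrt (v - 1)"
  have q: "q \<ge> 1" "q\<^sup>2 + 1 = v" using v by (simp_all add: q_def)
  obtain k' where k': "k = Suc k'" using k by (cases k) auto
  have "((\<lambda>\<theta>. kesten_mckay_poly v k (- 2 * q * cos \<theta>) * angular_density q \<theta>) has_integral 0) {0..pi}"
    using angular_integral(2)[OF q(1), of k'] unfolding q(2) k' .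
  from kesten_mckay_integral_eq[OF q(1) continuous_kesten_mckay_poly this]
  show "integrable (kesten_mckay v) (kesten_mckay_poly v k)"
    "integral\<^sup>L (kesten_mckay v) (kesten_mckay_poly v k) = 0" unfolding q(2) .
qed

lemma real_distribution_kesten_mckay:
  assumes v: "v \<ge> 2"
  shows "real_distribution (kesten_mckay v)"
proof -
  define q where "q = sqrt (v - 1)"
  have q: "q \<ge> 1" "q\<^sup>2 + 1 = v" using v by (simp_all add: q_def)
  have "((\<lambda>\<theta>. (\<lambda>_. 1 :: real) (- 2 * q * cos \<theta>) * angular_density q \<theta>) has_integral 1) {0..pi}"
    using angular_integral(1)[OF q(1)] by simp
  from kesten_mckay_integral_eq[OF q(1) _ this]
  have 1: "measure (kesten_mckay v) (space (kesten_mckay v)) = 1"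
    unfolding q(2) by simp
  \<comment> \<open>\<open>measure\<close> assigns 0 to an infinite mass, so the value 1 excludes
    that case.\<close>
  then have "emeasure (kesten_mckay v) (space (kesten_mckay v)) \<noteq> \<top>"
    by (auto simp: measure_def)
  then have "emeasure (kesten_mckay v) (space (kesten_mckay v)) = 1"
    using 1 by (simp add: emeasure_eq_ennreal_measure)
  then show ?thesis
    by (intro real_distribution.intro prob_spaceI real_distribution_axioms.intro) simp_all
qed

text \<open>The support ends at \<open>2 * sqrt (v - 1)\<close>, at most \<open>v\<close> by the
  inequality of the means. The weaker bound \<open>v\<close> is the one available for the
  eigenvalues of the compression, so a single compact interval serves both.\<close>

lemma AE_kesten_mckay_bounded:
  assumes v: "v \<ge> 2"
  shows "AE x in kesten_mckay v. \<bar>x\<bar> \<le> v"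
proof -
  define q where "q = sqrt (v - 1)"
  have q: "q \<ge> 1" "q\<^sup>2 + 1 = v" using v by (simp_all add: q_def)
  have "2 * q \<le> v" using q(2) sum_squares_bound[of q 1] by (simp add: power2_eq_square)
  moreover have "\<bar>2 * q * cos \<theta>\<bar> \<le> 2 * q" for \<theta>
    using q(1) abs_cos_le_one[of \<theta>] by (simp add: abs_mult mult_left_le)
  ultimately have "\<bar>2 * q * cos \<theta>\<bar> \<le> v" for \<theta> using order_trans by blast
  then show ?thesis
    unfolding q(2)[symmetric] kesten_mckay_eq_distr[OF q(1)]
    by (subst AE_distr_iff) (auto simp: q(2))
qed

section \<open>Correlations of the Legendre symbol\<close>

lemma Legendre_cong:
  assumes "[x = y] (mod q)"
  shows "Legendre x q = Legendre y q"
proof -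
  have "[x = z] (mod q) \<longleftrightarrow> [y = z] (mod q)" "[z = x] (mod q) \<longleftrightarrow> [z = y] (mod q)" for z
    using assms by (auto simp: cong_def)
  then show ?thesis unfolding Legendre_def QuadRes_def by simp
qed

lemma Legendre_mod [simp]: "Legendre (x mod q) q = Legendre x q"
  by (intro Legendre_cong) simp

lemma Legendre_cases: "Legendre x q = 0 \<or> Legendre x q = 1 \<or> Legendre x q = - 1"
  by (simp add: Legendre_def)

text \<open>Euler's criterion gives the identity modulo \<open>p\<close>. Both sides lie in
  \<open>{- 1, 0, 1}\<close>, so they differ by at most 2, which is less than
  \<open>p\<close>.\<close>

lemma Legendre_mult:
  assumes p: "prime p" "2 < p"
  shows "Legendre (x * y) (int p) = Legendre x (int p) * Legendre y (int p)"
proof -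
  have "[Legendre (x * y) (int p) = x ^ ((p - 1) div 2) * y ^ ((p - 1) div 2)] (mod int p)"
    using euler_criterion[OF p, of "x * y"] by (simp add: power_mult_distrib)
  moreover have "[Legendre x (int p) * Legendre y (int p) = x ^ ((p - 1) div 2) * y ^ ((p - 1) div 2)] (mod int p)"
    by (intro cong_mult euler_criterion p)
  ultimately have "[Legendre (x * y) (int p) = Legendre x (int p) * Legendre y (int p)] (mod int p)"
    using cong_sym cong_trans by blast
  then have "int p dvd Legendre (x * y) (int p) - Legendre x (int p) * Legendre y (int p)"
    by (simp add: cong_iff_dvd_diff)
  moreover have "\<bar>Legendre (x * y) (int p) - Legendre x (int p) * Legendre y (int p)\<bar> \<le> 2"
    using Legendre_cases[of "x * y" "int p"] Legendre_cases[of x "int p"] Legendre_cases[of y "int p"] by auto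
  ultimately show ?thesis
    using p(2) dvd_imp_le_int[of "Legendre (x * y) (int p) - Legendre x (int p) * Legendre y (int p)" "int p"] by linarith
qed

lemma sum_residue_field_affine:
  fixes g :: "int \<Rightarrow> 'b::comm_monoid_add"
  assumes "p > 0" "coprime c (int p)" and g: "\<And>x. g (x mod int p) = g x"
  shows "(\<Sum>z\<in>residue_field p. g (c * z + d)) = (\<Sum>z\<in>residue_field p. g z)"
proof -
  have inj: "inj_on (\<lambda>z. (c * z + d) mod int p) (residue_field p)"
  proof (rule inj_onI)
    fix x y assume xy: "x \<in> residue_field p" "y \<in> residue_field p"
      and "(c * x + d) mod int p = (c * y + d) mod int p"
    then have "[c * x + d = c * y + d] (mod int p)" by (simp add: cong_def)
    then have "[c * x = c * y] (mod int p)" by (simp add: cong_add_rcancel)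
    then have "[x = y] (mod int p)" using assms(2) by (simp add: cong_mult_lcancel)
    then show "x = y" using xy by (simp add: residue_field_def cong_def)
  qed
  moreover have "(\<lambda>z. (c * z + d) mod int p) ` residue_field p \<subseteq> residue_field p"
    using assms(1) by (auto simp: residue_field_def)
  ultimately have bij: "bij_betw (\<lambda>z. (c * z + d) mod int p) (residue_field p) (residue_field p)"
    using endo_inj_surj[of "residue_field p"] by (simp add: bij_betw_def residue_field_def)
  have "(\<Sum>z\<in>residue_field p. g (c * z + d)) = (\<Sum>z\<in>residue_field p. g ((c * z + d) mod int p))"
    by (simp add: g)
  also have "\<dots> = (\<Sum>z\<in>residue_field p. g z)" by (rule sum.reindex_bij_betw[OF bij])
  finally show ?thesis .
qed

text \<open>Squaring identifies 1 and \<open>- 1\<close>, so it is not injective on the finite set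
  of residues and hence not surjective. The missed value is non-zero because 0 is a square.\<close>

lemma ex_nonresidue:
  assumes p: "prime p" "2 < p"
  shows "\<exists>g. Legendre g (int p) = - 1"
proof -
  define f where "f z = z\<^sup>2 mod int p" for z
  have "f 1 = f (int p - 1)"
  proof -
    have "(int p - 1)\<^sup>2 = 1 + int p * (int p - 2)" by (simp add: power2_eq_square algebra_simps)
    then show ?thesis unfolding f_def by simp
  qed
  moreover have "1 \<in> residue_field p" "int p - 1 \<in> residue_field p" "1 \<noteq> int p - 1"
    using p(2) by (auto simp: residue_field_def)
  ultimately have "\<not> inj_on f (residue_field p)" by (metis inj_onD)
  then have "\<not> residue_field p \<subseteq> f ` residue_field p"
    using finite_surj_inj[of "residue_field p" f] by (auto simp: residue_field_def)
  then obtain g where g: "g \<in> residue_field p" "g \<notin> f ` residue_field p" by blast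
  have "\<not> QuadRes (int p) g"
  proof
    assume "QuadRes (int p) g"
    then obtain y where "[y\<^sup>2 = g] (mod int p)" by (auto simp: QuadRes_def)
    then have "f (y mod int p) = g" using g(1) by (simp add: f_def cong_def residue_field_def power_mod)
    moreover have "y mod int p \<in> residue_field p" using p(2) by (simp add: residue_field_def)
    ultimately show False using g(2) by blast
  qed
  moreover have "\<not> [g = 0] (mod int p)"
  proof
    assume "[g = 0] (mod int p)"
    then have "g = 0" using g(1) by (simp add: cong_def residue_field_def)
    moreover have "f 0 = 0" by (simp add: f_def)
    moreover have "0 \<in> residue_field p" using p(2) by (simp add: residue_field_def)
    ultimately show False using g(2) by (metis imageI)
  qed
  ultimately show ?thesis by (auto simp: Legendre_def)
qed

lemma coprime_residue:
  assumes "prime p" "\<not> int p dvd c"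
  shows "coprime c (int p)"
proof -
  have "prime (int p)" using assms(1) by simp
  then have "coprime (int p) c" using assms(2) by (rule prime_imp_coprime)
  then show ?thesis by (simp add: coprime_commute)
qed

text \<open>Multiplication by a non-residue permutes the residues and changes the sign of every
  term.\<close>

lemma sum_Legendre:
  assumes p: "prime p" "2 < p"
  shows "(\<Sum>z\<in>residue_field p. Legendre z (int p)) = 0"
proof -
  obtain g where g: "Legendre g (int p) = - 1" using ex_nonresidue[OF p] by blast
  then have "\<not> int p dvd g" by (auto simp: Legendre_def cong_0_iff split: if_splits)
  then have "coprime g (int p)" using coprime_residue p by blast
  have "(\<Sum>z\<in>residue_field p. Legendre z (int p)) = (\<Sum>z\<in>residue_field p. Legendre (g * z + 0) (int p))"
    using \<open>coprime g (int p)\<close> p(2) by (intro sum_residue_field_affine[symmetric]) auto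
  also have "\<dots> = - (\<Sum>z\<in>residue_field p. Legendre z (int p))"
    using g by (simp add: Legendre_mult[OF p] sum_negf)
  finally show ?thesis by simp
qed

lemma Legendre_square:
  "Legendre x q * Legendre x q = of_bool (\<not> q dvd x)"
  by (simp add: Legendre_def cong_0_iff)

lemma sum_Legendre_square:
  assumes "p > 0"
  shows "(\<Sum>z\<in>residue_field p. Legendre z (int p) * Legendre z (int p)) = int p - 1"
proof -
  have "(\<Sum>z\<in>residue_field p. Legendre z (int p) * Legendre z (int p)) = (\<Sum>z\<in>residue_field p - {0}. 1)"
    using assms by (intro sum.mono_neutral_cong_right)
      (auto simp: Legendre_square residue_field_def dest: zdvd_imp_le)
  also have "\<dots> = int (card (residue_field p - {0}))" by simp
  also have "card (residue_field p - {0}) = p - 1" using assms by (simp add: residue_field_def)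
  finally show ?thesis using assms by (simp add: of_nat_diff)
qed

text \<open>All correlations at a non-zero shift are equal by scaling, and the correlations at all shifts
  add up to the square of the vanishing full sum.\<close>

lemma sum_Legendre_correlation:
  assumes p: "prime p" "2 < p"
  shows "(\<Sum>z\<in>residue_field p. Legendre (x - z) (int p) * Legendre (y - z) (int p))
     = int p * of_bool (int p dvd x - y) - 1"
proof -
  define c where "c d = (\<Sum>z\<in>residue_field p. Legendre z (int p) * Legendre (z + d) (int p))" for d
  have fin: "finite (residue_field p)" by (simp add: residue_field_def)
  have per: "Legendre (z mod int p + d) (int p) = Legendre (z + d) (int p)" for z d
    by (intro Legendre_cong) (simp add: cong_def mod_add_left_eq)
  have cmod: "c (d mod int p) = c d" for d
    unfolding c_def by (intro sum.cong refl arg_cong2[of _ _ _ _ "(*)"] Legendre_cong) (simp add: cong_def mod_add_right_eq)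
  have c0: "c 0 = int p - 1" using sum_Legendre_square p(2) by (simp add: c_def)
  have c1: "c d = c 1" if d: "\<not> int p dvd d" for d
  proof -
    have "c d = (\<Sum>z\<in>residue_field p. Legendre (d * z + 0) (int p) * Legendre (d * z + 0 + d) (int p))"
      unfolding c_def using coprime_residue[OF p(1) d] p(2)
      by (intro sum_residue_field_affine[symmetric]) (auto simp: per)
    also have "\<dots> = (\<Sum>z\<in>residue_field p. (Legendre d (int p) * Legendre d (int p)) * (Legendre z (int p) * Legendre (z + 1) (int p)))"
    proof (intro sum.cong refl)
      fix z
      have "d * z + 0 + d = d * (z + 1)" by (simp add: algebra_simps)
      then show "Legendre (d * z + 0) (int p) * Legendre (d * z + 0 + d) (int p) = (Legendre d (int p) * Legendre d (int p)) * (Legendre z (int p) * Legendre (z + 1) (int p))"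
        by (simp add: Legendre_mult[OF p])
    qed
    also have "\<dots> = c 1" using d by (simp add: Legendre_square c_def)
    finally show ?thesis .
  qed
  have s0: "(\<Sum>d\<in>residue_field p. Legendre (1 * d + z) (int p)) = 0" for z
    using sum_Legendre[OF p] p(2) by (subst sum_residue_field_affine) auto
  have "(\<Sum>d\<in>residue_field p. c d) = (\<Sum>z\<in>residue_field p. Legendre z (int p) * (\<Sum>d\<in>residue_field p. Legendre (1 * d + z) (int p)))"
    unfolding c_def by (subst sum.swap) (simp add: sum_distrib_left add.commute)
  then have "(\<Sum>d\<in>residue_field p. c d) = 0" unfolding s0 by simp
  moreover have "(\<Sum>d\<in>residue_field p. c d) = c 0 + (\<Sum>d\<in>residue_field p - {0}. c d)"
    using fin p(2) by (subst sum.remove[of _ 0]) (auto simp: residue_field_def)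
  moreover have "(\<Sum>d\<in>residue_field p - {0}. c d) = (\<Sum>d\<in>residue_field p - {0}. c 1)"
    by (intro sum.cong refl c1) (auto simp: residue_field_def dest: zdvd_imp_le)
  moreover have "card (residue_field p - {0}) = p - 1" using p(2) by (simp add: residue_field_def)
  ultimately have "(int p - 1) * (1 + c 1) = 0" using c0 p(2) by (simp add: of_nat_diff algebra_simps)
  then have c1': "c 1 = - 1" using p(2) by auto
  have "(\<Sum>z\<in>residue_field p. Legendre (x - z) (int p) * Legendre (y - z) (int p))
     = (\<Sum>z\<in>residue_field p. Legendre ((- 1) * z + x) (int p) * Legendre ((- 1) * z + x + (y - x)) (int p))"
    by (simp add: algebra_simps)
  also have "\<dots> = c (y - x)"
    unfolding c_def using p(2) by (intro sum_residue_field_affine) (auto simp: per)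
  also have "\<dots> = int p * of_bool (int p dvd x - y) - 1"
  proof (cases "int p dvd x - y")
    case True
    then have "(y - x) mod int p = 0" by (simp add: dvd_diff_commute mod_eq_0_iff_dvd)
    then show ?thesis using cmod[of "y - x"] c0 True by simp
  next
    case False
    then show ?thesis using c1[of "y - x"] c1' by (simp add: dvd_diff_commute)
  qed
  finally show ?thesis .
qed

text \<open>For \<open>p = 4 * m + 1\<close> the exponent \<open>(p - 1) div 2\<close> in Euler's
  criterion is even.\<close>

lemma Legendre_minus:
  assumes "prime p" "[p = 1] (mod 4)"
  shows "Legendre (- x) (int p) = Legendre x (int p)"
proof -
  have "p mod 4 = 1" using assms(2) by (simp add: cong_def)
  then obtain m where m: "p = 4 * m + 1" by (metis mod_div_mult_eq add.commute mult.commute)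
  then have p2: "2 < p" using assms(1) by (cases m) auto
  have "[Legendre (- x) (int p) = (- x) ^ ((p - 1) div 2)] (mod int p)"
    by (rule euler_criterion[OF assms(1) p2])
  moreover have "(- x) ^ ((p - 1) div 2) = x ^ ((p - 1) div 2)" using m by simp
  moreover have "[Legendre x (int p) = x ^ ((p - 1) div 2)] (mod int p)"
    by (rule euler_criterion[OF assms(1) p2])
  ultimately have "[Legendre (- x) (int p) = Legendre x (int p)] (mod int p)"
    using cong_sym cong_trans by metis
  then have "int p dvd Legendre (- x) (int p) - Legendre x (int p)" by (simp add: cong_iff_dvd_diff)
  moreover have "\<bar>Legendre (- x) (int p) - Legendre x (int p)\<bar> \<le> 2"
    using Legendre_cases[of "- x" "int p"] Legendre_cases[of x "int p"] by auto
  ultimately show ?thesis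
    using p2 dvd_imp_le_int[of "Legendre (- x) (int p) - Legendre x (int p)" "int p"] by linarith
qed

section \<open>Compressions of involutions\<close>

text \<open>The kernel of the word \<open>s r s \<dots> r s\<close> with \<open>k + 1\<close> factors \<open>s\<close> and \<open>k\<close> diagonal factors \<open>r\<close>.\<close>

fun walk :: "'a set \<Rightarrow> ('a \<Rightarrow> 'a \<Rightarrow> real) \<Rightarrow> ('a \<Rightarrow> real) \<Rightarrow> nat \<Rightarrow> 'a \<Rightarrow> 'a \<Rightarrow> real" where
  "walk X s r 0 x y = s x y"
| "walk X s r (Suc k) x y = (\<Sum>z\<in>X. s x z * r z * walk X s r k z y)"

lemma walk_Suc_right: "walk X s r (Suc k) x y = (\<Sum>z\<in>X. walk X s r k x z * r z * s z y)"
proof (induction k arbitrary: x)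
  case (Suc k)
  have "walk X s r (Suc (Suc k)) x y = (\<Sum>w\<in>X. s x w * r w * (\<Sum>z\<in>X. walk X s r k w z * r z * s z y))"
    by (subst walk.simps(2)) (simp only: Suc)
  also have "\<dots> = (\<Sum>w\<in>X. \<Sum>z\<in>X. s x w * r w * walk X s r k w z * r z * s z y)"
    by (simp add: sum_distrib_left mult.assoc)
  also have "\<dots> = (\<Sum>z\<in>X. walk X s r (Suc k) x z * r z * s z y)"
    by (subst sum.swap) (simp add: sum_distrib_right)
  finally show ?case .
qed simp

lemma sum_restrict_of_bool:
  fixes f :: "'a \<Rightarrow> real"
  assumes "finite X" "V \<subseteq> X"
  shows "(\<Sum>z\<in>X. of_bool (z \<in> V) * f z) = (\<Sum>z\<in>V. f z)"
proof -
  have "(\<Sum>z\<in>X. of_bool (z \<in> V) * f z) = (\<Sum>z\<in>X \<inter> V. f z)"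
    using assms(1) by (simp add: Int_def)
  then show ?thesis using assms(2) by (simp add: Int_absorb1)
qed

locale involution_compression =
  fixes X V :: "'a set" and s :: "'a \<Rightarrow> 'a \<Rightarrow> real" and v :: real
  assumes finX: "finite X" and VX: "V \<subseteq> X"
    and sym: "\<And>x y. x \<in> X \<Longrightarrow> y \<in> X \<Longrightarrow> s x y = s y x"
    and inv: "\<And>x y. x \<in> X \<Longrightarrow> y \<in> X \<Longrightarrow> (\<Sum>z\<in>X. s x z * s z y) = of_bool (x = y)"
begin

definition r :: "'a \<Rightarrow> real" where "r x = v * of_bool (x \<in> V) - 1"

definition W :: "nat \<Rightarrow> 'a \<Rightarrow> 'a \<Rightarrow> real" where "W = walk X s r"

lemma finV: "finite V" using finX VX finite_subset by blast

lemma involution_apply: "(\<Sum>z\<in>X. s x z * (\<Sum>w\<in>X. s z w * f w)) = f x" if "x \<in> X"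
proof -
  have "(\<Sum>z\<in>X. s x z * (\<Sum>w\<in>X. s z w * f w)) = (\<Sum>w\<in>X. (\<Sum>z\<in>X. s x z * s z w) * f w)"
    unfolding sum_distrib_left sum_distrib_right by (subst sum.swap) (simp add: mult.assoc)
  also have "\<dots> = (\<Sum>w\<in>X. of_bool (x = w) * f w)" using inv that by (intro sum.cong) auto
  also have "\<dots> = f x" by (rule sum_mult_delta[OF finX that])
  finally show ?thesis .
qed

lemma sum_V_eq: "(\<Sum>z\<in>V. v * s x z * f z) = (\<Sum>z\<in>X. s x z * r z * f z) + (\<Sum>z\<in>X. s x z * f z)"
proof -
  have "(\<Sum>z\<in>V. v * s x z * f z) = (\<Sum>z\<in>X. of_bool (z \<in> V) * (v * s x z * f z))"
    by (rule sum_restrict_of_bool[OF finX VX, symmetric])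
  also have "\<dots> = (\<Sum>z\<in>X. s x z * r z * f z + s x z * f z)"
    by (intro sum.cong) (auto simp: r_def algebra_simps)
  finally show ?thesis by (simp add: sum.distrib)
qed

text \<open>The weight \<open>v\<close> on \<open>V\<close> is \<open>r + 1\<close> on
  \<open>X\<close>. The part \<open>r\<close> lengthens the word by one step; the part 1 puts two
  factors \<open>s\<close> side by side, which cancel. What remains is the identity for
  \<open>k = 0\<close>, and otherwise the shorter word with the diagonal factor
  \<open>r x = v - 1\<close> in front. After multiplication by \<open>v\<close> this is where the
  coefficient \<open>v\<close> of the second polynomial and \<open>v - 1\<close> of all later ones
  come from.\<close>

lemma walk_recurrence:
  assumes x: "x \<in> V" and y: "y \<in> V"
  shows "(\<Sum>z\<in>V. v * s x z * W 0 z y) = W 1 x y + of_bool (x = y)"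
    and "(\<Sum>z\<in>V. v * s x z * W (Suc k) z y) = W (Suc (Suc k)) x y + (v - 1) * W k x y"
proof -
  have xX: "x \<in> X" "y \<in> X" using x y VX by auto
  show "(\<Sum>z\<in>V. v * s x z * W 0 z y) = W 1 x y + of_bool (x = y)"
    unfolding sum_V_eq using inv[OF xX] by (simp add: W_def)
  have "(\<Sum>z\<in>X. s x z * W (Suc k) z y) = (\<Sum>z\<in>X. s x z * (\<Sum>w\<in>X. s z w * (r w * W k w y)))"
    by (simp add: W_def mult.assoc)
  also have "\<dots> = r x * W k x y" by (rule involution_apply[OF xX(1)])
  also have "r x = v - 1" using x by (simp add: r_def)
  finally show "(\<Sum>z\<in>V. v * s x z * W (Suc k) z y) = W (Suc (Suc k)) x y + (v - 1) * W k x y"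
    unfolding sum_V_eq by (simp add: W_def)
qed

text \<open>Restricted to \<open>V\<close>, the kernel \<open>v * W k\<close> is a polynomial in the
  kernel \<open>v * s\<close>; a word of index \<open>k\<close> has \<open>k + 1\<close> factors
  \<open>s\<close>, hence the degree \<open>Suc k\<close>.\<close>

lemma walk_eigenvector:
  assumes eb: "eigenbasis V (\<lambda>x y. v * s x y) l u" and i: "i \<in> V" and x: "x \<in> V"
  shows "(\<Sum>y\<in>V. v * W k x y * u i y) = kesten_mckay_poly v (Suc k) (l i) * u i x"
  using x
proof (induction k arbitrary: x rule: less_induct)
  case (less k)
  have step: "(\<Sum>y\<in>V. v * (\<Sum>z\<in>V. v * s x z * g z y) * u i y) = c * (l i * u i x)"
    if "\<And>z. z \<in> V \<Longrightarrow> (\<Sum>y\<in>V. v * g z y * u i y) = c * u i z" for g c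
  proof -
    have "(\<Sum>y\<in>V. v * (\<Sum>z\<in>V. v * s x z * g z y) * u i y) = (\<Sum>z\<in>V. v * s x z * (\<Sum>y\<in>V. v * g z y * u i y))"
      unfolding sum_distrib_left sum_distrib_right by (subst sum.swap) (simp add: mult_ac)
    also have "\<dots> = (\<Sum>z\<in>V. v * s x z * (c * u i z))" by (intro sum.cong refl) (simp add: that)
    also have "\<dots> = c * (\<Sum>z\<in>V. v * s x z * u i z)" by (simp add: sum_distrib_left mult_ac)
    finally show ?thesis using eigenbasisD(1)[OF eb i less.prems] by simp
  qed
  consider "k = 0" | "k = 1" | m where "k = Suc (Suc m)" by (metis One_nat_def not0_implies_Suc)
  then show ?case
  proof cases
    case 1
    then show ?thesis using eigenbasisD(1)[OF eb i less.prems] by (simp add: W_def)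
  next
    case 2
    have "(\<Sum>y\<in>V. v * W 1 x y * u i y) =
        (\<Sum>y\<in>V. v * (\<Sum>z\<in>V. v * s x z * W 0 z y) * u i y - v * (u i y * of_bool (x = y)))"
      using walk_recurrence(1)[OF less.prems] by (intro sum.cong refl) (simp add: algebra_simps)
    also have "\<dots> = l i * (l i * u i x) - v * u i x"
      unfolding sum_subtractf sum_distrib_left[symmetric] sum_mult_delta[OF finV less.prems]
      using less.IH[of 0] 2 by (subst step[of "W 0" "l i"]) auto
    finally show ?thesis using 2 by (simp add: algebra_simps)
  next
    case (3 m)
    have "(\<Sum>y\<in>V. v * W k x y * u i y) =
        (\<Sum>y\<in>V. v * (\<Sum>z\<in>V. v * s x z * W (Suc m) z y) * u i y - (v - 1) * (v * W m x y * u i y))"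
      unfolding 3
    proof (rule sum.cong[OF refl])
      fix y assume y: "y \<in> V"
      show "v * W (Suc (Suc m)) x y * u i y =
          v * (\<Sum>z\<in>V. v * s x z * W (Suc m) z y) * u i y - (v - 1) * (v * W m x y * u i y)"
        unfolding walk_recurrence(2)[OF less.prems y] by (simp add: algebra_simps)
    qed
    also have "\<dots> = kesten_mckay_poly v (Suc (Suc m)) (l i) * (l i * u i x) - (v - 1) * (kesten_mckay_poly v (Suc m) (l i) * u i x)"
      unfolding sum_subtractf sum_distrib_left[symmetric]
      using less.IH[of "Suc m"] less.IH[of m] 3 less.prems
      by (subst step[of "W (Suc m)" "kesten_mckay_poly v (Suc (Suc m)) (l i)"]) auto
    finally show ?thesis using 3 by (simp add: algebra_simps)
  qed
qed

text \<open>Completeness of the eigenvectors turns the sum over eigenvalues into the trace of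
  \<open>v * W k\<close> over \<open>V\<close>. Writing \<open>v\<close> on \<open>V\<close> as
  \<open>r + 1\<close> on \<open>X\<close> splits it: the first trace is that of a power of
  \<open>s r\<close>, the second can be shortened cyclically.\<close>

lemma sum_poly_eigenvalues:
  assumes eb: "eigenbasis V (\<lambda>x y. v * s x y) l u"
  shows "(\<Sum>i\<in>V. kesten_mckay_poly v (Suc k) (l i)) = (\<Sum>x\<in>X. r x * W k x x) + (\<Sum>x\<in>X. W k x x)"
proof -
  have "(\<Sum>i\<in>V. kesten_mckay_poly v (Suc k) (l i)) = (\<Sum>i\<in>V. \<Sum>x\<in>V. u i x * (kesten_mckay_poly v (Suc k) (l i) * u i x))"
  proof (intro sum.cong refl)
    fix i assume i: "i \<in> V"
    have "(\<Sum>x\<in>V. u i x * (kesten_mckay_poly v (Suc k) (l i) * u i x)) = kesten_mckay_poly v (Suc k) (l i) * (\<Sum>x\<in>V. u i x * u i x)"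
      by (simp add: sum_distrib_left mult_ac)
    then show "kesten_mckay_poly v (Suc k) (l i) = (\<Sum>x\<in>V. u i x * (kesten_mckay_poly v (Suc k) (l i) * u i x))"
      using eigenbasisD(2)[OF eb i i] by simp
  qed
  also have "\<dots> = (\<Sum>i\<in>V. \<Sum>x\<in>V. \<Sum>y\<in>V. v * W k x y * (u i x * u i y))"
    using walk_eigenvector[OF eb, symmetric] by (intro sum.cong refl) (simp add: sum_distrib_left mult_ac)
  also have "\<dots> = (\<Sum>x\<in>V. \<Sum>y\<in>V. v * W k x y * (\<Sum>i\<in>V. u i x * u i y))"
    by (subst sum.swap, rule sum.cong[OF refl], subst sum.swap) (simp add: sum_distrib_left)
  also have "\<dots> = (\<Sum>x\<in>V. \<Sum>y\<in>V. v * W k x y * of_bool (x = y))"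
    using eigenbasisD(3)[OF eb] by (intro sum.cong refl) auto
  also have "\<dots> = (\<Sum>x\<in>V. v * W k x x)" by (intro sum.cong refl sum_mult_delta[OF finV])
  also have "\<dots> = (\<Sum>x\<in>X. of_bool (x \<in> V) * (v * W k x x))"
    by (rule sum_restrict_of_bool[OF finX VX, symmetric])
  also have "\<dots> = (\<Sum>x\<in>X. r x * W k x x + W k x x)"
    by (intro sum.cong) (auto simp: r_def algebra_simps)
  finally show ?thesis by (simp add: sum.distrib)
qed

lemma trace_walk_1: "(\<Sum>x\<in>X. W (Suc 0) x x) = (\<Sum>x\<in>X. r x)"
proof -
  have "(\<Sum>x\<in>X. W (Suc 0) x x) = (\<Sum>z\<in>X. \<Sum>x\<in>X. r z * (s z x * s x z))"
    unfolding W_def walk.simps by (subst sum.swap) (simp add: mult_ac)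
  also have "\<dots> = (\<Sum>z\<in>X. r z)"
    by (intro sum.cong refl) (simp add: sum_distrib_left[symmetric] inv)
  finally show ?thesis .
qed

lemma r_square: "r x * r x = (v - 2) * r x + (v - 1)"
  by (simp add: r_def algebra_simps)

text \<open>Cyclically the first and the last \<open>s\<close> meet and cancel. The two outermost
  diagonal factors then meet as a square, which \<open>r_square\<close> makes linear.\<close>

lemma trace_walk_Suc_Suc:
  "(\<Sum>x\<in>X. W (Suc (Suc k)) x x) = (v - 2) * (\<Sum>x\<in>X. r x * W k x x) + (v - 1) * (\<Sum>x\<in>X. W k x x)"
proof -
  have "W (Suc (Suc k)) x x = (\<Sum>z\<in>X. \<Sum>w\<in>X. s x z * r z * (W k z w * r w * s w x))" for x
    unfolding W_def by (subst walk.simps(2)) (simp only: walk_Suc_right sum_distrib_left)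
  then have "(\<Sum>x\<in>X. W (Suc (Suc k)) x x) = (\<Sum>x\<in>X. \<Sum>z\<in>X. \<Sum>w\<in>X. r z * W k z w * r w * (s w x * s x z))"
    by (simp add: mult_ac)
  also have "\<dots> = (\<Sum>z\<in>X. \<Sum>w\<in>X. r z * W k z w * r w * (\<Sum>x\<in>X. s w x * s x z))"
    by (subst sum.swap, rule sum.cong[OF refl], subst sum.swap) (simp add: sum_distrib_left)
  also have "\<dots> = (\<Sum>z\<in>X. \<Sum>w\<in>X. r z * W k z w * r w * of_bool (w = z))"
    using inv by (intro sum.cong refl) auto
  also have "\<dots> = (\<Sum>z\<in>X. r z * W k z z * r z)" by (intro sum.cong refl sum_mult_delta[OF finX])
  also have "\<dots> = (\<Sum>z\<in>X. (v - 2) * (r z * W k z z) + (v - 1) * W k z z)"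
  proof (intro sum.cong refl)
    fix z
    have "r z * W k z z * r z = (r z * r z) * W k z z" by simp
    then show "r z * W k z z * r z = (v - 2) * (r z * W k z z) + (v - 1) * W k z z"
      unfolding r_square by (simp add: algebra_simps)
  qed
  finally show ?thesis by (simp add: sum.distrib sum_distrib_left)
qed

lemma norm_involution: "(\<Sum>x\<in>X. (\<Sum>y\<in>X. s x y * f y)\<^sup>2) = (\<Sum>x\<in>X. (f x)\<^sup>2)"
proof -
  have "(\<Sum>x\<in>X. (\<Sum>y\<in>X. s x y * f y)\<^sup>2) = (\<Sum>x\<in>X. \<Sum>y\<in>X. \<Sum>z\<in>X. (f y * f z) * (s y x * s x z))"
    unfolding power2_eq_square sum_product by (intro sum.cong refl) (simp add: sym mult_ac)
  also have "\<dots> = (\<Sum>y\<in>X. \<Sum>z\<in>X. (f y * f z) * (\<Sum>x\<in>X. s y x * s x z))"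
    by (subst sum.swap, rule sum.cong[OF refl], subst sum.swap) (simp add: sum_distrib_left)
  also have "\<dots> = (\<Sum>y\<in>X. \<Sum>z\<in>X. (f y * f z) * of_bool (y = z))"
    using inv by (intro sum.cong refl) auto
  also have "\<dots> = (\<Sum>y\<in>X. f y * f y)" by (intro sum.cong refl sum_mult_delta[OF finX])
  finally show ?thesis by (simp add: power2_eq_square)
qed

text \<open>An eigenvector is extended by zero to \<open>X\<close>; \<open>s\<close> preserves its
  norm, and restriction to \<open>V\<close> can only decrease it.\<close>

lemma eigenvalue_bound:
  assumes eb: "eigenbasis V (\<lambda>x y. v * s x y) l u" and i: "i \<in> V" and v: "v \<ge> 0"
  shows "\<bar>l i\<bar> \<le> v"
proof -
  define f where "f x = of_bool (x \<in> V) * u i x" for x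
  have sf: "(\<Sum>y\<in>X. s x y * f y) = (\<Sum>y\<in>V. s x y * u i y)" for x
  proof -
    have "(\<Sum>y\<in>X. s x y * f y) = (\<Sum>y\<in>X. of_bool (y \<in> V) * (s x y * u i y))"
      unfolding f_def by (simp add: mult_ac)
    then show ?thesis using sum_restrict_of_bool[OF finX VX] by simp
  qed
  have "(\<Sum>x\<in>X. (f x)\<^sup>2) = (\<Sum>x\<in>X. of_bool (x \<in> V) * (u i x * u i x))"
    by (intro sum.cong refl) (auto simp: f_def power2_eq_square)
  also have "\<dots> = 1" unfolding sum_restrict_of_bool[OF finX VX] using eigenbasisD(2)[OF eb i i] by simp
  finally have f1: "(\<Sum>x\<in>X. (f x)\<^sup>2) = 1" .
  have "(l i)\<^sup>2 = (\<Sum>x\<in>V. (l i * u i x)\<^sup>2)"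
  proof -
    have "(\<Sum>x\<in>V. (l i * u i x)\<^sup>2) = (l i)\<^sup>2 * (\<Sum>x\<in>V. u i x * u i x)"
      by (simp add: power2_eq_square sum_distrib_left mult_ac)
    then show ?thesis using eigenbasisD(2)[OF eb i i] by simp
  qed
  also have "\<dots> = (\<Sum>x\<in>V. v\<^sup>2 * (\<Sum>y\<in>V. s x y * u i y)\<^sup>2)"
  proof (intro sum.cong refl)
    fix x assume x: "x \<in> V"
    have "l i * u i x = v * (\<Sum>y\<in>V. s x y * u i y)"
      using eigenbasisD(1)[OF eb i x] by (simp add: sum_distrib_left mult_ac)
    then show "(l i * u i x)\<^sup>2 = v\<^sup>2 * (\<Sum>y\<in>V. s x y * u i y)\<^sup>2" by (simp add: power_mult_distrib)
  qed
  also have "\<dots> \<le> (\<Sum>x\<in>X. v\<^sup>2 * (\<Sum>y\<in>V. s x y * u i y)\<^sup>2)"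
    using VX finX by (intro sum_mono2) auto
  also have "\<dots> = v\<^sup>2 * (\<Sum>x\<in>X. (\<Sum>y\<in>X. s x y * f y)\<^sup>2)" by (simp add: sf sum_distrib_left)
  also have "\<dots> = v\<^sup>2" unfolding norm_involution f1 by simp
  finally show ?thesis using v by (simp add: abs_le_square_iff[symmetric])
qed

end

section \<open>Traces of weighted kernels\<close>

text \<open>An operator on functions in place of a kernel: norm bounds then iterate along
  \<open>^^\<close>, and a finite rank difference is expressed by its action on an arbitrary
  function.\<close>

definition weighted_op :: "'a set \<Rightarrow> ('a \<Rightarrow> 'a \<Rightarrow> real) \<Rightarrow> ('a \<Rightarrow> real) \<Rightarrow> ('a \<Rightarrow> real) \<Rightarrow> 'a \<Rightarrow> real" where
  "weighted_op X s r f = (\<lambda>x. \<Sum>z\<in>X. s x z * r z * f z)"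

definition op_trace :: "'a set \<Rightarrow> (('a \<Rightarrow> real) \<Rightarrow> 'a \<Rightarrow> real) \<Rightarrow> real" where
  "op_trace X A = (\<Sum>x\<in>X. A (\<lambda>y. of_bool (y = x)) x)"

lemma weighted_op_pow_delta:
  assumes "finite X" "y \<in> X"
  shows "(weighted_op X s r ^^ Suc k) (\<lambda>z. of_bool (z = y)) x = walk X s r k x y * r y"
proof (induction k arbitrary: x)
  case 0
  show ?case using sum_mult_delta(1)[OF assms, of "\<lambda>z. s x z * r z"] by (simp add: weighted_op_def)
next
  case (Suc k)
  have "(weighted_op X s r ^^ Suc (Suc k)) (\<lambda>z. of_bool (z = y)) x
     = (\<Sum>z\<in>X. s x z * r z * ((weighted_op X s r ^^ Suc k) (\<lambda>z. of_bool (z = y)) z))"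
    by (subst funpow.simps(2)) (simp add: weighted_op_def)
  also have "\<dots> = (\<Sum>z\<in>X. s x z * r z * (walk X s r k z y * r y))" by (simp only: Suc)
  finally show ?case by (simp add: sum_distrib_right mult.assoc)
qed

lemma op_trace_weighted_op_pow:
  assumes "finite X"
  shows "op_trace X (weighted_op X s r ^^ Suc k) = (\<Sum>x\<in>X. r x * walk X s r k x x)"
  unfolding op_trace_def using assms
  by (intro sum.cong refl) (simp only: weighted_op_pow_delta mult.commute)

lemma weighted_op_pow_sum:
  "(weighted_op X s r ^^ n) (\<lambda>x. \<Sum>j\<in>J. c j * g j x) = (\<lambda>x. \<Sum>j\<in>J. c j * (weighted_op X s r ^^ n) (g j) x)"
proof (induction n)
  case (Suc n)
  have "weighted_op X s r (\<lambda>x. \<Sum>j\<in>J. c j * h j x) = (\<lambda>x. \<Sum>j\<in>J. c j * weighted_op X s r (h j) x)" for h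
    unfolding weighted_op_def sum_distrib_left by (subst sum.swap) (simp add: mult_ac)
  then show ?case by (simp add: Suc)
qed simp

lemma weighted_op_pow_add:
  "(weighted_op X s r ^^ n) (\<lambda>x. f x + g x) = (\<lambda>x. (weighted_op X s r ^^ n) f x + (weighted_op X s r ^^ n) g x)"
proof (induction n)
  case (Suc n)
  have "weighted_op X s r (\<lambda>x. f x + g x) = (\<lambda>x. weighted_op X s r f x + weighted_op X s r g x)" for f g
    unfolding weighted_op_def by (simp add: algebra_simps sum.distrib)
  then show ?case by (simp add: Suc)
qed simp

lemma weighted_op_pow_expand:
  assumes fin: "finite X" and x: "x \<in> X"
  shows "(weighted_op X s r ^^ n) f x = (\<Sum>y\<in>X. f y * (weighted_op X s r ^^ n) (\<lambda>z. of_bool (z = y)) x)"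
  using x
proof (induction n arbitrary: x)
  case 0
  then show ?case using sum_mult_delta(2)[OF fin, of x f] by simp
next
  case (Suc n)
  have e: "(weighted_op X s r ^^ Suc n) h x = (\<Sum>z\<in>X. s x z * r z * (weighted_op X s r ^^ n) h z)" for h
    by (simp add: weighted_op_def[of X s r "(weighted_op X s r ^^ n) h"])
  have "(weighted_op X s r ^^ Suc n) f x = (\<Sum>z\<in>X. s x z * r z * (\<Sum>y\<in>X. f y * (weighted_op X s r ^^ n) (\<lambda>z. of_bool (z = y)) z))"
    unfolding e by (intro sum.cong refl) (simp add: Suc.IH)
  also have "\<dots> = (\<Sum>y\<in>X. f y * (\<Sum>z\<in>X. s x z * r z * (weighted_op X s r ^^ n) (\<lambda>z. of_bool (z = y)) z))"
    unfolding sum_distrib_left by (subst sum.swap) (simp add: mult_ac)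
  finally show ?case unfolding e .
qed

section \<open>Traces under perturbations of finite rank\<close>

lemma L2_set_mult_bound:
  assumes "\<And>x. x \<in> X \<Longrightarrow> \<bar>g x\<bar> \<le> C" "C \<ge> 0"
  shows "L2_set (\<lambda>x. g x * f x) X \<le> C * L2_set f X"
proof -
  have "L2_set (\<lambda>x. g x * f x) X = L2_set (\<lambda>x. \<bar>g x * f x\<bar>) X" by (simp add: L2_set_def)
  also have "\<dots> \<le> L2_set (\<lambda>x. C * \<bar>f x\<bar>) X"
    by (intro L2_set_mono) (auto simp: abs_mult intro!: mult_right_mono assms)
  also have "\<dots> = C * L2_set (\<lambda>x. \<bar>f x\<bar>) X" by (rule L2_set_right_distrib[symmetric]) fact
  also have "L2_set (\<lambda>x. \<bar>f x\<bar>) X = L2_set f X" by (simp add: L2_set_def)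
  finally show ?thesis .
qed

lemma L2_set_pow_bound:
  assumes C: "\<And>f. L2_set (A f) X \<le> C * L2_set f X" "C \<ge> 0"
  shows "L2_set ((A ^^ n) f) X \<le> C ^ n * L2_set f X"
proof (induction n)
  case (Suc n)
  have "L2_set ((A ^^ Suc n) f) X \<le> C * L2_set ((A ^^ n) f) X" using C(1) by simp
  also have "\<dots> \<le> C * (C ^ n * L2_set f X)" by (intro mult_left_mono Suc C)
  finally show ?case by (simp add: mult.assoc)
qed simp

text \<open>Telescoping over the mixed words \<open>A ^ m B ^ (n + 1 - m)\<close>: consecutive
  traces differ by \<open>card J\<close> traces of rank one operators, and each is a single inner
  product bounded through norms. Thus the error does not grow with \<open>X\<close>.\<close>

lemma finite_rank_trace_perturbation:
  fixes X :: "'a set" and s1 s0 :: "'a \<Rightarrow> 'a \<Rightarrow> real" and r1 r0 :: "'a \<Rightarrow> real" and a b :: "'j \<Rightarrow> 'a \<Rightarrow> real"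
  defines "A \<equiv> weighted_op X s1 r1" and "B \<equiv> weighted_op X s0 r0"
  assumes fin: "finite X"
    and AB: "\<And>f. A f = (\<lambda>x. B f x + (\<Sum>j\<in>J. (\<Sum>z\<in>X. b j z * f z) * a j x))"
    and CA: "\<And>f. L2_set (A f) X \<le> C * L2_set f X" and CB: "\<And>f. L2_set (B f) X \<le> C * L2_set f X"
    and C: "C \<ge> 0" and ab: "\<And>j. j \<in> J \<Longrightarrow> L2_set (b j) X * L2_set (a j) X \<le> M"
  shows "\<bar>op_trace X (A ^^ Suc n) - op_trace X (B ^^ Suc n)\<bar> \<le> real (Suc n) * (real (card J) * (C ^ n * M))"
proof -
  define T where "T m = op_trace X (\<lambda>f. (A ^^ m) ((B ^^ (Suc n - m)) f))" for m
  have step: "\<bar>T (Suc m) - T m\<bar> \<le> real (card J) * (C ^ n * M)" if m: "m < Suc n" for m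
  proof -
    define l where "l = n - m"
    have l: "Suc n - m = Suc l" "Suc n - Suc m = l" "l + m = n" using m by (auto simp: l_def)
    have TS: "T (Suc m) = T m + (\<Sum>x\<in>X. \<Sum>j\<in>J. (\<Sum>z\<in>X. b j z * (B ^^ l) (\<lambda>y. of_bool (y = x)) z) * (A ^^ m) (a j) x)"
    proof -
      have "(A ^^ Suc m) f = (A ^^ m) (A f)" for f by (simp add: funpow_swap1)
      moreover have "(A ^^ m) (A ((B ^^ l) f)) x = (A ^^ m) ((B ^^ Suc l) f) x + (\<Sum>j\<in>J. (\<Sum>z\<in>X. b j z * (B ^^ l) f z) * (A ^^ m) (a j) x)" for f x
        unfolding AB[of "(B ^^ l) f"] unfolding A_def
        by (subst weighted_op_pow_add, subst weighted_op_pow_sum) simp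
      ultimately show ?thesis unfolding T_def l op_trace_def by (simp add: sum.distrib)
    qed
    \<comment> \<open>The sum over \<open>x\<close> reassembles \<open>(A ^^ m) (a j)\<close> from
      basis vectors, so each rank one trace collapses to the pairing of \<open>b j\<close> with a
      vector of controlled norm.\<close>
    have "(\<Sum>x\<in>X. \<Sum>j\<in>J. (\<Sum>z\<in>X. b j z * (B ^^ l) (\<lambda>y. of_bool (y = x)) z) * (A ^^ m) (a j) x)
       = (\<Sum>j\<in>J. \<Sum>x\<in>X. \<Sum>z\<in>X. b j z * ((A ^^ m) (a j) x * (B ^^ l) (\<lambda>y. of_bool (y = x)) z))"
      by (subst sum.swap) (simp add: sum_distrib_left sum_distrib_right mult_ac)
    also have "\<dots> = (\<Sum>j\<in>J. \<Sum>z\<in>X. b j z * (\<Sum>x\<in>X. (A ^^ m) (a j) x * (B ^^ l) (\<lambda>y. of_bool (y = x)) z))"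
      by (rule sum.cong[OF refl], subst sum.swap) (simp add: sum_distrib_left)
    also have "\<dots> = (\<Sum>j\<in>J. \<Sum>z\<in>X. b j z * (B ^^ l) ((A ^^ m) (a j)) z)"
      unfolding B_def by (intro sum.cong refl) (simp add: weighted_op_pow_expand[OF fin, symmetric])
    finally have diff: "T (Suc m) - T m = (\<Sum>j\<in>J. \<Sum>z\<in>X. b j z * (B ^^ l) ((A ^^ m) (a j)) z)"
      using TS by simp
    have "\<bar>\<Sum>z\<in>X. b j z * (B ^^ l) ((A ^^ m) (a j)) z\<bar> \<le> C ^ n * M" if j: "j \<in> J" for j
    proof -
      have "\<bar>\<Sum>z\<in>X. b j z * (B ^^ l) ((A ^^ m) (a j)) z\<bar> \<le> (\<Sum>z\<in>X. \<bar>b j z\<bar> * \<bar>(B ^^ l) ((A ^^ m) (a j)) z\<bar>)"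
        unfolding abs_mult[symmetric] by (rule sum_abs)
      also have "\<dots> \<le> L2_set (b j) X * L2_set ((B ^^ l) ((A ^^ m) (a j))) X" by (rule L2_set_mult_ineq)
      also have "\<dots> \<le> L2_set (b j) X * (C ^ l * L2_set ((A ^^ m) (a j)) X)"
        by (intro mult_left_mono L2_set_pow_bound CB C) simp
      also have "\<dots> \<le> L2_set (b j) X * (C ^ l * (C ^ m * L2_set (a j) X))"
        by (intro mult_left_mono L2_set_pow_bound CA C) (simp_all add: C)
      also have "\<dots> = C ^ n * (L2_set (b j) X * L2_set (a j) X)"
        using l(3) by (simp add: power_add[symmetric] mult_ac)
      also have "\<dots> \<le> C ^ n * M" by (intro mult_left_mono ab j) (simp add: C)
      finally show ?thesis .
    qed
    then have "(\<Sum>j\<in>J. \<bar>\<Sum>z\<in>X. b j z * (B ^^ l) ((A ^^ m) (a j)) z\<bar>) \<le> real (card J) * (C ^ n * M)"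
      by (rule sum_bounded_above)
    then show ?thesis unfolding diff by (rule order_trans[OF sum_abs])
  qed
  have "\<bar>T m - T 0\<bar> \<le> real m * (real (card J) * (C ^ n * M))" if "m \<le> Suc n" for m
    using that
  proof (induction m)
    case (Suc m)
    then show ?case using step[of m] by (simp add: algebra_simps)
  qed simp
  from this[of "Suc n"] show ?thesis unfolding T_def by (simp add: comp_def)
qed

section \<open>Closed walks as traces\<close>

text \<open>The closing factor \<open>H\<close> is arbitrary because the induction sums out the last
  vertex and absorbs it into \<open>H\<close>. The transposed kernel on the right reflects the order
  \<open>S (x (i + 1)) (x i)\<close> of the arguments in a necklace.\<close>

lemma sum_closed_walks:
  fixes S :: "'a \<Rightarrow> 'a \<Rightarrow> real"
  shows "(\<Sum>x \<in> {1..Suc k} \<rightarrow>\<^sub>E X. (\<Prod>i\<in>{1..<Suc k}. S (x (i + 1)) (x i)) * (\<Prod>i\<in>{1..Suc k}. r (x i)) * H (x 1) (x (Suc k)))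
    = (\<Sum>y\<in>X. r y * ((weighted_op X (\<lambda>x y. S y x) r ^^ k) (H y)) y)"
proof (induction k arbitrary: H)
  case 0
  have "bij_betw (\<lambda>x. x 1) ({1..Suc 0} \<rightarrow>\<^sub>E X) X"
  proof (rule bij_betwI[where g = "\<lambda>y i. if i = 1 then y else undefined"])
    fix x assume "x \<in> {1..Suc 0} \<rightarrow>\<^sub>E X"
    then show "(\<lambda>i. if i = 1 then x 1 else undefined) = x"
      by (auto simp: PiE_def extensional_def fun_eq_iff)
  qed (auto simp: PiE_def extensional_def)
  from sum.reindex_bij_betw[OF this, of "\<lambda>y. r y * H y y"] show ?case by simp
next
  case (Suc k)
  let ?F = "\<lambda>x. (\<Prod>i\<in>{1..<Suc k}. S (x (i + 1)) (x i)) * (\<Prod>i\<in>{1..Suc k}. r (x i))"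
  have ins: "{1..Suc (Suc k)} = insert (Suc (Suc k)) {1..Suc k}" by auto
  have gen: "(\<Sum>x \<in> {1..Suc (Suc k)} \<rightarrow>\<^sub>E X. G x) = (\<Sum>(y, x) \<in> X \<times> ({1..Suc k} \<rightarrow>\<^sub>E X). G (x(Suc (Suc k) := y)))"
    for G :: "(nat \<Rightarrow> 'a) \<Rightarrow> real"
  proof -
    have "inj_on (\<lambda>(y, g). g(Suc (Suc k) := y)) (X \<times> ({1..Suc k} \<rightarrow>\<^sub>E X))"
      by (rule inj_combinator) simp
    then show ?thesis unfolding ins PiE_insert_eq
      by (subst sum.reindex) (simp_all add: case_prod_unfold comp_def)
  qed
  have ins': "{1..<Suc (Suc k)} = insert (Suc k) {1..<Suc k}" by auto
  have "(\<Sum>x \<in> {1..Suc (Suc k)} \<rightarrow>\<^sub>E X. (\<Prod>i\<in>{1..<Suc (Suc k)}. S (x (i + 1)) (x i)) * (\<Prod>i\<in>{1..Suc (Suc k)}. r (x i)) * H (x 1) (x (Suc (Suc k))))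
     = (\<Sum>(y, x) \<in> X \<times> ({1..Suc k} \<rightarrow>\<^sub>E X). (\<lambda>x. (\<Prod>i\<in>{1..<Suc (Suc k)}. S (x (i + 1)) (x i)) * (\<Prod>i\<in>{1..Suc (Suc k)}. r (x i)) * H (x 1) (x (Suc (Suc k)))) (x(Suc (Suc k) := y)))"
    by (rule gen)
  also have "\<dots> = (\<Sum>(y, x) \<in> X \<times> ({1..Suc k} \<rightarrow>\<^sub>E X). ?F x * (S y (x (Suc k)) * r y * H (x 1) y))"
  proof (intro sum.cong refl, clarify)
    fix y x
    have 1: "(\<Prod>i\<in>{1..<Suc (Suc k)}. S ((x(Suc (Suc k) := y)) (i + 1)) ((x(Suc (Suc k) := y)) i)) = S y (x (Suc k)) * (\<Prod>i\<in>{1..<Suc k}. S (x (i + 1)) (x i))"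
      unfolding ins' by (subst prod.insert) (auto intro!: prod.cong)
    have 2: "(\<Prod>i\<in>{1..Suc (Suc k)}. r ((x(Suc (Suc k) := y)) i)) = r y * (\<Prod>i\<in>{1..Suc k}. r (x i))"
      unfolding ins by (subst prod.insert) (auto intro!: prod.cong)
    show "(\<Prod>i\<in>{1..<Suc (Suc k)}. S ((x(Suc (Suc k) := y)) (i + 1)) ((x(Suc (Suc k) := y)) i)) * (\<Prod>i\<in>{1..Suc (Suc k)}. r ((x(Suc (Suc k) := y)) i)) *
        H ((x(Suc (Suc k) := y)) 1) ((x(Suc (Suc k) := y)) (Suc (Suc k))) = ?F x * (S y (x (Suc k)) * r y * H (x 1) y)"
      unfolding 1 2 by simp
  qed
  also have "\<dots> = (\<Sum>x \<in> {1..Suc k} \<rightarrow>\<^sub>E X. ?F x * weighted_op X (\<lambda>x y. S y x) r (H (x 1)) (x (Suc k)))"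
    unfolding sum.cartesian_product[symmetric]
    by (subst sum.swap) (simp add: weighted_op_def sum_distrib_left)
  also have "\<dots> = (\<Sum>y\<in>X. r y * ((weighted_op X (\<lambda>x y. S y x) r ^^ k) (weighted_op X (\<lambda>x y. S y x) r (H y))) y)"
    by (rule Suc)
  finally show ?case by (simp add: funpow_swap1)
qed

lemma weighted_op_pow_kernel: "(weighted_op X s r ^^ k) (\<lambda>x. s x y) x = walk X s r k x y"
proof (induction k arbitrary: x)
  case (Suc k)
  have "(weighted_op X s r ^^ Suc k) (\<lambda>x. s x y) x = (\<Sum>z\<in>X. s x z * r z * (weighted_op X s r ^^ k) (\<lambda>x. s x y) z)"
    by (simp add: weighted_op_def[of X s r "(weighted_op X s r ^^ k) (\<lambda>x. s x y)"])
  then show ?case by (simp add: Suc)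
qed simp

lemma walk_scale: "walk X (\<lambda>x y. c * s x y) r k x y = c ^ Suc k * walk X s r k x y"
  by (induction k arbitrary: x) (simp_all add: sum_distrib_left mult_ac)

section \<open>Localizations of Paley graphs\<close>

lemma paley_arcs_ends_iff:
  "(x, y) \<in> arcs_ends (paley_graph p) \<longleftrightarrow>
    x \<in> residue_field p \<and> y \<in> residue_field p \<and> Legendre (x - y) (int p) = 1"
  by (force simp: arcs_ends_conv paley_graph_def Legendre_def)

text \<open>A bound for the trace of \<open>s r ... s r\<close> with \<open>k + 1\<close> pairs. The
  first summand counts at most \<open>(2 ^ a) ^ (k + 1)\<close> tuples of subsets; the second is the
  perturbation error for \<open>a + 1\<close> rank one terms and operators of norm at most
  \<open>2 * 2 ^ a\<close>.\<close>

definition closed_walk_bound :: "nat \<Rightarrow> (nat \<Rightarrow> real) \<Rightarrow> nat \<Rightarrow> nat \<Rightarrow> real" where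
  "closed_walk_bound a M p k = (2 ^ a) ^ Suc k * ((1 / sqrt p) ^ Suc k * M (Suc k))
     + real (Suc k) * (real (a + 1) * ((2 * 2 ^ a) ^ k * 2 ^ a))"

text \<open>It bounds the trace of \<open>W k\<close> along the cyclic reduction: the base values
  bound the trace of \<open>s\<close> and the sum of \<open>r\<close>, and the step replaces
  \<open>v - 2\<close> and \<open>v - 1\<close> by \<open>v = 2 ^ a\<close>.\<close>

fun diagonal_bound :: "nat \<Rightarrow> (nat \<Rightarrow> real) \<Rightarrow> nat \<Rightarrow> nat \<Rightarrow> real" where
  "diagonal_bound a M p 0 = 1"
| "diagonal_bound a M p (Suc 0) = 2 ^ a * sqrt (M 2 + p) + 2 ^ a / 2 * a"
| "diagonal_bound a M p (Suc (Suc k)) = 2 ^ a * closed_walk_bound a M p k + 2 ^ a * diagonal_bound a M p k"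

locale paley_independent_set =
  fixes p a :: nat and I :: "int set"
  assumes p: "prime p" "[p = 1] (mod 4)" and a: "a \<ge> 1" and I: "I \<in> independent_sets a (paley_graph p)"
begin

definition X where "X = residue_field p"

definition chi :: "int \<Rightarrow> real" where "chi x = real_of_int (Legendre x (int p))"

definition v :: real where "v = 2 ^ a"

definition V where "V = verts (paley_localization p I)"

definition s0 :: "int \<Rightarrow> int \<Rightarrow> real" where "s0 x y = chi (x - y) / sqrt p"

text \<open>The square of \<open>s0\<close> is the identity minus the projection onto the constants, which \<open>s0\<close> annihilates.
  Adding this projection turns \<open>s0\<close> into an involution.\<close>

definition s :: "int \<Rightarrow> int \<Rightarrow> real" where "s x y = s0 x y + 1 / p"

definition psi :: "int set \<Rightarrow> int \<Rightarrow> real" where "psi Z x = (\<Prod>z\<in>Z. chi (x - z))"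

text \<open>A version of \<open>r\<close> that is a signed sum of characters on all of
  \<open>X\<close>; the two differ only on \<open>I\<close>.\<close>

definition r0 :: "int \<Rightarrow> real" where
  "r0 x = (\<Sum>Z\<in>Pow I - {{}}. (- 1) ^ card Z * psi Z x)"

lemma p2: "2 < p"
proof -
  have "p mod 4 = 1" using p(2) by (simp add: cong_def)
  moreover have "p \<noteq> 1" using p(1) by auto
  ultimately show ?thesis by presburger
qed

lemma p0 [simp]: "0 < p" "p \<noteq> 0" using p2 by auto

lemma finX [simp]: "finite X" by (simp add: X_def residue_field_def)

lemma cardX [simp]: "card X = p" by (simp add: X_def residue_field_def)

lemma IX: "I \<subseteq> X" and finI [simp]: "finite I" and cardI [simp]: "card I = a"
  using I by (auto simp: independent_sets_def X_def paley_graph_def)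

lemma v1: "v \<ge> 1" by (simp add: v_def)

lemma dvd_diff_X: "x \<in> X \<Longrightarrow> y \<in> X \<Longrightarrow> int p dvd x - y \<longleftrightarrow> x = y"
  using cong_iff_dvd_diff[of x y "int p"] by (auto simp: X_def residue_field_def cong_def)

lemma chi_minus: "chi (x - y) = chi (y - x)"
  using Legendre_minus[OF p, of "x - y"] by (simp add: chi_def)

lemma chi_square: "x \<in> X \<Longrightarrow> y \<in> X \<Longrightarrow> chi (x - y) * chi (x - y) = of_bool (x \<noteq> y)"
  using Legendre_square[of "x - y" "int p"] dvd_diff_X[of x y]
  unfolding chi_def of_int_mult[symmetric] by auto

lemma chi_cases: "x \<in> X \<Longrightarrow> y \<in> X \<Longrightarrow> x \<noteq> y \<Longrightarrow> chi (x - y) = 1 \<or> chi (x - y) = - 1"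
  using Legendre_cases[of "x - y" "int p"] chi_square[of x y] by (auto simp: chi_def)

lemma chi_0 [simp]: "chi 0 = 0"
  by (simp add: chi_def Legendre_def)

lemma abs_chi_le: "\<bar>chi x\<bar> \<le> 1"
  using Legendre_cases[of x "int p"] by (auto simp: chi_def)

lemma sum_chi: "(\<Sum>z\<in>X. chi (x - z)) = 0"
proof -
  have "(\<Sum>z\<in>residue_field p. Legendre ((- 1) * z + x) (int p)) = (\<Sum>z\<in>residue_field p. Legendre z (int p))"
    by (intro sum_residue_field_affine) auto
  then have "(\<Sum>z\<in>X. Legendre (x - z) (int p)) = 0"
    using sum_Legendre[OF p(1) p2] by (simp add: X_def)
  then show ?thesis unfolding chi_def of_int_sum[symmetric] by simp
qed

lemma sum_chi_chi: "x \<in> X \<Longrightarrow> y \<in> X \<Longrightarrow> (\<Sum>z\<in>X. chi (x - z) * chi (z - y)) = real p * of_bool (x = y) - 1"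
proof -
  assume xy: "x \<in> X" "y \<in> X"
  have "(\<Sum>z\<in>X. chi (x - z) * chi (z - y)) = (\<Sum>z\<in>X. chi (x - z) * chi (y - z))"
    using chi_minus[of y] by simp
  also have "\<dots> = real_of_int (\<Sum>z\<in>X. Legendre (x - z) (int p) * Legendre (y - z) (int p))"
    by (simp add: chi_def)
  also have "\<dots> = real p * of_bool (x = y) - 1"
    unfolding X_def sum_Legendre_correlation[OF p(1) p2] using dvd_diff_X[OF xy] by simp
  finally show ?thesis .
qed

lemma chi_I: "x \<in> I \<Longrightarrow> y \<in> I \<Longrightarrow> x \<noteq> y \<Longrightarrow> chi (x - y) = - 1"
proof -
  assume xy: "x \<in> I" "y \<in> I" "x \<noteq> y"
  then have "(x, y) \<notin> arcs_ends (paley_graph p)" using I by (auto simp: independent_sets_def)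
  then have "chi (x - y) \<noteq> 1"
    using xy IX unfolding paley_arcs_ends_iff by (auto simp: chi_def X_def)
  then show ?thesis using chi_cases[of x y] xy IX by auto
qed

text \<open>A vertex of \<open>I\<close> is excluded through its own factor, because
  \<open>chi 0 = 0\<close>; away from \<open>I\<close>, non-adjacency means the value
  \<open>- 1\<close>.\<close>

lemma V_iff: "x \<in> V \<longleftrightarrow> x \<in> X \<and> (\<forall>z\<in>I. chi (x - z) = - 1)"
proof -
  have "x \<in> V \<longleftrightarrow> x \<in> X \<and> x \<notin> I \<and> (\<forall>z\<in>I. chi (x - z) \<noteq> 1)"
    using IX unfolding V_def paley_localization_def paley_arcs_ends_iff
    by (auto simp: X_def paley_graph_def chi_def)
  also have "\<dots> \<longleftrightarrow> x \<in> X \<and> (\<forall>z\<in>I. chi (x - z) = - 1)"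
    using IX chi_cases[of x] by fastforce
  finally show ?thesis .
qed

lemma VX: "V \<subseteq> X" using V_iff by blast

lemma finite_V [simp]: "finite V" by (rule finite_subset[OF VX finX])

text \<open>On \<open>V\<close> every factor is 2. At a point of \<open>I\<close> its own factor is
  1 and, by independence, the other \<open>a - 1\<close> factors are 2, which gives
  \<open>v / 2\<close>. At any other vertex some neighbour in \<open>I\<close> contributes the
  factor 0.\<close>

lemma prod_one_minus_chi:
  assumes x: "x \<in> X"
  shows "(\<Prod>z\<in>I. 1 - chi (x - z)) = v * of_bool (x \<in> V) + v / 2 * of_bool (x \<in> I)"
proof -
  consider "x \<in> V" | "x \<in> I" | z where "x \<notin> V" "x \<notin> I" "z \<in> I" "chi (x - z) \<noteq> - 1"
    using V_iff[of x] x by blast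
  then show ?thesis
  proof cases
    case 1
    then have "x \<notin> I" using V_iff[of x] by force
    moreover have "(\<Prod>z\<in>I. 1 - chi (x - z)) = (\<Prod>z\<in>I. 2)" using 1 V_iff[of x] by (intro prod.cong) auto
    ultimately show ?thesis using 1 by (simp add: v_def)
  next
    case 2
    then have "x \<notin> V" using V_iff[of x] by force
    have "(\<Prod>z\<in>I. 1 - chi (x - z)) = (1 - chi (x - x)) * (\<Prod>z\<in>I - {x}. 1 - chi (x - z))"
      using 2 by (intro prod.remove) auto
    also have "(\<Prod>z\<in>I - {x}. 1 - chi (x - z)) = (\<Prod>z\<in>I - {x}. 2)"
      using 2 chi_I[of x] by (intro prod.cong) auto
    also have "\<dots> = 2 ^ (a - 1)" using 2 by simp
    also have "a > 0" using 2 cardI finI by (metis card_gt_0_iff empty_iff)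
    then have "(2 :: real) ^ (a - 1) = v / 2" by (simp add: v_def power_diff)
    finally show ?thesis using 2 \<open>x \<notin> V\<close> by simp
  next
    case (3 z)
    then have "x \<noteq> z" "z \<in> X" using IX by auto
    then have "chi (x - z) = 1" using chi_cases[of x z] 3 x by auto
    then have "(\<Prod>z\<in>I. 1 - chi (x - z)) = 0" using 3 by (auto simp: prod_zero_iff)
    then show ?thesis using 3 by simp
  qed
qed

text \<open>Expanding the product over \<open>I\<close> gives a sum over all subsets, in which the
  empty one contributes the 1 that is subtracted here.\<close>

lemma r0_eq:
  assumes x: "x \<in> X"
  shows "r0 x = v * of_bool (x \<in> V) - 1 + v / 2 * of_bool (x \<in> I)"
proof -
  have "(\<Prod>z\<in>I. 1 - chi (x - z)) = (\<Prod>z\<in>I. - chi (x - z) + 1)" by simp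
  also have "\<dots> = (\<Sum>Z\<in>Pow I. (- 1) ^ card Z * psi Z x)"
    unfolding psi_def by (subst prod_add) (simp_all add: prod_uminus)
  also have "\<dots> = 1 + r0 x"
    unfolding r0_def by (subst sum.remove[of _ "{}"]) (simp_all add: psi_def)
  finally show ?thesis using prod_one_minus_chi[OF x] by simp
qed

lemma s_sym: "s x y = s y x" and s0_sym: "s0 x y = s0 y x"
  using chi_minus[of x y] by (simp_all add: s_def s0_def)

lemma s0_s0: "x \<in> X \<Longrightarrow> y \<in> X \<Longrightarrow> (\<Sum>z\<in>X. s0 x z * s0 z y) = of_bool (x = y) - 1 / p"
proof -
  assume xy: "x \<in> X" "y \<in> X"
  have "(\<Sum>z\<in>X. s0 x z * s0 z y) = (\<Sum>z\<in>X. chi (x - z) * chi (z - y)) / p"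
    unfolding sum_divide_distrib by (intro sum.cong refl) (simp add: s0_def)
  then show ?thesis using sum_chi_chi[OF xy] by (simp add: field_simps)
qed

lemma s_inv: "x \<in> X \<Longrightarrow> y \<in> X \<Longrightarrow> (\<Sum>z\<in>X. s x z * s z y) = of_bool (x = y)"
proof -
  assume xy: "x \<in> X" "y \<in> X"
  have rows: "(\<Sum>z\<in>X. s0 x z) = 0" for x
    unfolding s0_def sum_divide_distrib[symmetric] sum_chi by simp
  have "(\<Sum>z\<in>X. s x z * s z y) = (\<Sum>z\<in>X. s0 x z * s0 z y + 1 / p * s0 x z + 1 / p * s0 y z + 1 / (p * p))"
    by (intro sum.cong refl) (simp add: s_def s0_sym[of y] algebra_simps)
  also have "\<dots> = of_bool (x = y) - 1 / p + p * (1 / (p * p))"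
    unfolding sum.distrib sum_distrib_left[symmetric] rows s0_s0[OF xy] by simp
  finally show ?thesis by simp
qed

sublocale involution_compression X V s v
  by standard (use VX s_sym s_inv in auto)

lemma r_eq: "x \<in> X \<Longrightarrow> r x = r0 x - v / 2 * of_bool (x \<in> I)"
  using r0_eq by (simp add: r_def)

section \<open>From the involution to the character matrix\<close>

lemma abs_r_le: "\<bar>r x\<bar> \<le> v"
  using v1 by (simp add: r_def)

lemma abs_r0_le: "x \<in> X \<Longrightarrow> \<bar>r0 x\<bar> \<le> 2 * v"
  using v1 by (auto simp: r0_eq abs_le_iff)

text \<open>\<open>s\<close> preserves norms and \<open>r\<close> is bounded by \<open>v\<close>.
  The constant is relaxed to \<open>2 * v\<close> to agree with the one for \<open>s0\<close> and
  \<open>r0\<close>.\<close>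

lemma L2_weighted_op_s: "L2_set (weighted_op X s r f) X \<le> (2 * v) * L2_set f X"
proof -
  have "weighted_op X s r f = (\<lambda>x. \<Sum>y\<in>X. s x y * (r y * f y))"
    by (simp add: weighted_op_def mult.assoc)
  then have "L2_set (weighted_op X s r f) X = L2_set (\<lambda>x. r x * f x) X"
    unfolding L2_set_def using norm_involution[of "\<lambda>y. r y * f y"] by simp
  also have "\<dots> \<le> (2 * v) * L2_set f X"
  proof (rule L2_set_mult_bound)
    show "\<bar>r x\<bar> \<le> 2 * v" for x using abs_r_le[of x] v1 by linarith
  qed (use v1 in simp)
  finally show ?thesis .
qed

text \<open>As \<open>s0\<close> squares to the identity minus a projection, the additional term has
  a favourable sign and \<open>s0\<close> is a contraction; the factor \<open>2 * v\<close> bounds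
  \<open>r0\<close>.\<close>

lemma L2_weighted_op_s0: "L2_set (weighted_op X s0 r0 f) X \<le> (2 * v) * L2_set f X"
proof -
  define g where "g y = r0 y * f y" for y
  have w: "weighted_op X s0 r0 f = (\<lambda>x. \<Sum>y\<in>X. s0 x y * g y)"
    by (simp add: weighted_op_def g_def mult.assoc)
  have "(\<Sum>x\<in>X. (\<Sum>y\<in>X. s0 x y * g y)\<^sup>2) = (\<Sum>x\<in>X. \<Sum>y\<in>X. \<Sum>z\<in>X. (g y * g z) * (s0 y x * s0 x z))"
    unfolding power2_eq_square sum_product by (intro sum.cong refl) (simp add: s0_sym mult_ac)
  also have "\<dots> = (\<Sum>y\<in>X. \<Sum>z\<in>X. (g y * g z) * (\<Sum>x\<in>X. s0 y x * s0 x z))"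
    by (subst sum.swap, rule sum.cong[OF refl], subst sum.swap) (simp add: sum_distrib_left)
  also have "\<dots> = (\<Sum>y\<in>X. \<Sum>z\<in>X. (g y * g z) * of_bool (y = z) - 1 / p * (g y * g z))"
    by (intro sum.cong refl) (simp add: s0_s0 right_diff_distrib)
  also have "\<dots> = (\<Sum>y\<in>X. \<Sum>z\<in>X. (g y * g z) * of_bool (y = z)) - 1 / p * ((\<Sum>y\<in>X. g y) * (\<Sum>z\<in>X. g z))"
    by (simp only: sum_subtractf sum_product) (simp only: sum_distrib_left)
  also have "(\<Sum>y\<in>X. \<Sum>z\<in>X. (g y * g z) * of_bool (y = z)) = (\<Sum>y\<in>X. g y * g y)"
    by (intro sum.cong refl sum_mult_delta[OF finX])
  also have "(\<Sum>y\<in>X. g y * g y) - 1 / p * ((\<Sum>y\<in>X. g y) * (\<Sum>z\<in>X. g z)) \<le> (\<Sum>y\<in>X. (g y)\<^sup>2)"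
    by (simp add: power2_eq_square)
  finally have "L2_set (weighted_op X s0 r0 f) X \<le> L2_set g X"
    unfolding L2_set_def w by (rule real_sqrt_le_mono)
  also have "\<dots> \<le> (2 * v) * L2_set f X"
    unfolding g_def using abs_r0_le v1 by (intro L2_set_mult_bound) auto
  finally show ?thesis .
qed

text \<open>The label \<open>None\<close> accounts for the constant \<open>1 / p\<close> in
  \<open>s\<close>, the label \<open>Some i\<close> for the correction of \<open>r0\<close> at the
  point \<open>i\<close> of \<open>I\<close>. Splitting \<open>1 / p\<close> evenly into two factors
  \<open>1 / sqrt p\<close> keeps both vectors of that term bounded in norm.\<close>

lemma weighted_op_difference:
  "weighted_op X s r f = (\<lambda>x. weighted_op X s0 r0 f x +
     (\<Sum>j\<in>insert None (Some ` I). (\<Sum>z\<in>X. (case j of None \<Rightarrow> r z / sqrt p | Some i \<Rightarrow> - (v / 2) * of_bool (z = i)) * f z)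
        * (case j of None \<Rightarrow> 1 / sqrt p | Some i \<Rightarrow> s0 x i)))"
proof
  fix x
  have "(\<Sum>j\<in>insert None (Some ` I). (\<Sum>z\<in>X. (case j of None \<Rightarrow> r z / sqrt p | Some i \<Rightarrow> - (v / 2) * of_bool (z = i)) * f z)
        * (case j of None \<Rightarrow> 1 / sqrt p | Some i \<Rightarrow> s0 x i))
     = (\<Sum>z\<in>X. r z / sqrt p * f z) * (1 / sqrt p) + (\<Sum>i\<in>I. (\<Sum>z\<in>X. - (v / 2) * of_bool (z = i) * f z) * s0 x i)"
    by (subst sum.insert) (auto simp: sum.reindex)
  also have "(\<Sum>z\<in>X. r z / sqrt p * f z) * (1 / sqrt p) = (\<Sum>z\<in>X. 1 / p * r z * f z)"
    unfolding sum_distrib_right by (intro sum.cong refl) (simp add: field_simps)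
  also have "(\<Sum>i\<in>I. (\<Sum>z\<in>X. - (v / 2) * of_bool (z = i) * f z) * s0 x i) = (\<Sum>i\<in>I. - (v / 2) * (s0 x i * f i))"
  proof (intro sum.cong refl)
    fix i assume "i \<in> I"
    then have i: "i \<in> X" using IX by auto
    have "(\<Sum>z\<in>X. - (v / 2) * of_bool (z = i) * f z) = (\<Sum>z\<in>X. (- (v / 2) * f z) * of_bool (z = i))"
      by (simp add: mult_ac)
    then show "(\<Sum>z\<in>X. - (v / 2) * of_bool (z = i) * f z) * s0 x i = - (v / 2) * (s0 x i * f i)"
      unfolding sum_mult_delta[OF finX i] by simp
  qed
  also have "\<dots> = (\<Sum>z\<in>X. of_bool (z \<in> I) * (- (v / 2) * (s0 x z * f z)))"
    by (rule sum_restrict_of_bool[OF finX IX, symmetric])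
  finally have *: "(\<Sum>j\<in>insert None (Some ` I). (\<Sum>z\<in>X. (case j of None \<Rightarrow> r z / sqrt p | Some i \<Rightarrow> - (v / 2) * of_bool (z = i)) * f z)
        * (case j of None \<Rightarrow> 1 / sqrt p | Some i \<Rightarrow> s0 x i))
     = (\<Sum>z\<in>X. 1 / p * r z * f z) + (\<Sum>z\<in>X. of_bool (z \<in> I) * (- (v / 2) * (s0 x z * f z)))" .
  show "weighted_op X s r f x = weighted_op X s0 r0 f x +
     (\<Sum>j\<in>insert None (Some ` I). (\<Sum>z\<in>X. (case j of None \<Rightarrow> r z / sqrt p | Some i \<Rightarrow> - (v / 2) * of_bool (z = i)) * f z)
        * (case j of None \<Rightarrow> 1 / sqrt p | Some i \<Rightarrow> s0 x i))"
    unfolding * weighted_op_def sum.distrib[symmetric]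
    by (intro sum.cong refl) (simp add: s_def r_eq algebra_simps)
qed

lemma trace_comparison:
  "\<bar>(\<Sum>x\<in>X. r x * W k x x) - (\<Sum>x\<in>X. r0 x * walk X s0 r0 k x x)\<bar>
     \<le> real (Suc k) * (real (a + 1) * ((2 * v) ^ k * v))"
proof -
  let ?J = "insert None (Some ` I)"
  let ?b = "\<lambda>j z. case j of None \<Rightarrow> r z / sqrt p | Some i \<Rightarrow> - (v / 2) * of_bool (z = i)"
  let ?a = "\<lambda>j x. case j of None \<Rightarrow> 1 / sqrt p | Some i \<Rightarrow> s0 x i"
  have ab: "L2_set (?b j) X * L2_set (?a j) X \<le> v" if j: "j \<in> ?J" for j
  proof (cases j)
    case None
    have "L2_set (?a j) X = 1" using None by (simp add: L2_set_def power_divide)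
    moreover have "L2_set (?b j) X \<le> v"
    proof -
      have "L2_set (\<lambda>z. r z * (1 / sqrt p)) X \<le> v * L2_set (\<lambda>z. 1 / sqrt p) X"
        using abs_r_le v1 by (intro L2_set_mult_bound) auto
      then show ?thesis using None by (simp add: L2_set_def power_divide)
    qed
    ultimately show ?thesis by simp
  next
    case (Some i)
    then have i: "i \<in> X" using j IX by auto
    have "L2_set (?b j) X = sqrt ((v / 2)\<^sup>2)"
    proof -
      have "(\<Sum>z\<in>X. (- (v / 2) * of_bool (z = i))\<^sup>2) = (\<Sum>z\<in>X. (v / 2)\<^sup>2 * of_bool (z = i))"
        by (intro sum.cong refl) auto
      then show ?thesis unfolding L2_set_def Some option.case sum_mult_delta[OF finX i] by simp
    qed
    then have b: "L2_set (?b j) X = v / 2" using v1 by simp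
    \<comment> \<open>Each of the \<open>p\<close> entries of a column of \<open>s0\<close> has
      square at most \<open>1 / p\<close>.\<close>
    have "(\<Sum>x\<in>X. (s0 x i)\<^sup>2) \<le> (\<Sum>x\<in>X. 1 / p)"
    proof (intro sum_mono)
      fix x
      have "(chi (x - i))\<^sup>2 \<le> 1" using abs_chi_le[of "x - i"] by (simp add: abs_square_le_1)
      then show "(s0 x i)\<^sup>2 \<le> 1 / p" by (simp add: s0_def power_divide divide_right_mono)
    qed
    then have "L2_set (?a j) X \<le> 1" unfolding L2_set_def Some option.case by simp
    then have "L2_set (?b j) X * L2_set (?a j) X \<le> v / 2 * 1" unfolding b using v1 by (intro mult_left_mono) auto
    then show ?thesis using v1 by simp
  qed
  have "\<bar>op_trace X (weighted_op X s r ^^ Suc k) - op_trace X (weighted_op X s0 r0 ^^ Suc k)\<bar>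
      \<le> real (Suc k) * (real (card ?J) * ((2 * v) ^ k * v))"
    by (rule finite_rank_trace_perturbation[where a = ?a and b = ?b])
      (use weighted_op_difference L2_weighted_op_s L2_weighted_op_s0 v1 ab in auto)
  moreover have "card ?J = a + 1" by (subst card_insert_disjoint) (auto simp: card_image)
  ultimately show ?thesis unfolding op_trace_weighted_op_pow[OF finX] W_def by simp
qed


section \<open>Traces as necklace sums\<close>

definition necklace_max :: "nat \<Rightarrow> real" where
  "necklace_max k = Max ((\<lambda>Z. real_of_int \<bar>necklace_sum p k Z\<bar>) ` necklace_tuples p k a)"

lemma necklace_le_max:
  assumes "Z \<in> {1..k} \<rightarrow>\<^sub>E Pow I - {{}}"
  shows "\<bar>real_of_int (necklace_sum p k Z)\<bar> \<le> necklace_max k"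
proof -
  have "finite ({1..k} \<rightarrow>\<^sub>E Pow (residue_field p))"
    by (intro finite_PiE) (auto simp: residue_field_def)
  then have fin: "finite (necklace_tuples p k a)"
    unfolding necklace_tuples_def by simp
  have sub: "(\<Union>i\<in>{1..k}. Z i) \<subseteq> I" using assms by fastforce
  then have "card (\<Union>i\<in>{1..k}. Z i) \<le> a" using card_mono[OF finI] by simp
  moreover have "Z \<in> {1..k} \<rightarrow>\<^sub>E Pow (residue_field p)"
    using assms IX unfolding PiE_def Pi_def X_def by fastforce
  moreover have "\<forall>i\<in>{1..k}. Z i \<noteq> {}" using assms by fastforce
  ultimately have "Z \<in> necklace_tuples p k a" unfolding necklace_tuples_def by simp
  then show ?thesis unfolding necklace_max_def using fin by (intro Max_ge) auto
qed

lemma I_ne: "I \<noteq> {}" using cardI a by (metis card.empty not_one_le_zero)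

lemma necklace_max_nonneg: "necklace_max k \<ge> 0"
proof -
  have "restrict (\<lambda>_. I) {1..k} \<in> {1..k} \<rightarrow>\<^sub>E Pow I - {{}}" using I_ne by auto
  from necklace_le_max[OF this] show ?thesis by linarith
qed

lemma necklace_sum_eq:
  "real_of_int (necklace_sum p (Suc k) Z) =
     (\<Sum>x \<in> {1..Suc k} \<rightarrow>\<^sub>E X. (\<Prod>i\<in>{1..<Suc k}. chi (x (i + 1) - x i)) * (\<Prod>i\<in>{1..Suc k}. psi (Z i) (x i)) * chi (x (Suc k) - x 1))"
proof -
  have "real_of_int (necklace_sum p (Suc k) Z) =
     (\<Sum>x \<in> {1..Suc k} \<rightarrow>\<^sub>E X. (\<Prod>i\<in>{1..<Suc k}. chi (x (i + 1) - x i)) * chi (x 1 - x (Suc k)) * (\<Prod>i\<in>{1..Suc k}. psi (Z i) (x i)))"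
    unfolding necklace_sum_def X_def chi_def psi_def by (simp only: of_int_sum of_int_mult of_int_prod)
  also have "\<dots> = (\<Sum>x \<in> {1..Suc k} \<rightarrow>\<^sub>E X. (\<Prod>i\<in>{1..<Suc k}. chi (x (i + 1) - x i)) * (\<Prod>i\<in>{1..Suc k}. psi (Z i) (x i)) * chi (x (Suc k) - x 1))"
  proof (rule sum.cong[OF refl])
    fix x :: "nat \<Rightarrow> int"
    show "(\<Prod>i\<in>{1..<Suc k}. chi (x (i + 1) - x i)) * chi (x 1 - x (Suc k)) * (\<Prod>i\<in>{1..Suc k}. psi (Z i) (x i))
      = (\<Prod>i\<in>{1..<Suc k}. chi (x (i + 1) - x i)) * (\<Prod>i\<in>{1..Suc k}. psi (Z i) (x i)) * chi (x (Suc k) - x 1)"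
      unfolding chi_minus[of "x 1"] by (simp only: mult_ac)
  qed
  finally show ?thesis .
qed

lemma chi_kernel_flip: "(\<lambda>x y. chi (y - x)) = (\<lambda>x y. chi (x - y))"
  using chi_minus by blast

text \<open>The trace is a sum over closed walks with a factor \<open>r0\<close> at every vertex.
  Multiplying out these factors chooses one non-empty subset of \<open>I\<close> per vertex, that
  is, a tuple \<open>Z\<close>.\<close>

lemma trace_r0_eq_necklace:
  "(\<Sum>x\<in>X. r0 x * walk X (\<lambda>x y. chi (x - y)) r0 k x x) =
     (\<Sum>Z \<in> {1..Suc k} \<rightarrow>\<^sub>E Pow I - {{}}. (\<Prod>i\<in>{1..Suc k}. (- 1) ^ card (Z i)) * real_of_int (necklace_sum p (Suc k) Z))"
proof -
  have "(\<Sum>x\<in>X. r0 x * walk X (\<lambda>x y. chi (x - y)) r0 k x x)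
     = (\<Sum>y\<in>X. r0 y * (weighted_op X (\<lambda>x y. chi (y - x)) r0 ^^ k) (\<lambda>w. chi (w - y)) y)"
    unfolding chi_kernel_flip using weighted_op_pow_kernel[where s = "\<lambda>x y. chi (x - y)" and X = X and r = r0 and k = k] by simp
  also have "\<dots> = (\<Sum>x \<in> {1..Suc k} \<rightarrow>\<^sub>E X. (\<Prod>i\<in>{1..<Suc k}. chi (x (i + 1) - x i)) * (\<Prod>i\<in>{1..Suc k}. r0 (x i)) * chi (x (Suc k) - x 1))"
    using sum_closed_walks[where X = X and k = k and S = "\<lambda>x y. chi (x - y)" and r = r0 and H = "\<lambda>y w. chi (w - y)"]
    by simp
  also have "\<dots> = (\<Sum>x \<in> {1..Suc k} \<rightarrow>\<^sub>E X. \<Sum>Z \<in> {1..Suc k} \<rightarrow>\<^sub>E Pow I - {{}}.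
       (\<Prod>i\<in>{1..Suc k}. (- 1) ^ card (Z i)) *
       ((\<Prod>i\<in>{1..<Suc k}. chi (x (i + 1) - x i)) * (\<Prod>i\<in>{1..Suc k}. psi (Z i) (x i)) * chi (x (Suc k) - x 1)))"
  proof (rule sum.cong[OF refl])
    fix x :: "nat \<Rightarrow> int"
    have "(\<Prod>i\<in>{1..Suc k}. r0 (x i)) = (\<Sum>Z \<in> {1..Suc k} \<rightarrow>\<^sub>E Pow I - {{}}. \<Prod>i\<in>{1..Suc k}. (- 1) ^ card (Z i) * psi (Z i) (x i))"
      unfolding r0_def by (intro prod_sum_PiE) auto
    then show "(\<Prod>i\<in>{1..<Suc k}. chi (x (i + 1) - x i)) * (\<Prod>i\<in>{1..Suc k}. r0 (x i)) * chi (x (Suc k) - x 1)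
       = (\<Sum>Z \<in> {1..Suc k} \<rightarrow>\<^sub>E Pow I - {{}}. (\<Prod>i\<in>{1..Suc k}. (- 1) ^ card (Z i)) *
       ((\<Prod>i\<in>{1..<Suc k}. chi (x (i + 1) - x i)) * (\<Prod>i\<in>{1..Suc k}. psi (Z i) (x i)) * chi (x (Suc k) - x 1)))"
      by (simp only: sum_distrib_left sum_distrib_right prod.distrib mult_ac)
  qed
  also have "\<dots> = (\<Sum>Z \<in> {1..Suc k} \<rightarrow>\<^sub>E Pow I - {{}}. (\<Prod>i\<in>{1..Suc k}. (- 1) ^ card (Z i)) * real_of_int (necklace_sum p (Suc k) Z))"
    unfolding necklace_sum_eq sum_distrib_left by (rule sum.swap)
  finally show ?thesis .
qed

text \<open>There are \<open>k + 1\<close> kernel factors \<open>1 / sqrt p\<close> and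
  \<open>(2 ^ a - 1) ^ (k + 1)\<close> tuples, all within \<open>I\<close> and therefore admissible
  for the maximum.\<close>

lemma trace_r0_bound:
  "\<bar>\<Sum>x\<in>X. r0 x * walk X s0 r0 k x x\<bar> \<le> (1 / sqrt p) ^ Suc k * (v ^ Suc k * necklace_max (Suc k))"
proof -
  let ?Q = "{1..Suc k} \<rightarrow>\<^sub>E Pow I - {{}}"
  have s0: "s0 = (\<lambda>x y. 1 / sqrt p * chi (x - y))" by (simp add: s0_def fun_eq_iff)
  have "(\<Sum>x\<in>X. r0 x * walk X s0 r0 k x x) = (1 / sqrt p) ^ Suc k * (\<Sum>x\<in>X. r0 x * walk X (\<lambda>x y. chi (x - y)) r0 k x x)"
    unfolding s0 walk_scale by (simp add: sum_distrib_left mult_ac)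
  then have "\<bar>\<Sum>x\<in>X. r0 x * walk X s0 r0 k x x\<bar> = (1 / sqrt p) ^ Suc k * \<bar>\<Sum>x\<in>X. r0 x * walk X (\<lambda>x y. chi (x - y)) r0 k x x\<bar>"
    by (simp add: abs_mult)
  also have "\<dots> \<le> (1 / sqrt p) ^ Suc k * (v ^ Suc k * necklace_max (Suc k))"
  proof (rule mult_left_mono)
    have "\<bar>\<Sum>x\<in>X. r0 x * walk X (\<lambda>x y. chi (x - y)) r0 k x x\<bar>
        \<le> (\<Sum>Z\<in>?Q. \<bar>(\<Prod>i\<in>{1..Suc k}. (- 1) ^ card (Z i)) * real_of_int (necklace_sum p (Suc k) Z)\<bar>)"
      unfolding trace_r0_eq_necklace by (rule sum_abs)
    also have "\<dots> \<le> real (card ?Q) * necklace_max (Suc k)"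
    proof (rule sum_bounded_above)
      fix Z assume "Z \<in> ?Q"
      then show "\<bar>(\<Prod>i\<in>{1..Suc k}. (- 1) ^ card (Z i)) * real_of_int (necklace_sum p (Suc k) Z)\<bar> \<le> necklace_max (Suc k)"
        using necklace_le_max by (simp add: abs_mult abs_prod power_abs)
    qed
    also have "\<dots> \<le> v ^ Suc k * necklace_max (Suc k)"
    proof -
      have "real (card ?Q) \<le> v ^ Suc k"
      proof -
        have "card ?Q = (2 ^ a - 1) ^ Suc k" by (simp add: card_PiE card_Pow)
        also have "\<dots> \<le> (2 ^ a) ^ Suc k" by (intro power_mono) auto
        finally have "real (card ?Q) \<le> real ((2 ^ a) ^ Suc k)" by linarith
        then show ?thesis by (simp add: v_def)
      qed
      then show ?thesis using necklace_max_nonneg by (rule mult_right_mono)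
    qed
    finally show "\<bar>\<Sum>x\<in>X. r0 x * walk X (\<lambda>x y. chi (x - y)) r0 k x x\<bar> \<le> v ^ Suc k * necklace_max (Suc k)" .
  qed simp
  finally show ?thesis .
qed

text \<open>For \<open>k = 2\<close> and equal sets the necklace sum is the square of the character sum minus its diagonal.\<close>

lemma sum_psi_bound:
  assumes Z: "Z \<subseteq> I" "Z \<noteq> {}"
  shows "(\<Sum>x\<in>X. psi Z x)\<^sup>2 \<le> necklace_max 2 + p"
proof -
  define Y where "Y = restrict (\<lambda>_ :: nat. Z) {1..2}"
  have Y: "Y \<in> {1..2} \<rightarrow>\<^sub>E Pow I - {{}}" using Z by (auto simp: Y_def)
  have psi2: "(psi Z x)\<^sup>2 \<le> 1" for x
  proof -
    have "\<bar>psi Z x\<bar> \<le> 1" unfolding psi_def abs_prod by (intro prod_le_1) (simp add: abs_chi_le)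
    then show ?thesis by (simp add: abs_square_le_1)
  qed
  have "real_of_int (necklace_sum p 2 Y) = (\<Sum>x \<in> {1..Suc 1} \<rightarrow>\<^sub>E X. (\<Prod>i\<in>{1..<Suc 1}. chi (x (i + 1) - x i)) * (\<Prod>i\<in>{1..Suc 1}. psi Z (x i)) * chi (x (Suc 1) - x 1))"
    using necklace_sum_eq[of 1 Y] by (simp add: Y_def numeral_2_eq_2 atLeastAtMostSuc_conv)
  also have "\<dots> = (\<Sum>y\<in>X. psi Z y * (\<Sum>z\<in>X. chi (z - y) * psi Z z * chi (z - y)))"
    using sum_closed_walks[where X = X and k = 1 and S = "\<lambda>x y. chi (x - y)" and r = "psi Z" and H = "\<lambda>y w. chi (w - y)"]
    by (simp add: weighted_op_def)
  also have "\<dots> = (\<Sum>y\<in>X. \<Sum>z\<in>X. psi Z y * psi Z z - psi Z y * psi Z z * of_bool (z = y))"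
    unfolding sum_distrib_left
  proof (intro sum.cong refl)
    fix y z assume yz: "y \<in> X" "z \<in> X"
    have "psi Z y * (chi (z - y) * psi Z z * chi (z - y)) = psi Z y * psi Z z * (chi (z - y) * chi (z - y))" by simp
    also have "\<dots> = psi Z y * psi Z z * of_bool (z \<noteq> y)" by (simp only: chi_square[OF yz(2,1)])
    also have "\<dots> = psi Z y * psi Z z - psi Z y * psi Z z * of_bool (z = y)" by (cases "z = y") simp_all
    finally show "psi Z y * (chi (z - y) * psi Z z * chi (z - y)) = psi Z y * psi Z z - psi Z y * psi Z z * of_bool (z = y)" .
  qed
  also have "\<dots> = (\<Sum>x\<in>X. psi Z x)\<^sup>2 - (\<Sum>y\<in>X. \<Sum>z\<in>X. psi Z y * psi Z z * of_bool (z = y))"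
    unfolding power2_eq_square sum_product sum_subtractf ..
  also have "(\<Sum>y\<in>X. \<Sum>z\<in>X. psi Z y * psi Z z * of_bool (z = y)) = (\<Sum>y\<in>X. (psi Z y)\<^sup>2)"
    unfolding power2_eq_square by (intro sum.cong refl sum_mult_delta[OF finX])
  finally have "(\<Sum>x\<in>X. psi Z x)\<^sup>2 = real_of_int (necklace_sum p 2 Y) + (\<Sum>y\<in>X. (psi Z y)\<^sup>2)" by simp
  moreover have "(\<Sum>y\<in>X. (psi Z y)\<^sup>2) \<le> (\<Sum>y\<in>X. 1)" by (intro sum_mono psi2)
  ultimately show ?thesis using necklace_le_max[OF Y] by simp
qed

text \<open>Summation over \<open>x\<close> leaves one complete character sum for each non-empty
  subset, controlled by the necklace of length two with equal sets. The last summand is the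
  correction of \<open>r0\<close> at the \<open>a\<close> points of \<open>I\<close>.\<close>

lemma sum_r_bound: "\<bar>\<Sum>x\<in>X. r x\<bar> \<le> v * sqrt (necklace_max 2 + p) + v / 2 * a"
proof -
  have "(\<Sum>x\<in>X. r x) = (\<Sum>x\<in>X. r0 x) - v / 2 * (\<Sum>x\<in>X. of_bool (x \<in> I) * 1)"
    by (simp add: r_eq sum_subtractf sum_distrib_left del: sum_of_bool_eq)
  also have "(\<Sum>x\<in>X. of_bool (x \<in> I) * 1) = real a"
    unfolding sum_restrict_of_bool[OF finX IX] by simp
  also have "(\<Sum>x\<in>X. r0 x) = (\<Sum>Z\<in>Pow I - {{}}. (- 1) ^ card Z * (\<Sum>x\<in>X. psi Z x))"
    unfolding r0_def sum_distrib_left by (rule sum.swap)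
  finally have eq: "(\<Sum>x\<in>X. r x) = (\<Sum>Z\<in>Pow I - {{}}. (- 1) ^ card Z * (\<Sum>x\<in>X. psi Z x)) - v / 2 * a" .
  have nn: "necklace_max 2 + p \<ge> 0" using necklace_max_nonneg[of 2] by simp
  have "\<bar>\<Sum>Z\<in>Pow I - {{}}. (- 1) ^ card Z * (\<Sum>x\<in>X. psi Z x)\<bar> \<le> (\<Sum>Z\<in>Pow I - {{}}. \<bar>(- 1) ^ card Z * (\<Sum>x\<in>X. psi Z x)\<bar>)"
    by (rule sum_abs)
  also have "\<dots> \<le> real (card (Pow I - {{}})) * sqrt (necklace_max 2 + p)"
  proof (rule sum_bounded_above)
    fix Z assume Z: "Z \<in> Pow I - {{}}"
    have "\<bar>(- 1) ^ card Z * (\<Sum>x\<in>X. psi Z x)\<bar> = sqrt ((\<Sum>x\<in>X. psi Z x)\<^sup>2)"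
      by (simp add: abs_mult power_abs)
    also have "\<dots> \<le> sqrt (necklace_max 2 + p)"
      using Z by (intro real_sqrt_le_mono sum_psi_bound) auto
    finally show "\<bar>(- 1) ^ card Z * (\<Sum>x\<in>X. psi Z x)\<bar> \<le> sqrt (necklace_max 2 + p)" .
  qed
  also have "\<dots> \<le> v * sqrt (necklace_max 2 + p)"
  proof (rule mult_right_mono)
    have "card (Pow I - {{}}) \<le> card (Pow I)" by (intro card_mono) auto
    then have "real (card (Pow I - {{}})) \<le> real (2 ^ a)" by (simp add: card_Pow)
    then show "real (card (Pow I - {{}})) \<le> v" by (simp add: v_def)
  qed (use nn in simp)
  finally have "\<bar>\<Sum>Z\<in>Pow I - {{}}. (- 1) ^ card Z * (\<Sum>x\<in>X. psi Z x)\<bar> \<le> v * sqrt (necklace_max 2 + p)" .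
  moreover have "v / 2 * a \<ge> 0" using v1 by simp
  ultimately show ?thesis unfolding eq by linarith
qed


lemma trace_walk_0: "(\<Sum>x\<in>X. W 0 x x) = 1"
  by (simp add: W_def s_def s0_def)

text \<open>Through this identity the bound on the sum of \<open>r\<close> becomes an estimate of
  the number of vertices.\<close>

lemma sum_r: "(\<Sum>x\<in>X. r x) = v * card V - p"
proof -
  have "(\<Sum>x\<in>X. r x) = v * (\<Sum>x\<in>X. of_bool (x \<in> V) * 1) - p"
    unfolding r_def sum_subtractf sum_distrib_left by simp
  then show ?thesis unfolding sum_restrict_of_bool[OF finX VX] by simp
qed

lemma trace_r_bound:
  "\<bar>\<Sum>x\<in>X. r x * W k x x\<bar> \<le> v ^ Suc k * ((1 / sqrt p) ^ Suc k * necklace_max (Suc k))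
     + real (Suc k) * (real (a + 1) * ((2 * v) ^ k * v))"
  using trace_comparison[of k] trace_r0_bound[of k] by (simp only: mult.left_commute)

section \<open>The adjacency matrix as a perturbed compression\<close>

definition scaled_adjacency :: "int \<Rightarrow> int \<Rightarrow> real" where
  "scaled_adjacency x y = 2 ^ (a + 1) / sqrt p * of_bool (Legendre (x - y) (int p) = 1)"

text \<open>Off the diagonal, adjacency is \<open>(chi + 1) / 2\<close>, and the scaling
  \<open>2 ^ (a + 1)\<close> turns the half into \<open>v\<close>. The multiple of the identity
  restores the empty diagonal. The trailing factors \<open>1 * 1\<close> exhibit the last term as
  \<open>c * g x * g y\<close> with constant \<open>g\<close>.\<close>

lemma scaled_adjacency_eq:
  assumes "x \<in> V" "y \<in> V"
  shows "scaled_adjacency x y = v * s x y - v / sqrt p * of_bool (x = y) + v * (1 / sqrt p - 1 / p) * 1 * 1"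
proof (cases "x = y")
  case True
  then show ?thesis by (simp add: scaled_adjacency_def s_def s0_def Legendre_def algebra_simps)
next
  case False
  then have "chi (x - y) = 1 \<or> chi (x - y) = - 1" using assms VX chi_cases by auto
  moreover have "Legendre (x - y) (int p) = 1 \<longleftrightarrow> chi (x - y) = 1" by (simp add: chi_def)
  ultimately have "of_bool (Legendre (x - y) (int p) = 1) = (chi (x - y) + 1) / 2" by auto
  then show ?thesis unfolding scaled_adjacency_def using False
    by (simp add: s_def s0_def v_def add_divide_distrib algebra_simps)
qed

lemma adjacency_matrix_eq:
  "(2 ^ (a + 1) / sqrt (real p)) \<cdot>\<^sub>m adjacency_matrix (paley_localization p I) =
     mat (card V) (card V) (\<lambda>(i, j). scaled_adjacency (sorted_list_of_set V ! i) (sorted_list_of_set V ! j))"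
proof -
  have "(x, y) \<in> arcs_ends (paley_localization p I) \<longleftrightarrow> Legendre (x - y) (int p) = 1" if "x \<in> V" "y \<in> V" for x y
  proof -
    have "(x, y) \<in> arcs_ends (paley_localization p I) \<longleftrightarrow> (x, y) \<in> arcs_ends (paley_graph p)"
      using that unfolding V_def paley_localization_def arcs_ends_conv by (force simp: paley_graph_def)
    then show ?thesis using that VX unfolding paley_arcs_ends_iff by (auto simp: X_def)
  qed
  moreover have "sorted_list_of_set V ! i \<in> V" if "i < card V" for i
    using that nth_mem[of i "sorted_list_of_set V"] by simp
  ultimately show ?thesis
    unfolding adjacency_matrix_def Let_def V_def[symmetric]
    by (intro eq_matI) (auto simp: scaled_adjacency_def)
qed

text \<open>Here \<open>l\<close> are the eigenvalues of the compression of \<open>v s\<close>, to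
  which the word calculus applies, and \<open>m\<close> those of the scaled adjacency matrix. The
  two counting inequalities use the rank one comparison with opposite signs of
  \<open>c\<close>.\<close>

lemma spectral_comparison:
  obtains l m where
    "proots (char_poly ((2 ^ (a + 1) / sqrt (real p)) \<cdot>\<^sub>m adjacency_matrix (paley_localization p I))) = image_mset m (mset_set V)"
    "\<And>i. i \<in> V \<Longrightarrow> \<bar>l i\<bar> \<le> v"
    "\<And>k. (\<Sum>i\<in>V. kesten_mckay_poly v (Suc k) (l i)) = (\<Sum>x\<in>X. r x * W k x x) + (\<Sum>x\<in>X. W k x x)"
    "\<And>t. card {i\<in>V. m i \<le> t} \<le> card {i\<in>V. l i - v / sqrt p \<le> t} + 1"
    "\<And>t. card {i\<in>V. l i - v / sqrt p \<le> t} \<le> card {i\<in>V. m i \<le> t} + 1"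
proof -
  obtain l u where lu: "eigenbasis V (\<lambda>x y. v * s x y) l u"
    using symmetric_kernel_eigenbasis_exists[of V "\<lambda>x y. v * s x y"] s_sym by auto
  have "scaled_adjacency x y = scaled_adjacency y x" for x y
    unfolding scaled_adjacency_def using Legendre_minus[OF p, of "x - y"] by simp
  then obtain m w where mw: "eigenbasis V scaled_adjacency m w"
    using symmetric_kernel_eigenbasis_exists[of V scaled_adjacency] by auto
  note sh = eigenbasis_shift[OF finite_V lu, of "v / sqrt p"]
  show thesis
  proof (rule that)
    show "proots (char_poly ((2 ^ (a + 1) / sqrt (real p)) \<cdot>\<^sub>m adjacency_matrix (paley_localization p I))) = image_mset m (mset_set V)"
      unfolding adjacency_matrix_eq by (rule proots_char_poly_eigenbasis[OF finite_V mw])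
    show "\<bar>l i\<bar> \<le> v" if "i \<in> V" for i using eigenvalue_bound[OF lu that] v1 by simp
    show "(\<Sum>i\<in>V. kesten_mckay_poly v (Suc k) (l i)) = (\<Sum>x\<in>X. r x * W k x x) + (\<Sum>x\<in>X. W k x x)" for k
      by (rule sum_poly_eigenvalues[OF lu])
    show "card {i\<in>V. m i \<le> t} \<le> card {i\<in>V. l i - v / sqrt p \<le> t} + 1" for t
      by (rule rank_one_perturbation_eigenvalue_count[OF finite_V mw sh, where c = "v * (1 / sqrt p - 1 / p)" and g = "\<lambda>_. 1"])
        (rule scaled_adjacency_eq)
    show "card {i\<in>V. l i - v / sqrt p \<le> t} \<le> card {i\<in>V. m i \<le> t} + 1" for t
      by (rule rank_one_perturbation_eigenvalue_count[OF finite_V sh mw, where c = "- (v * (1 / sqrt p - 1 / p))" and g = "\<lambda>_. 1"])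
        (use scaled_adjacency_eq in simp)
  qed
qed


lemma abs_trace_walk_le:
  "\<bar>\<Sum>x\<in>X. W k x x\<bar> \<le> diagonal_bound a necklace_max p k"
proof (induction k rule: less_induct)
  case (less k)
  consider "k = 0" | "k = 1" | m where "k = Suc (Suc m)" by (metis One_nat_def not0_implies_Suc)
  then show ?case
  proof cases
    case 1
    then show ?thesis using trace_walk_0 by simp
  next
    case 2
    then show ?thesis using trace_walk_1 sum_r_bound by (simp add: v_def)
  next
    case (3 m)
    have "\<bar>\<Sum>x\<in>X. W k x x\<bar> \<le> \<bar>v - 2\<bar> * \<bar>\<Sum>x\<in>X. r x * W m x x\<bar> + \<bar>v - 1\<bar> * \<bar>\<Sum>x\<in>X. W m x x\<bar>"
      unfolding 3 trace_walk_Suc_Suc abs_mult[symmetric] by (rule abs_triangle_ineq)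
    also have "\<dots> \<le> v * closed_walk_bound a necklace_max p m + v * diagonal_bound a necklace_max p m"
    proof (intro add_mono mult_mono)
      show "\<bar>\<Sum>x\<in>X. r x * W m x x\<bar> \<le> closed_walk_bound a necklace_max p m"
        unfolding closed_walk_bound_def v_def[symmetric] by (rule trace_r_bound)
      show "\<bar>\<Sum>x\<in>X. W m x x\<bar> \<le> diagonal_bound a necklace_max p m" using less.IH[of m] 3 by simp
    qed (use v1 in auto)
    finally show ?thesis unfolding 3 by (simp add: v_def)
  qed
qed

text \<open>The existential form permits a simultaneous choice of \<open>l\<close> and
  \<open>m\<close> for all suitable primes.\<close>

lemma spectral_summary:
  "\<bar>2 ^ a * real (card V) - real p\<bar> \<le> diagonal_bound a necklace_max p 1"
  "\<exists>l m. proots (char_poly ((2 ^ (a + 1) / sqrt (real p)) \<cdot>\<^sub>m adjacency_matrix (paley_localization p I))) = image_mset m (mset_set V)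
    \<and> (\<forall>i\<in>V. \<bar>l i\<bar> \<le> 2 ^ a)
    \<and> (\<forall>k. \<bar>\<Sum>i\<in>V. kesten_mckay_poly (2 ^ a) (Suc k) (l i)\<bar> \<le> closed_walk_bound a necklace_max p k + diagonal_bound a necklace_max p k)
    \<and> (\<forall>t. card {i\<in>V. m i \<le> t} \<le> card {i\<in>V. l i - 2 ^ a / sqrt p \<le> t} + 1)
    \<and> (\<forall>t. card {i\<in>V. l i - 2 ^ a / sqrt p \<le> t} \<le> card {i\<in>V. m i \<le> t} + 1)"
proof -
  show "\<bar>2 ^ a * real (card V) - real p\<bar> \<le> diagonal_bound a necklace_max p 1"
    using abs_trace_walk_le[of 1] trace_walk_1 sum_r by (simp add: v_def)
  show "\<exists>l m. proots (char_poly ((2 ^ (a + 1) / sqrt (real p)) \<cdot>\<^sub>m adjacency_matrix (paley_localization p I))) = image_mset m (mset_set V)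
    \<and> (\<forall>i\<in>V. \<bar>l i\<bar> \<le> 2 ^ a)
    \<and> (\<forall>k. \<bar>\<Sum>i\<in>V. kesten_mckay_poly (2 ^ a) (Suc k) (l i)\<bar> \<le> closed_walk_bound a necklace_max p k + diagonal_bound a necklace_max p k)
    \<and> (\<forall>t. card {i\<in>V. m i \<le> t} \<le> card {i\<in>V. l i - 2 ^ a / sqrt p \<le> t} + 1)
    \<and> (\<forall>t. card {i\<in>V. l i - 2 ^ a / sqrt p \<le> t} \<le> card {i\<in>V. m i \<le> t} + 1)"
  proof (rule spectral_comparison, goal_cases)
    case lm: (1 l m)
    have "\<bar>\<Sum>i\<in>V. kesten_mckay_poly v (Suc k) (l i)\<bar> \<le> closed_walk_bound a necklace_max p k + diagonal_bound a necklace_max p k" for k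
      unfolding lm(3) closed_walk_bound_def v_def[symmetric]
      by (rule order_trans[OF abs_triangle_ineq add_mono[OF trace_r_bound abs_trace_walk_le]])
    then show ?case using lm(1,2,4,5) unfolding v_def by blast
  qed
qed

end

section \<open>Weak convergence\<close>

definition uniform_image :: "'a set \<Rightarrow> ('a \<Rightarrow> real) \<Rightarrow> real measure" where
  "uniform_image V g = distr (measure_pmf (map_pmf g (pmf_of_set V))) borel (\<lambda>x. x)"

lemma real_distribution_uniform_image: "real_distribution (uniform_image V g)"
  unfolding uniform_image_def
  by (intro real_distribution.intro real_distribution_axioms.intro prob_space.prob_space_distr) (auto intro: prob_space_measure_pmf)

lemma integral_uniform_image:
  assumes "finite V" "V \<noteq> {}" "continuous_on UNIV f"
  shows "integral\<^sup>L (uniform_image V g) f = (\<Sum>i\<in>V. f (g i)) / card V"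
proof -
  have "f \<in> borel_measurable borel" using assms(3) by (rule borel_measurable_continuous_onI)
  then show ?thesis unfolding uniform_image_def
    using assms by (subst integral_distr) (auto simp: integral_map_pmf integral_pmf_of_set)
qed

lemma cdf_uniform_image:
  assumes "finite V" "V \<noteq> {}"
  shows "cdf (uniform_image V g) t = card {i\<in>V. g i \<le> t} / card V"
proof -
  have "cdf (uniform_image V g) t = measure (measure_pmf (map_pmf g (pmf_of_set V))) {..t}"
    unfolding cdf_def uniform_image_def by (subst measure_distr) auto
  also have "\<dots> = measure (measure_pmf (pmf_of_set V)) (g -` {..t})" by simp
  also have "\<dots> = card (V \<inter> g -` {..t}) / card V" using assms by (intro measure_pmf_of_set) auto
  also have "V \<inter> g -` {..t} = {i\<in>V. g i \<le> t}" by auto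
  finally show ?thesis .
qed

lemma empirical_spectral_distribution_eq:
  assumes "proots (char_poly M) = image_mset g (mset_set V)" "finite V" "V \<noteq> {}"
  shows "empirical_spectral_distribution M = uniform_image V g"
proof -
  have ne: "image_mset g (mset_set V) \<noteq> {#}" using assms by (simp add: mset_set_empty_iff)
  have "pmf_of_multiset (image_mset g (mset_set V)) = map_pmf g (pmf_of_set V)"
  proof (rule pmf_eqI)
    fix x
    have "pmf (pmf_of_multiset (image_mset g (mset_set V))) x = card {i\<in>V. g i = x} / card V"
      using ne assms by (simp add: count_image_mset' sum.If_cases Int_def conj_commute eq_commute[of x])
    also have "\<dots> = measure (measure_pmf (pmf_of_set V)) (g -` {x})"
    proof -
      have "V \<inter> g -` {x} = {i\<in>V. g i = x}" by auto
      then show ?thesis using measure_pmf_of_set[OF assms(3,2)] by simp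
    qed
    finally show "pmf (pmf_of_multiset (image_mset g (mset_set V))) x = pmf (map_pmf g (pmf_of_set V)) x"
      by (simp add: pmf_map)
  qed
  then show ?thesis unfolding empirical_spectral_distribution_def uniform_image_def assms(1) by simp
qed

section \<open>Convergence of means\<close>

lemma kesten_mckay_integrable_continuous:
  fixes f :: "real \<Rightarrow> real"
  assumes v: "v \<ge> 2" and f: "continuous_on UNIV f"
  shows "integrable (kesten_mckay v) f"
proof -
  interpret real_distribution "kesten_mckay v" by (rule real_distribution_kesten_mckay[OF v])
  have "bounded (f ` {- v..v})"
    using f by (intro compact_imp_bounded compact_continuous_image) (auto intro: continuous_on_subset)
  then obtain B where B: "\<And>x. x \<in> {- v..v} \<Longrightarrow> \<bar>f x\<bar> \<le> B" unfolding bounded_iff real_norm_def by blast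
  have "\<bar>f x\<bar> \<le> B" if "\<bar>x\<bar> \<le> v" for x
  proof -
    have "- v \<le> x" "x \<le> v" using that by linarith+
    then show ?thesis using B[of x] by simp
  qed
  then have "AE x in kesten_mckay v. norm (f x) \<le> B"
    using AE_kesten_mckay_bounded[OF v] by auto
  moreover have "f \<in> borel_measurable (kesten_mckay v)"
    using borel_measurable_continuous_onI[OF f] by simp
  ultimately show ?thesis by (intro integrable_const_bound)
qed

text \<open>The three-term recurrence expresses \<open>x\<close> times a polynomial by its
  neighbours, for the empirical means and for the integrals alike. Induction on \<open>j\<close>
  with \<open>k\<close> arbitrary thus reaches all monomials without inverting the change of basis;
  the base case is total mass one in degree 0 and the vanishing means in positive degree.\<close>

lemma tendsto_mean_poly:
  fixes l :: "nat \<Rightarrow> 'a \<Rightarrow> real"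
  assumes v: "v \<ge> 2" and V: "\<And>n. finite (V n)" "\<And>n. V n \<noteq> {}"
    and lim: "\<And>k. (\<lambda>n. (\<Sum>i\<in>V n. kesten_mckay_poly v (Suc k) (l n i)) / card (V n)) \<longlonglongrightarrow> 0"
  shows "(\<lambda>n. (\<Sum>i\<in>V n. l n i ^ j * kesten_mckay_poly v k (l n i)) / card (V n))
    \<longlonglongrightarrow> (\<integral>x. x ^ j * kesten_mckay_poly v k x \<partial>kesten_mckay v)"
proof (induction j arbitrary: k)
  case 0
  interpret real_distribution "kesten_mckay v" by (rule real_distribution_kesten_mckay[OF v])
  show ?case
  proof (cases k)
    case 0
    have "measure (kesten_mckay v) UNIV = 1" using prob_space by simp
    then show ?thesis using 0 V by simp
  next
    case (Suc k')
    then show ?thesis using lim[of k'] kesten_mckay_integral_poly(2)[OF v, of k]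
      by (simp del: kesten_mckay_poly.simps)
  qed
next
  case (Suc j)
  have cont: "continuous_on UNIV (\<lambda>x. x ^ j * kesten_mckay_poly v k x)" for j k
    by (intro continuous_intros)
  show ?case
  proof (cases k)
    case 0
    show ?thesis using Suc.IH[of 1] 0 by (simp add: mult.commute)
  next
    case k: (Suc k')
    define c where "c = (if k' = 0 then v else v - 1)"
    have eq: "x ^ Suc j * kesten_mckay_poly v k x
       = x ^ j * kesten_mckay_poly v (Suc k) x + c * (x ^ j * kesten_mckay_poly v k' x)" for x
      unfolding k c_def by (simp add: algebra_simps)
    have "(\<integral>x. x ^ Suc j * kesten_mckay_poly v k x \<partial>kesten_mckay v)
       = (\<integral>x. x ^ j * kesten_mckay_poly v (Suc k) x \<partial>kesten_mckay v) + c * (\<integral>x. x ^ j * kesten_mckay_poly v k' x \<partial>kesten_mckay v)"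
      unfolding eq
      by (subst Bochner_Integration.integral_add)
        (auto intro!: integrable_mult_right kesten_mckay_integrable_continuous v cont simp del: kesten_mckay_poly.simps)
    moreover have "(\<Sum>i\<in>V n. l n i ^ Suc j * kesten_mckay_poly v k (l n i)) / card (V n)
       = (\<Sum>i\<in>V n. l n i ^ j * kesten_mckay_poly v (Suc k) (l n i)) / card (V n)
         + c * ((\<Sum>i\<in>V n. l n i ^ j * kesten_mckay_poly v k' (l n i)) / card (V n))" for n
      unfolding eq by (simp add: sum.distrib add_divide_distrib sum_distrib_left del: kesten_mckay_poly.simps)
    ultimately show ?thesis by (simp only:) (intro tendsto_add tendsto_mult_left Suc.IH)
  qed
qed

text \<open>All eigenvalues and almost all of the limit law lie in the interval from
  \<open>- v\<close> to \<open>v\<close>, so uniform polynomial approximation there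
  suffices.\<close>

lemma tendsto_mean_continuous:
  fixes l :: "nat \<Rightarrow> 'a \<Rightarrow> real"
  assumes v: "v \<ge> 2" and V: "\<And>n. finite (V n)" "\<And>n. V n \<noteq> {}"
    and lim: "\<And>k. (\<lambda>n. (\<Sum>i\<in>V n. kesten_mckay_poly v (Suc k) (l n i)) / card (V n)) \<longlonglongrightarrow> 0"
    and bound: "\<And>n i. i \<in> V n \<Longrightarrow> \<bar>l n i\<bar> \<le> v" and f: "continuous_on UNIV f"
  shows "(\<lambda>n. (\<Sum>i\<in>V n. f (l n i)) / card (V n)) \<longlonglongrightarrow> (\<integral>x. f x \<partial>kesten_mckay v)"
proof (rule LIMSEQ_I)
  interpret real_distribution "kesten_mckay v" by (rule real_distribution_kesten_mckay[OF v])
  fix e :: real assume e: "e > 0"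
  have "continuous_on {- v..v} f" using f by (rule continuous_on_subset) simp
  then obtain g where g: "real_polynomial_function g" "\<And>x. x \<in> {- v..v} \<Longrightarrow> \<bar>f x - g x\<bar> < e / 4"
    using Stone_Weierstrass_real_polynomial_function[of "{- v..v}" f "e / 4"] e by auto
  obtain b N where gb: "g = (\<lambda>x. \<Sum>j\<le>N. b j * x ^ j)"
    using g(1) unfolding real_polynomial_function_iff_sum by blast
  have contg: "continuous_on UNIV g" unfolding gb by (intro continuous_intros)
  have mono: "(\<lambda>n. (\<Sum>i\<in>V n. l n i ^ j) / card (V n)) \<longlonglongrightarrow> (\<integral>x. x ^ j \<partial>kesten_mckay v)" for j
    using tendsto_mean_poly[OF v V lim, of j 0] by simp
  have "(\<lambda>n. \<Sum>j\<le>N. b j * ((\<Sum>i\<in>V n. l n i ^ j) / card (V n))) \<longlonglongrightarrow> (\<Sum>j\<le>N. b j * (\<integral>x. x ^ j \<partial>kesten_mckay v))"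
    by (intro tendsto_sum tendsto_mult_left mono)
  also have "(\<lambda>n. \<Sum>j\<le>N. b j * ((\<Sum>i\<in>V n. l n i ^ j) / card (V n))) = (\<lambda>n. (\<Sum>i\<in>V n. g (l n i)) / card (V n))"
  proof
    fix n
    have "(\<Sum>i\<in>V n. g (l n i)) = (\<Sum>j\<le>N. b j * (\<Sum>i\<in>V n. l n i ^ j))"
      unfolding gb sum_distrib_left by (rule sum.swap)
    then show "(\<Sum>j\<le>N. b j * ((\<Sum>i\<in>V n. l n i ^ j) / card (V n))) = (\<Sum>i\<in>V n. g (l n i)) / card (V n)"
      by (simp add: sum_divide_distrib sum_distrib_left)
  qed
  also have "(\<Sum>j\<le>N. b j * (\<integral>x. x ^ j \<partial>kesten_mckay v)) = (\<integral>x. g x \<partial>kesten_mckay v)"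
    unfolding gb
    by (subst Bochner_Integration.integral_sum)
      (auto intro!: integrable_mult_right kesten_mckay_integrable_continuous v continuous_intros)
  finally have "(\<lambda>n. (\<Sum>i\<in>V n. g (l n i)) / card (V n)) \<longlonglongrightarrow> (\<integral>x. g x \<partial>kesten_mckay v)" .
  from LIMSEQ_D[OF this, of "e / 4"] e obtain n0 where
    n0: "\<And>n. n \<ge> n0 \<Longrightarrow> \<bar>(\<Sum>i\<in>V n. g (l n i)) / card (V n) - (\<integral>x. g x \<partial>kesten_mckay v)\<bar> < e / 4"
    by auto
  have I: "\<bar>(\<integral>x. f x \<partial>kesten_mckay v) - (\<integral>x. g x \<partial>kesten_mckay v)\<bar> \<le> e / 4"
  proof -
    have int: "integrable (kesten_mckay v) f" "integrable (kesten_mckay v) g"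
      by (intro kesten_mckay_integrable_continuous v f contg)+
    have "\<bar>\<integral>x. f x - g x \<partial>kesten_mckay v\<bar> \<le> (\<integral>x. \<bar>f x - g x\<bar> \<partial>kesten_mckay v)"
      using integral_norm_bound[of "kesten_mckay v" "\<lambda>x. f x - g x"] by simp
    also have "\<dots> \<le> (\<integral>x. e / 4 \<partial>kesten_mckay v)"
    proof (rule integral_mono_AE)
      show "AE x in kesten_mckay v. \<bar>f x - g x\<bar> \<le> e / 4"
      proof -
        have "\<bar>f x - g x\<bar> \<le> e / 4" if "\<bar>x\<bar> \<le> v" for x
        proof -
          have "- v \<le> x" "x \<le> v" using that by linarith+
          then show ?thesis using g(2)[of x] by simp
        qed
        then show ?thesis using AE_kesten_mckay_bounded[OF v] by auto
      qed
    qed (use int in auto)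
    also have "\<dots> = e / 4" using prob_space by simp
    finally show ?thesis using int by simp
  qed
  have S: "\<bar>(\<Sum>i\<in>V n. f (l n i)) / card (V n) - (\<Sum>i\<in>V n. g (l n i)) / card (V n)\<bar> \<le> e / 4" for n
  proof -
    have c: "card (V n) > 0" using V by (simp add: card_gt_0_iff)
    have "\<bar>\<Sum>i\<in>V n. f (l n i) - g (l n i)\<bar> \<le> (\<Sum>i\<in>V n. \<bar>f (l n i) - g (l n i)\<bar>)" by (rule sum_abs)
    also have "\<dots> \<le> real (card (V n)) * (e / 4)"
    proof (rule sum_bounded_above)
      fix i assume "i \<in> V n"
      then have "l n i \<in> {- v..v}" using bound[of i n] by (auto simp: abs_le_iff)
      then show "\<bar>f (l n i) - g (l n i)\<bar> \<le> e / 4" using g(2) by (simp add: less_imp_le)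
    qed
    finally show ?thesis using c
      by (simp add: sum_subtractf diff_divide_distrib[symmetric] abs_div_pos[symmetric] divide_le_eq mult.commute)
  qed
  show "\<exists>n0. \<forall>n\<ge>n0. norm ((\<Sum>i\<in>V n. f (l n i)) / card (V n) - (\<integral>x. f x \<partial>kesten_mckay v)) < e"
  proof (intro exI allI impI)
    fix n assume "n0 \<le> n"
    then show "norm ((\<Sum>i\<in>V n. f (l n i)) / card (V n) - (\<integral>x. f x \<partial>kesten_mckay v)) < e"
      using n0[of n] I S[of n] e unfolding real_norm_def by argo
  qed
qed

lemma weak_conv_shifted:
  fixes l :: "nat \<Rightarrow> 'a \<Rightarrow> real"
  assumes v: "v \<ge> 2" and V: "\<And>n. finite (V n)" "\<And>n. V n \<noteq> {}"
    and lim: "\<And>k. (\<lambda>n. (\<Sum>i\<in>V n. kesten_mckay_poly v (Suc k) (l n i)) / card (V n)) \<longlonglongrightarrow> 0"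
    and bound: "\<And>n i. i \<in> V n \<Longrightarrow> \<bar>l n i\<bar> \<le> v" and d: "d \<longlonglongrightarrow> 0"
  shows "weak_conv_m (\<lambda>n. uniform_image (V n) (\<lambda>i. l n i - d n)) (kesten_mckay v)"
proof -
  have "weak_conv_filter (\<lambda>n. uniform_image (V n) (\<lambda>i. l n i - d n)) (kesten_mckay v) sequentially"
    unfolding weak_conv_filter_def
  proof (intro allI impI)
    fix f :: "real \<Rightarrow> real" assume f: "continuous_on UNIV f"
    have "(\<lambda>n. (\<Sum>i\<in>V n. f (l n i - d n)) / card (V n) - (\<Sum>i\<in>V n. f (l n i)) / card (V n)) \<longlonglongrightarrow> 0"
    proof (rule LIMSEQ_I)
      fix e :: real assume e: "e > 0"
      \<comment> \<open>The interval is widened by 1 so that it still contains the shifted points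
        once \<open>d n\<close> is less than 1 in absolute value.\<close>
      have "uniformly_continuous_on {- v - 1..v + 1} f"
        using f by (intro compact_uniformly_continuous) (auto intro: continuous_on_subset)
      then obtain \<delta> where \<delta>: "\<delta> > 0" "\<And>x y. x \<in> {- v - 1..v + 1} \<Longrightarrow> y \<in> {- v - 1..v + 1} \<Longrightarrow> dist y x < \<delta> \<Longrightarrow> dist (f y) (f x) < e / 2"
        using e unfolding uniformly_continuous_on_def by (metis half_gt_zero)
      from LIMSEQ_D[OF d, of "min \<delta> 1"] \<delta>(1) obtain n0 where n0: "\<And>n. n \<ge> n0 \<Longrightarrow> \<bar>d n\<bar> < min \<delta> 1" by auto
      show "\<exists>n0. \<forall>n\<ge>n0. norm ((\<Sum>i\<in>V n. f (l n i - d n)) / card (V n) - (\<Sum>i\<in>V n. f (l n i)) / card (V n) - 0) < e"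
      proof (intro exI allI impI)
        fix n assume n: "n0 \<le> n"
        have c: "card (V n) > 0" using V by (simp add: card_gt_0_iff)
        have "\<bar>\<Sum>i\<in>V n. f (l n i - d n) - f (l n i)\<bar> \<le> (\<Sum>i\<in>V n. \<bar>f (l n i - d n) - f (l n i)\<bar>)" by (rule sum_abs)
        also have "\<dots> \<le> real (card (V n)) * (e / 2)"
        proof (rule sum_bounded_above)
          fix i assume "i \<in> V n"
          then have "\<bar>l n i\<bar> \<le> v" by (rule bound)
          moreover have "\<bar>d n\<bar> < 1" "\<bar>d n\<bar> < \<delta>" using n0[OF n] by auto
          ultimately show "\<bar>f (l n i - d n) - f (l n i)\<bar> \<le> e / 2"
            using \<delta>(2)[of "l n i" "l n i - d n"] by (auto simp: dist_real_def abs_le_iff abs_less_iff)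
        qed
        finally have "\<bar>(\<Sum>i\<in>V n. f (l n i - d n)) / card (V n) - (\<Sum>i\<in>V n. f (l n i)) / card (V n)\<bar> \<le> e / 2"
          using c by (simp add: sum_subtractf diff_divide_distrib[symmetric] abs_div_pos[symmetric] divide_le_eq mult.commute)
        then show "norm ((\<Sum>i\<in>V n. f (l n i - d n)) / card (V n) - (\<Sum>i\<in>V n. f (l n i)) / card (V n) - 0) < e"
          using e by simp
      qed
    qed
    from tendsto_add[OF this tendsto_mean_continuous[OF v V lim bound f]]
    show "(\<lambda>n. integral\<^sup>L (uniform_image (V n) (\<lambda>i. l n i - d n)) f) \<longlonglongrightarrow> integral\<^sup>L (kesten_mckay v) f"
      by (simp add: integral_uniform_image[OF V f])
  qed
  then show ?thesis
    by (subst (asm) weak_conv_filter_sequentially) (auto intro: real_distribution_uniform_image real_distribution_kesten_mckay v)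
qed

section \<open>Removing the rank one term and passing to sequences\<close>

text \<open>The distribution functions differ by at most \<open>1 / card (V n)\<close>, which tends
  to 0. No bound on the eigenvalues \<open>m\<close> enters, so an outlier may escape to
  infinity.\<close>

lemma weak_conv_count_perturbation:
  fixes l m :: "nat \<Rightarrow> 'a \<Rightarrow> real"
  assumes V: "\<And>n. finite (V n)" "\<And>n. V n \<noteq> {}"
    and card: "filterlim (\<lambda>n. real (card (V n))) at_top sequentially"
    and conv: "weak_conv_m (\<lambda>n. uniform_image (V n) (l n)) \<mu>"
    and c1: "\<And>n t. card {i\<in>V n. m n i \<le> t} \<le> card {i\<in>V n. l n i \<le> t} + 1"
    and c2: "\<And>n t. card {i\<in>V n. l n i \<le> t} \<le> card {i\<in>V n. m n i \<le> t} + 1"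
  shows "weak_conv_m (\<lambda>n. uniform_image (V n) (m n)) \<mu>"
  unfolding weak_conv_m_def weak_conv_def
proof (intro allI impI)
  fix t assume "isCont (cdf \<mu>) t"
  then have lim: "(\<lambda>n. cdf (uniform_image (V n) (l n)) t) \<longlonglongrightarrow> cdf \<mu> t"
    using conv unfolding weak_conv_m_def weak_conv_def by blast
  have inv: "(\<lambda>n. 1 / real (card (V n))) \<longlonglongrightarrow> 0"
    using tendsto_inverse_0_at_top[OF card] by (simp add: inverse_eq_divide)
  have "(\<lambda>n. cdf (uniform_image (V n) (m n)) t - cdf (uniform_image (V n) (l n)) t) \<longlonglongrightarrow> 0"
  proof (rule Lim_null_comparison[OF _ inv], rule always_eventually, rule allI)
    fix n
    have c: "real (card (V n)) > 0" using V by (simp add: card_gt_0_iff)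
    have "\<bar>real (card {i\<in>V n. m n i \<le> t}) - real (card {i\<in>V n. l n i \<le> t})\<bar> \<le> 1"
      using c1[of n t] c2[of n t] by linarith
    then show "norm (cdf (uniform_image (V n) (m n)) t - cdf (uniform_image (V n) (l n)) t) \<le> 1 / real (card (V n))"
      using c unfolding cdf_uniform_image[OF V]
      by (simp add: diff_divide_distrib[symmetric] divide_right_mono)
  qed
  from tendsto_add[OF this lim] show "(\<lambda>n. cdf (uniform_image (V n) (m n)) t) \<longlonglongrightarrow> cdf \<mu> t" by simp
qed

text \<open>A failure of convergence yields a sequence of primes that stays away from the limit.
  Since \<open>Q\<close> holds eventually, the sequence can be taken entirely within
  \<open>Q\<close>, so each of its terms has the required spectral data.\<close>

lemma tendsto_primes_1_mod_4_sequentially: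
  fixes g :: "nat \<Rightarrow> real"
  assumes Q: "eventually Q primes_1_mod_4"
    and lim: "\<And>X. (\<And>n. Q (X n)) \<Longrightarrow> filterlim X primes_1_mod_4 sequentially \<Longrightarrow> (\<lambda>n. g (X n)) \<longlonglongrightarrow> L"
  shows "(g \<longlongrightarrow> L) primes_1_mod_4"
proof (rule ccontr)
  define S where "S = {p. prime p \<and> [p = (1 :: nat)] (mod 4)}"
  have ev: "eventually P primes_1_mod_4 \<longleftrightarrow> (\<exists>N. \<forall>n\<ge>N. n \<in> S \<longrightarrow> P n)" for P
    unfolding primes_1_mod_4_def S_def[symmetric] eventually_inf_principal eventually_at_top_linorder ..
  assume "\<not> ?thesis"
  then obtain e where e: "e > 0" "\<not> eventually (\<lambda>p. dist (g p) L < e) primes_1_mod_4"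
    unfolding tendsto_iff by blast
  obtain N0 where N0: "\<And>n. n \<ge> N0 \<Longrightarrow> n \<in> S \<Longrightarrow> Q n" using Q unfolding ev by blast
  have "\<exists>p\<ge>max N N0. p \<in> S \<and> \<not> dist (g p) L < e" for N
    using e(2) unfolding ev by blast
  then obtain X where X: "\<And>n. X n \<ge> max n N0" "\<And>n. X n \<in> S" "\<And>n. \<not> dist (g (X n)) L < e" by metis
  have "filterlim X primes_1_mod_4 sequentially"
    unfolding filterlim_iff ev eventually_sequentially using X(1,2) by (metis max.bounded_iff order_trans)
  moreover have "Q (X n)" for n using X N0 by simp
  ultimately have "(\<lambda>n. g (X n)) \<longlonglongrightarrow> L" using lim by blast
  then have "eventually (\<lambda>n. dist (g (X n)) L < e) sequentially" using e(1) by (rule tendstoD)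
  then show False using X(3) by simp
qed

section \<open>Convergence of the empirical spectral distributions\<close>

lemma eventually_primes_1_mod_4: "eventually (\<lambda>p. prime p \<and> [p = 1] (mod 4)) primes_1_mod_4"
  unfolding primes_1_mod_4_def eventually_inf_principal by simp

lemma primes_1_mod_4_at_top: "filterlim (\<lambda>p. real p) at_top primes_1_mod_4"
  unfolding primes_1_mod_4_def
  by (rule filterlim_mono[OF filterlim_real_sequentially order_refl inf_le1])

text \<open>Dividing \<open>(1 / sqrt p) ^ (k + 1)\<close> by \<open>p\<close> produces exactly the
  exponent of the hypothesis for length \<open>k + 1\<close>; the perturbation error is constant in
  \<open>p\<close>.\<close>

lemma tendsto_closed_walk_bound:
  assumes M: "\<And>k. k \<ge> 1 \<Longrightarrow> ((\<lambda>p. real p powr (- (real k / 2 + 1)) * M p k) \<longlongrightarrow> 0) primes_1_mod_4"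
  shows "((\<lambda>p. closed_walk_bound a (M p) p k / real p) \<longlongrightarrow> 0) primes_1_mod_4"
proof -
  define C where "C = real (Suc k) * (real (a + 1) * ((2 * 2 ^ a) ^ k * 2 ^ a))"
  have "((\<lambda>p. (2 ^ a) ^ Suc k * (real p powr (- (real (Suc k) / 2 + 1)) * M p (Suc k)) + C * inverse (real p))
      \<longlongrightarrow> (2 ^ a) ^ Suc k * 0 + C * 0) primes_1_mod_4"
    by (intro tendsto_add tendsto_mult_left M tendsto_inverse_0_at_top primes_1_mod_4_at_top) simp
  moreover have "eventually (\<lambda>p. (2 ^ a) ^ Suc k * (real p powr (- (real (Suc k) / 2 + 1)) * M p (Suc k)) + C * inverse (real p)
      = closed_walk_bound a (M p) p k / real p) primes_1_mod_4"
    using eventually_primes_1_mod_4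
  proof eventually_elim
    case (elim p)
    then have p: "real p > 0" by (simp add: prime_gt_0_nat)
    have e: "(1 / sqrt p) ^ Suc k / p = real p powr (- (real (Suc k) / 2 + 1))"
    proof -
      have "1 / sqrt p = real p powr (- 1 / 2)"
        using p by (simp add: powr_half_sqrt[symmetric] powr_minus_divide)
      then have "(1 / sqrt p) ^ Suc k = real p powr (real (Suc k) * (- 1 / 2))"
        using p by (simp only: powr_power)
      moreover have "1 / real p = real p powr (- 1)" using p by (simp add: powr_minus_divide)
      ultimately have "(1 / sqrt p) ^ Suc k * (1 / p) = real p powr (real (Suc k) * (- 1 / 2) + - 1)"
        by (simp only: powr_add)
      moreover have "real (Suc k) * (- 1 / 2) + - 1 = - (real (Suc k) / 2 + 1)" by simp
      ultimately show ?thesis by (simp only: times_divide_eq_right mult_1_right)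
    qed
    have "b * (c / real p * x) + C * inverse (real p) = (b * (c * x) + C) / real p" for b c x
      by (simp add: divide_inverse algebra_simps)
    then show ?case
      unfolding closed_walk_bound_def C_def[symmetric] e[symmetric] .
  qed
  ultimately have "((\<lambda>p. closed_walk_bound a (M p) p k / real p) \<longlongrightarrow> (2 ^ a) ^ Suc k * 0 + C * 0) primes_1_mod_4"
    by (rule Lim_transform_eventually)
  then show ?thesis by simp
qed

lemma tendsto_diagonal_bound:
  assumes M: "\<And>k. k \<ge> 1 \<Longrightarrow> ((\<lambda>p. real p powr (- (real k / 2 + 1)) * M p k) \<longlongrightarrow> 0) primes_1_mod_4"
  shows "((\<lambda>p. diagonal_bound a (M p) p k / real p) \<longlongrightarrow> 0) primes_1_mod_4"
proof (induction k rule: less_induct)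
  case (less k)
  have inv: "((\<lambda>p. inverse (real p)) \<longlongrightarrow> 0) primes_1_mod_4"
    by (intro tendsto_inverse_0_at_top primes_1_mod_4_at_top)
  consider "k = 0" | "k = 1" | m where "k = Suc (Suc m)" by (metis One_nat_def not0_implies_Suc)
  then show ?case
  proof cases
    case 1
    then show ?thesis using inv by (simp add: inverse_eq_divide)
  next
    case 2
    have "((\<lambda>p. 2 ^ a * sqrt (real p powr (- (real 2 / 2 + 1)) * M p 2 + inverse (real p)) + 2 ^ a / 2 * a * inverse (real p))
        \<longlongrightarrow> 2 ^ a * sqrt (0 + 0) + 2 ^ a / 2 * a * 0) primes_1_mod_4"
      by (intro tendsto_add tendsto_mult_left tendsto_real_sqrt M inv) simp
    moreover have "eventually (\<lambda>p. 2 ^ a * sqrt (real p powr (- (real 2 / 2 + 1)) * M p 2 + inverse (real p)) + 2 ^ a / 2 * a * inverse (real p)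
        = diagonal_bound a (M p) p k / real p) primes_1_mod_4"
      using eventually_primes_1_mod_4
    proof eventually_elim
      case (elim p)
      then have p: "real p > 0" by (simp add: prime_gt_0_nat)
      \<comment> \<open>For length two the normalization is \<open>p ^ 2\<close>, which becomes the
        required division by \<open>p\<close> after the square root.\<close>
      have "real p powr (- (real 2 / 2 + 1)) = 1 / (real p)\<^sup>2"
        using p by (simp add: powr_minus_divide)
      then have "real p powr (- (real 2 / 2 + 1)) * M p 2 + inverse (real p) = (M p 2 + p) / (real p)\<^sup>2"
        using p by (simp add: field_simps power2_eq_square)
      then have e: "sqrt (real p powr (- (real 2 / 2 + 1)) * M p 2 + inverse (real p)) = sqrt (M p 2 + p) / p"
        using p by (simp add: real_sqrt_divide)
      have "b * (x / real p) + c * inverse (real p) = (b * x + c) / real p" for b c x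
        by (simp add: divide_inverse algebra_simps)
      then show ?case unfolding 2 One_nat_def diagonal_bound.simps e .
    qed
    ultimately have "((\<lambda>p. diagonal_bound a (M p) p k / real p) \<longlongrightarrow> 2 ^ a * sqrt (0 + 0) + 2 ^ a / 2 * a * 0) primes_1_mod_4"
      by (rule Lim_transform_eventually)
    then show ?thesis by simp
  next
    case (3 m)
    have "((\<lambda>p. 2 ^ a * (closed_walk_bound a (M p) p m / real p) + 2 ^ a * (diagonal_bound a (M p) p m / real p))
        \<longlongrightarrow> 2 ^ a * 0 + 2 ^ a * 0) primes_1_mod_4"
      using 3 by (intro tendsto_add tendsto_mult_left tendsto_closed_walk_bound M less.IH) auto
    then show ?thesis using 3 by (simp add: add_divide_distrib)
  qed
qed

theorem theorem1p17:
  fixes a :: nat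
  assumes "a \<ge> 1"
    and "\<And>k::nat. k \<ge> 1 \<Longrightarrow>
      ((\<lambda>p. real p powr (- (real k / 2 + 1)) *
          Max ((\<lambda>Z. real_of_int \<bar>necklace_sum p k Z\<bar>) ` necklace_tuples p k a))
        \<longlongrightarrow> 0) primes_1_mod_4"
  shows "\<forall>I :: nat \<Rightarrow> int set.
      (\<forall>\<^sub>F p in primes_1_mod_4. I p \<in> independent_sets a (paley_graph p)) \<longrightarrow>
      weak_conv_filter
        (\<lambda>p. empirical_spectral_distribution
               ((2 ^ (a + 1) / sqrt (real p)) \<cdot>\<^sub>m adjacency_matrix (paley_localization p (I p))))
        (kesten_mckay (2 ^ a)) primes_1_mod_4"
proof (intro allI impI)
  fix I :: "nat \<Rightarrow> int set"
  assume I: "\<forall>\<^sub>F p in primes_1_mod_4. I p \<in> independent_sets a (paley_graph p)"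
  define M where "M p k = Max ((\<lambda>Z. real_of_int \<bar>necklace_sum p k Z\<bar>) ` necklace_tuples p k a)" for p k
  define V where "V p = verts (paley_localization p (I p))" for p
  define A where "A p = (2 ^ (a + 1) / sqrt (real p)) \<cdot>\<^sub>m adjacency_matrix (paley_localization p (I p))" for p
  let ?v = "2 ^ a :: real"
  have v: "?v \<ge> 2" using power_increasing[OF assms(1), of "2 :: real"] by simp
  note M = assms(2)[folded M_def]
  note cw = tendsto_closed_walk_bound[of M a, OF M] and db = tendsto_diagonal_bound[of M a, OF M]
  \<comment> \<open>The last condition forces \<open>V p\<close> to be non-empty, since an empty
    vertex set would make the error in \<open>v * card V\<close> equal to \<open>p\<close>. Only
    then is the empirical distribution specified.\<close>
  define Q where "Q p \<longleftrightarrow> prime p \<and> [p = 1] (mod 4) \<and> I p \<in> independent_sets a (paley_graph p)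
    \<and> diagonal_bound a (M p) p 1 / real p < 1" for p
  have Q: "eventually Q primes_1_mod_4"
    unfolding Q_def using eventually_primes_1_mod_4 I order_tendstoD(2)[OF db[of 1], of 1]
    by (simp add: eventually_conj_iff)
  have pis: "paley_independent_set p a (I p)" if "Q p" for p
    using that assms(1) by (simp add: Q_def paley_independent_set_def)
  have Mp: "paley_independent_set.necklace_max p a = M p" if "Q p" for p
    unfolding paley_independent_set.necklace_max_def[OF pis[OF that]] fun_eq_iff M_def by simp
  have Vp: "paley_independent_set.V p (I p) = V p" if "Q p" for p
    unfolding paley_independent_set.V_def[OF pis[OF that]] V_def ..
  have cardV: "\<bar>?v * real (card (V p)) - real p\<bar> \<le> diagonal_bound a (M p) p 1" if "Q p" for p
    using paley_independent_set.spectral_summary(1)[OF pis[OF that]] unfolding Mp[OF that] Vp[OF that] .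
  have finV: "finite (V p)" if "Q p" for p
    using paley_independent_set.finite_V[OF pis[OF that]] unfolding Vp[OF that] .
  have neV: "V p \<noteq> {}" if "Q p" for p
  proof
    assume "V p = {}"
    then have "real p \<le> diagonal_bound a (M p) p 1" using cardV[OF that] by simp
    then show False using that by (auto simp: Q_def divide_less_eq split: if_splits dest: prime_gt_0_nat)
  qed
  define R where "R p l m \<longleftrightarrow> proots (char_poly (A p)) = image_mset m (mset_set (V p))
      \<and> (\<forall>i\<in>V p. \<bar>l i\<bar> \<le> ?v)
      \<and> (\<forall>k. \<bar>\<Sum>i\<in>V p. kesten_mckay_poly ?v (Suc k) (l i)\<bar> \<le> closed_walk_bound a (M p) p k + diagonal_bound a (M p) p k)
      \<and> (\<forall>t. card {i\<in>V p. m i \<le> t} \<le> card {i\<in>V p. l i - ?v / sqrt p \<le> t} + 1)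
      \<and> (\<forall>t. card {i\<in>V p. l i - ?v / sqrt p \<le> t} \<le> card {i\<in>V p. m i \<le> t} + 1)" for p l m
  have "\<exists>l m. R p l m" if "Q p" for p
    using paley_independent_set.spectral_summary(2)[OF pis[OF that]]
    unfolding Mp[OF that] Vp[OF that] A_def[symmetric] R_def .
  then obtain l m where R: "\<And>p. Q p \<Longrightarrow> R p (l p) (m p)" by metis
  have lm:
    "proots (char_poly (A p)) = image_mset (m p) (mset_set (V p))"
    "\<And>i. i \<in> V p \<Longrightarrow> \<bar>l p i\<bar> \<le> ?v"
    "\<And>k. \<bar>\<Sum>i\<in>V p. kesten_mckay_poly ?v (Suc k) (l p i)\<bar> \<le> closed_walk_bound a (M p) p k + diagonal_bound a (M p) p k"
    "\<And>t. card {i\<in>V p. m p i \<le> t} \<le> card {i\<in>V p. l p i - ?v / sqrt p \<le> t} + 1"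
    "\<And>t. card {i\<in>V p. l p i - ?v / sqrt p \<le> t} \<le> card {i\<in>V p. m p i \<le> t} + 1" if "Q p" for p
    using R[OF that] unfolding R_def by blast+
  show "weak_conv_filter (\<lambda>p. empirical_spectral_distribution
      ((2 ^ (a + 1) / sqrt (real p)) \<cdot>\<^sub>m adjacency_matrix (paley_localization p (I p))))
      (kesten_mckay (2 ^ a)) primes_1_mod_4"
    unfolding weak_conv_filter_def A_def[symmetric]
  proof (intro allI impI)
    fix f :: "real \<Rightarrow> real" assume f: "continuous_on UNIV f" "bounded (range f)"
    show "((\<lambda>p. integral\<^sup>L (empirical_spectral_distribution (A p)) f) \<longlongrightarrow> integral\<^sup>L (kesten_mckay ?v) f) primes_1_mod_4"
    proof (rule tendsto_primes_1_mod_4_sequentially[OF Q])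
      fix X :: "nat \<Rightarrow> nat" assume QX: "\<And>n. Q (X n)" and X: "filterlim X primes_1_mod_4 sequentially"
      note pos = QX[unfolded Q_def, THEN conjunct1, THEN prime_gt_0_nat]
      note fin = finV[OF QX] and ne = neV[OF QX]
      note lims = filterlim_compose[OF _ X]
      have Xtop: "filterlim (\<lambda>n. real (X n)) at_top sequentially" by (rule lims[OF primes_1_mod_4_at_top])
      \<comment> \<open>This limit replaces the normalization by \<open>p\<close>, natural for
        traces, by the number of vertices, and shows that the latter tends to infinity.\<close>
      have ratio: "(\<lambda>n. real (card (V (X n))) / real (X n)) \<longlonglongrightarrow> 1 / ?v"
      proof -
        have "(\<lambda>n. ?v * real (card (V (X n))) / real (X n) - 1) \<longlonglongrightarrow> 0"
        proof (rule Lim_null_comparison[OF always_eventually lims[OF db[of 1]]], rule allI)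
          fix n
          have "?v * real (card (V (X n))) / real (X n) - 1 = (?v * real (card (V (X n))) - real (X n)) / real (X n)"
            using pos[of n] by (simp add: diff_divide_distrib)
          then show "norm (?v * real (card (V (X n))) / real (X n) - 1) \<le> diagonal_bound a (M (X n)) (X n) 1 / real (X n)"
            using cardV[OF QX, of n] by (simp add: divide_right_mono)
        qed
        then have "(\<lambda>n. (?v * real (card (V (X n))) / real (X n) - 1 + 1) / ?v) \<longlonglongrightarrow> (0 + 1) / ?v"
          by (intro tendsto_divide tendsto_add tendsto_const) auto
        then show ?thesis by simp
      qed
      have cardtop: "filterlim (\<lambda>n. real (card (V (X n)))) at_top sequentially"
      proof -
        have "filterlim (\<lambda>n. real (card (V (X n))) / real (X n) * real (X n)) at_top sequentially"
          by (rule filterlim_tendsto_pos_mult_at_top[OF ratio _ Xtop]) simp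
        then show ?thesis using pos by (simp add: less_imp_neq[symmetric])
      qed
      have lim: "(\<lambda>n. (\<Sum>i\<in>V (X n). kesten_mckay_poly ?v (Suc k) (l (X n) i)) / card (V (X n))) \<longlonglongrightarrow> 0" for k
      proof -
        have "(\<lambda>n. closed_walk_bound a (M (X n)) (X n) k / real (X n) + diagonal_bound a (M (X n)) (X n) k / real (X n)) \<longlonglongrightarrow> 0 + 0"
          by (intro tendsto_add lims[OF cw] lims[OF db])
        then have b: "(\<lambda>n. (closed_walk_bound a (M (X n)) (X n) k + diagonal_bound a (M (X n)) (X n) k) / real (X n)) \<longlonglongrightarrow> 0"
          by (simp add: add_divide_distrib)
        have "(\<lambda>n. (\<Sum>i\<in>V (X n). kesten_mckay_poly ?v (Suc k) (l (X n) i)) / real (X n)) \<longlonglongrightarrow> 0"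
        proof (rule Lim_null_comparison[OF always_eventually b], rule allI)
          fix n
          show "norm ((\<Sum>i\<in>V (X n). kesten_mckay_poly ?v (Suc k) (l (X n) i)) / real (X n))
              \<le> (closed_walk_bound a (M (X n)) (X n) k + diagonal_bound a (M (X n)) (X n) k) / real (X n)"
            using divide_right_mono[OF lm(3)[OF QX[of n], of k], of "real (X n)"]
            by (simp del: kesten_mckay_poly.simps)
        qed
        from tendsto_divide[OF this ratio]
        have "(\<lambda>n. (\<Sum>i\<in>V (X n). kesten_mckay_poly ?v (Suc k) (l (X n) i)) / real (X n) / (real (card (V (X n))) / real (X n))) \<longlonglongrightarrow> 0"
          by simp
        then show ?thesis using pos by (simp add: less_imp_neq[symmetric] del: kesten_mckay_poly.simps)
      qed
      have d: "(\<lambda>n. ?v / sqrt (X n)) \<longlonglongrightarrow> 0"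
        by (rule tendsto_divide_0[OF tendsto_const filterlim_at_top_imp_at_infinity[OF filterlim_compose[OF sqrt_at_top Xtop]]])
      have "weak_conv_m (\<lambda>n. uniform_image (V (X n)) (\<lambda>i. l (X n) i - ?v / sqrt (X n))) (kesten_mckay ?v)"
        by (rule weak_conv_shifted[OF v fin ne lim lm(2)[OF QX] d])
      then have "weak_conv_m (\<lambda>n. uniform_image (V (X n)) (m (X n))) (kesten_mckay ?v)"
        by (rule weak_conv_count_perturbation[OF fin ne cardtop _ lm(4)[OF QX] lm(5)[OF QX]])
      then have "weak_conv_filter (\<lambda>n. uniform_image (V (X n)) (m (X n))) (kesten_mckay ?v) sequentially"
        by (subst weak_conv_filter_sequentially) (auto intro: real_distribution_uniform_image real_distribution_kesten_mckay v)
      moreover have "empirical_spectral_distribution (A (X n)) = uniform_image (V (X n)) (m (X n))" for n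
        by (rule empirical_spectral_distribution_eq[OF lm(1)[OF QX] fin ne])
      ultimately show "(\<lambda>n. integral\<^sup>L (empirical_spectral_distribution (A (X n))) f) \<longlonglongrightarrow> integral\<^sup>L (kesten_mckay ?v) f"
        using f unfolding weak_conv_filter_def by simp
    qed
  qed
qed

end
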